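(* Let $n\geq 2$ be an integer. Let $P_{*}(f)$ be a differential polynomial in $f$ of degree $n-1$ with rational functions as its coefficients, let $\alpha_{1},\alpha_{2}$ be nonconstant polynomials, and let $p_{1},p_{2}$ be rational functions that are not identically zero. If $f$ is a transcendental meromorphic solution (in $\mathbb{C}$) of $$f^{n}(z)+P_{*}(f)=p_{1}(z)e^{\alpha_{1}(z)}+p_{2}(z)e^{\alpha_{2}(z)}$$ with $\lambda_{f}:=\max\{\lambda(f),\lambda(1/f)\}<\sigma(f)$, then $\sigma(f)=\deg\alpha_{1}=\deg\alpha_{2}$, and one of the following holds: (I) $\alpha_{2}'=\alpha_{1}'$. In this case, $f=s_{1}(z)\exp(\alpha_{1}(z)/n)=s_{2}(z)\exp(\alpha_{2}(z)/n)$, where $s_{1}$ and $s_{2}$ are rational functions satisfying $s_{1}^{n}=p_{1}+p_{2}c_{2}$ and $s_{2}^{n}=\frac{1}{c_{2}}p_{1}+p_{2}$, and $c_{2}=e^{\alpha_{2}-\alpha_{1}}$ is a nonzero constant. (II) $k_{1}\alpha_{1}'=n\alpha_{2}'$, where $k_{1}$ is an integer satisfying $1\leq k_{1}\leq n-1$. In this case, $f(z)=s_{3}(z)e^{\alpha_{1}(z)/n}$, where $s_{3}$ is a rational function satisfying $s_{3}^{n}=p_{1}$. (III) $k_{2}\alpha_{2}'=n\alpha_{1}'$, where $k_{2}$ is an integer satisfying $1\leq k_{2}\leq n-1$. In this case, $f(z)=s_{4}(z)e^{\alpha_{2}(z)/n}$, where $s_{4}$ is a rational function satisfying $s_{4}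^{n}=p_{2}$.
   Context: For a meromorphic function $f$ on $\mathbb{C}$ with Nevanlinna characteristic $T(r,f)$, $\sigma(f)=\limsup_{r\to\infty}\frac{\log^{+} T(r,f)}{\log r}$ is the order of $f$, $\lambda(f)$ is the exponent of convergence of the zeros of $f$, and $\lambda(1/f)$ is the exponent of convergence of the poles of $f$. A differential polynomial in $f$ is a finite sum of terms $a_\lambda f^{l_0}(f')^{l_1}\cdots(f^{(k)})^{l_k}$ with coefficients $a_\lambda$ (here rational functions of $z$) and nonnegative integers $l_j$; its degree is the maximum of $l_0+l_1+\cdots+l_k$ over its terms. *)

theory Defs
  imports
    "HOL-Complex_Analysis.Complex_Analysis"
    "HOL-Computational_Algebra.Computational_Algebra"
    "HOL-Computational_Algebra.Field_as_Ring"
    "HOL-Library.Poly_Mapping"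
begin

text \<open>
  A meromorphic function on the plane is an \<^term>\<open>f :: complex \<Rightarrow> complex\<close> with
  \<^term>\<open>f meromorphic_on UNIV\<close>. The values of \<^term>\<open>f\<close> on a sparse set (in particular at its poles)
  carry no information, so identities between meromorphic functions are stated on a cosparse set;
  the growth and counting notions below do not depend on such values.
\<close>

type_synonym ratfun = "complex poly fract"

text \<open>
  The reduced representation is evaluated, so the poles of \<^term>\<open>R\<close>
  are the only points with a zero denominator.
\<close>
definition ratfun_eval :: "ratfun \<Rightarrow> complex \<Rightarrow> complex" where
  "ratfun_eval R z = poly (fst (quot_of_fract R)) z / poly (snd (quot_of_fract R)) z"

lemma ratfun_eval_Fract:
  assumes "poly q z \<noteq> 0"
  shows "ratfun_eval (Fract p q) z = poly p z / poly q z"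
proof -
  define a b where "a = fst (quot_of_fract (Fract p q))" and "b = snd (quot_of_fract (Fract p q))"
  have q: "q \<noteq> 0" using assms by auto
  have b: "b \<noteq> 0" unfolding b_def by simp
  have "Fract a b = Fract p q"
    unfolding a_def b_def by (simp add: Fract_quot_of_fract)
  hence eq: "a * q = p * b" using q b by (simp add: eq_fract)
  have "coprime a b" unfolding a_def b_def by (rule coprime_quot_of_fract)
  hence "b dvd q" using eq by (metis coprime_commute coprime_dvd_mult_right_iff dvd_triv_right)
  hence bz: "poly b z \<noteq> 0" using assms by (auto simp: dvd_def)
  have "poly a z * poly q z = poly p z * poly b z" using eq by (metis poly_mult)
  thus ?thesis using assms bz
    unfolding ratfun_eval_def a_def[symmetric] b_def[symmetric] by (simp add: field_simps)
qed

definition ratfun_const :: "complex \<Rightarrow> ratfun" where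
  "ratfun_const c = to_fract [:c:]"

definition transcendental_meromorphic :: "(complex \<Rightarrow> complex) \<Rightarrow> bool" where
  "transcendental_meromorphic f \<longleftrightarrow>
     f meromorphic_on UNIV \<and> \<not> (\<exists>R. \<forall>\<^sub>\<approx>z\<in>UNIV. f z = ratfun_eval R z)"

definition log_plus :: "real \<Rightarrow> real" where
  "log_plus x = ln (max 1 x)"

definition proximity :: "real \<Rightarrow> (complex \<Rightarrow> complex) \<Rightarrow> real" where
  "proximity r f =
     integral {0..2*pi} (\<lambda>\<theta>. log_plus (norm (f (of_real r * cis \<theta>)))) / (2 * pi)"

definition pole_count :: "real \<Rightarrow> (complex \<Rightarrow> complex) \<Rightarrow> nat" where
  "pole_count t f = (\<Sum>z | z \<in> cball 0 t \<and> is_pole f z. nat (- zorder f z))"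

definition integrated_pole_count :: "real \<Rightarrow> (complex \<Rightarrow> complex) \<Rightarrow> real" where
  "integrated_pole_count r f =
     integral {0..r} (\<lambda>t. (real (pole_count t f) - real (pole_count 0 f)) / t)
       + real (pole_count 0 f) * ln r"

definition nevanlinna_char :: "real \<Rightarrow> (complex \<Rightarrow> complex) \<Rightarrow> real" where
  "nevanlinna_char r f = proximity r f + integrated_pole_count r f"

definition growth_order :: "(complex \<Rightarrow> complex) \<Rightarrow> ereal" where
  "growth_order f = Limsup at_top (\<lambda>r::real. ereal (log_plus (nevanlinna_char r f) / ln r))"

text \<open>
  The exponent of convergence of the zeros is the infimum of all \<open>\<tau> \<ge> 0\<close> for which the sum of
  \<open>1 / \<bar>z\<bar>\<^sup>\<tau>\<close> over the nonzero zeros, repeated according to multiplicity, converges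
  (\<open>\<infinity>\<close> if there is no such \<open>\<tau>\<close>). That of the poles of \<^term>\<open>f\<close> is obtained by
  applying it to \<^term>\<open>\<lambda>z. 1 / f z\<close>.
\<close>
definition conv_exponent :: "(complex \<Rightarrow> complex) \<Rightarrow> ereal" where
  "conv_exponent f =
     Inf (ereal ` {\<tau>. \<tau> \<ge> 0 \<and>
       (\<lambda>z. real (nat (zorder f z)) * norm z powr (- \<tau>)) summable_on
         {z. z \<noteq> 0 \<and> isolated_zero f z}})"

text \<open>
  The monomial \<open>f\<^bsup>l\<^sub>0\<^esup> (f')\<^bsup>l\<^sub>1\<^esup> \<cdots>\<close> is encoded by the
  finitely supported exponent function \<open>l\<close>, and a differential polynomial by its finitely many
  monomials with nonzero coefficient.
\<close>
type_synonym diffpoly = "(nat \<Rightarrow>\<^sub>0 nat) \<Rightarrow>\<^sub>0 ratfun"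

definition diffpoly_degree :: "diffpoly \<Rightarrow> nat" where
  "diffpoly_degree P =
     Max (insert 0 ((\<lambda>l. \<Sum>j\<in>Poly_Mapping.keys l. Poly_Mapping.lookup l j) ` Poly_Mapping.keys P))"

definition diffpoly_eval :: "diffpoly \<Rightarrow> (complex \<Rightarrow> complex) \<Rightarrow> complex \<Rightarrow> complex" where
  "diffpoly_eval P f z =
     (\<Sum>l\<in>Poly_Mapping.keys P. ratfun_eval (Poly_Mapping.lookup P l) z *
        (\<Prod>j\<in>Poly_Mapping.keys l. (deriv ^^ j) f z ^ Poly_Mapping.lookup l j))"

end

theory Submission
  imports Defs "HOL-Real_Asymp.Real_Asymp"
begin

text \<open>
  Since the zeros and poles of \<open>f\<close> are sparse relative to its order, canonical products give
  \<open>f = d\<^sub>1 / d\<^sub>2 \<cdot> e\<^bsup>h\<^esup>\<close> with \<open>h\<close> entire and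
  \<open>log \<bar>d\<^sub>i(z)\<bar> = O(\<bar>z\<bar>\<^sup>\<tau>)\<close> for some \<open>\<tau> < \<sigma>(f)\<close>.
  Clearing denominators turns the differential equation into an identity
  \<open>G e\<^bsup>nh\<^esup> + \<Sum>\<^bsub>j<n\<^esub> A\<^sub>j e\<^bsup>jh\<^esup> = B\<^sub>1 e\<^bsup>\<alpha>\<^sub>1\<^esup> + B\<^sub>2 e\<^bsup>\<alpha>\<^sub>2\<^esup>\<close>
  whose coefficients are polynomials in \<open>d\<^sub>1, d\<^sub>2, h', h'', \<dots>\<close> and the data.
  Where \<open>Re h\<close> is large this bounds \<open>Re h\<close> by the logarithms of the coefficients; averaged over
  circles (Jensen's inequality controls \<open>1 / G\<close>), it yields an inequality for the mean \<open>U(r)\<close> of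
  the positive part of \<open>Re h\<close> whose right-hand side contains only \<open>log U\<close>. Iterating it on a bounded
  range of radii forces polynomial growth of \<open>U\<close>, so \<open>h\<close> is a polynomial, of degree \<open>> \<tau>\<close>.
  Borel's theorem on exponential sums, with exponents grouped modulo polynomials of degree
  \<open>\<le> \<tau>\<close>, then shows that \<open>f\<^sup>n\<close> is \<open>p\<^sub>1 e\<^bsup>\<alpha>\<^sub>1\<^esup>\<close>, \<open>p\<^sub>2 e\<^bsup>\<alpha>\<^sub>2\<^esup>\<close> or their sum.
  In the first two cases \<open>f = s e\<^bsup>\<alpha>\<^sub>i/n\<^esup>\<close> with \<open>s\<close> rational, and a second application of Borel's theorem to
  \<open>P(f)\<close> relates \<open>\<alpha>\<^sub>1'\<close> and \<open>\<alpha>\<^sub>2'\<close>. In the third, an \<open>n\<close>-th power \<open>P\<^sub>1 + P\<^sub>2 e\<^bsup>\<beta>\<^esup>\<close> has only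
  finitely many zeros, being multiple ones, which is impossible for nonconstant \<open>\<beta>\<close>.
\<close>

section \<open>Circle means and Jensen's inequality\<close>

text \<open>The hypotheses allow \<sigma>(f) to be infinite, so h starts as an arbitrary entire
  function and the coefficients, which contain its derivatives, have no known growth. They are,
  however, polynomial in these derivatives. On |z| \<le> r, h and each derivative are bounded by
  powers of r, 1/\<delta> and 1 + U(r + \<delta>) up to constants, so their logarithms cost only log
  U(r + \<delta>) and log(1/\<delta>), far less than the U(r) that they are to bound. Once h is a
  polynomial, the same calculus is run without the log U term; this is why the growth classes carry
  a parameter \<open>W\<close>.

  Coefficients have zeros, so no estimate divides by one pointwise. Bounds take the form |G| exp
  \<psi> \<le> exp B and are averaged over a circle, where Jensen's inequality makes the mean of
  -log |G| at most a constant.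

  The gap \<tau> < \<sigma>(f) makes the degree of h exceed \<tau>. Then no difference (n - j) h
  with j < n has degree \<le> \<tau>, so the group of the exponent n h can contain, besides itself,
  only \<alpha>1 and \<alpha>2.\<close>

definition circ_mean :: "real \<Rightarrow> (complex \<Rightarrow> real) \<Rightarrow> real" where
  "circ_mean r g = integral {0..2*pi} (\<lambda>\<theta>. g (of_real r * cis \<theta>)) / (2 * pi)"

lemma continuous_on_circle:
  fixes g :: "complex \<Rightarrow> 'b::topological_space"
  assumes "continuous_on (sphere 0 r) g" "r \<ge> 0"
  shows "continuous_on S (\<lambda>\<theta>. g (of_real r * cis \<theta>))"
  by (rule continuous_on_compose2[OF assms(1)])
     (use assms(2) in \<open>auto intro!: continuous_intros simp: norm_mult\<close>)

lemma integrable_on_circle: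
  fixes g :: "complex \<Rightarrow> 'b::banach"
  assumes "continuous_on (sphere 0 r) g" "r \<ge> 0"
  shows "(\<lambda>\<theta>. g (of_real r * cis \<theta>)) integrable_on {0..2*pi}"
  by (intro integrable_continuous_interval continuous_on_circle assms)

lemma circ_mean_cong:
  assumes "\<And>z. z \<in> sphere 0 r \<Longrightarrow> g z = h z" "r \<ge> 0"
  shows "circ_mean r g = circ_mean r h"
proof -
  have "g (of_real r * cis t) = h (of_real r * cis t)" for t
    using assms by (auto simp: norm_mult)
  thus ?thesis by (simp add: circ_mean_def)
qed

lemma circ_mean_mono:
  assumes "continuous_on (sphere 0 r) g" "continuous_on (sphere 0 r) h" "r \<ge> 0"
    and "\<And>z. z \<in> sphere 0 r \<Longrightarrow> g z \<le> h z"
  shows "circ_mean r g \<le> circ_mean r h"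
  unfolding circ_mean_def
  by (intro divide_right_mono integral_le integrable_on_circle assms) 
     (use assms(3) in \<open>auto simp: norm_mult\<close>)

lemma circ_mean_add:
  assumes "continuous_on (sphere 0 r) g" "continuous_on (sphere 0 r) h" "r \<ge> 0"
  shows "circ_mean r (\<lambda>z. g z + h z) = circ_mean r g + circ_mean r h"
  unfolding circ_mean_def
  by (subst Henstock_Kurzweil_Integration.integral_add)
     (auto intro!: integrable_on_circle assms simp: add_divide_distrib)

lemma circ_mean_cmult: "circ_mean r (\<lambda>z. c * g z) = c * circ_mean r g"
  by (simp add: circ_mean_def)

lemma circ_mean_diff:
  assumes "continuous_on (sphere 0 r) g" "continuous_on (sphere 0 r) h" "r \<ge> 0"
  shows "circ_mean r (\<lambda>z. g z - h z) = circ_mean r g - circ_mean r h"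
  unfolding circ_mean_def
  by (subst Henstock_Kurzweil_Integration.integral_diff)
     (auto intro!: integrable_on_circle assms simp: diff_divide_distrib)

lemma circ_mean_const [simp]: "circ_mean r (\<lambda>_. c) = c"
  by (simp add: circ_mean_def)

lemma circ_mean_sum:
  assumes "finite I" "\<And>i. i \<in> I \<Longrightarrow> continuous_on (sphere 0 r) (g i)" "r \<ge> 0"
  shows "circ_mean r (\<lambda>z. \<Sum>i\<in>I. g i z) = (\<Sum>i\<in>I. circ_mean r (g i))"
  unfolding circ_mean_def sum_divide_distrib[symmetric]
  by (subst integral_sum) (auto intro!: integrable_on_circle assms)

text \<open>Cauchy's formula at the centre: on the circle dz / z = i dt.\<close>

lemma holomorphic_mean_value:
  fixes g :: "complex \<Rightarrow> complex"
  assumes "g holomorphic_on ball 0 R" "0 < r" "r < R"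
  shows "integral {0..2*pi} (\<lambda>\<theta>. g (of_real r * cis \<theta>)) = 2 * pi * g 0"
proof -
  have "((\<lambda>u. g u / (u - 0)) has_contour_integral (2 * of_real pi * \<i> * g 0)) (circlepath 0 r)"
    by (rule Cauchy_integral_circlepath_simple)
       (use assms in \<open>auto intro!: holomorphic_on_subset[OF assms(1)]\<close>)
  hence "((\<lambda>t. g (0 + of_real r * cis t) / (0 + of_real r * cis t - 0) * r * \<i> * cis t)
           has_integral (2 * of_real pi * \<i> * g 0)) {0..2*pi}"
    unfolding circlepath_def
    by (subst (asm) has_contour_integral_part_circlepath_iff) (auto simp: add.commute)
  also have "(\<lambda>t. g (0 + of_real r * cis t) / (0 + of_real r * cis t - 0) * r * \<i> * cis t) =
     (\<lambda>t. \<i> * g (of_real r * cis t))"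
    using assms by (auto simp: field_simps)
  finally have "integral {0..2*pi} (\<lambda>t. \<i> * g (of_real r * cis t)) = 2 * of_real pi * \<i> * g 0"
    by (rule integral_unique)
  thus ?thesis by simp
qed

lemma circ_mean_Re_holomorphic:
  assumes "g holomorphic_on ball 0 R" "0 < r" "r < R"
  shows "circ_mean r (\<lambda>z. Re (g z)) = Re (g 0)"
proof -
  have "continuous_on (sphere 0 r) g"
    by (rule continuous_on_subset[OF holomorphic_on_imp_continuous_on[OF assms(1)]])
       (use assms in auto)
  hence "(\<lambda>\<theta>. g (of_real r * cis \<theta>)) integrable_on {0..2*pi}"
    by (rule integrable_on_circle) (use assms in auto)
  hence "Re (integral {0..2*pi} (\<lambda>\<theta>. g (of_real r * cis \<theta>))) =
        integral {0..2*pi} (\<lambda>\<theta>. Re (g (of_real r * cis \<theta>)))"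
    using integral_linear[OF _ bounded_linear_Re] by (force simp: o_def)
  thus ?thesis
    unfolding circ_mean_def using holomorphic_mean_value[OF assms] by (simp add: field_simps)
qed

text \<open>On a zero-free disc ln |g| is the real part of a holomorphic logarithm of g, so the mean
  value property applies.\<close>

lemma circ_mean_ln_norm_holomorphic:
  assumes "g holomorphic_on ball 0 R" "0 < r" "r < R" "\<And>z. z \<in> ball 0 R \<Longrightarrow> g z \<noteq> 0"
  shows "circ_mean r (\<lambda>z. ln (norm (g z))) = ln (norm (g 0))"
proof -
  obtain L where L: "L holomorphic_on ball 0 R" "\<And>z. z \<in> ball 0 R \<Longrightarrow> exp (L z) = g z"
    using holomorphic_logarithm_exists[of "ball 0 R" g 0] assms by auto
  have *: "ln (norm (g z)) = Re (L z)" if "z \<in> ball 0 R" for z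
    using L(2)[OF that, symmetric] by simp
  have "circ_mean r (\<lambda>z. ln (norm (g z))) = circ_mean r (\<lambda>z. Re (L z))"
    by (rule circ_mean_cong) (use assms * in auto)
  also have "\<dots> = Re (L 0)" by (rule circ_mean_Re_holomorphic[OF L(1)]) (use assms in auto)
  finally show ?thesis using *[of 0] assms by simp
qed

text \<open>The mean equals the maximum of ln |w| and ln r: the integrand is harmonic inside when w
  lies outside the circle, and w is reflected when it lies inside. Jensen's inequality uses only the
  lower bound. Points w on the circle are left out to keep the integrand continuous.\<close>

lemma circ_mean_ln_dist_ge:
  assumes "w \<noteq> 0" "0 < r" "r \<noteq> norm w"
  shows "circ_mean r (\<lambda>z. ln (norm (z - w))) \<ge> ln (norm w)"
proof (cases "r < norm w")
  case True
  have "circ_mean r (\<lambda>z. ln (norm (z - w))) = ln (norm (0 - w))"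
    by (rule circ_mean_ln_norm_holomorphic[where R = "norm w"])
       (use assms True in \<open>auto intro!: holomorphic_intros\<close>)
  thus ?thesis by simp
next
  case False
  hence less: "norm w < r" using assms by auto
  \<comment> \<open>the reflected factor, zero-free in the disc, has the same modulus on the circle\<close>
  define g where "g = (\<lambda>z. of_real r - z * cnj w / of_real r)"
  have "norm (z - w) = norm (g z)" if "z \<in> sphere 0 r" for z
  proof -
    have z: "norm z = r" using that by simp
    hence "of_real r ^ 2 = z * cnj z" by (simp add: complex_norm_square[symmetric])
    hence "g z = z * cnj (z - w) / of_real r" 
      unfolding g_def using assms by (simp add: field_simps power2_eq_square)
    hence "norm (g z) = norm (z * cnj (z - w)) / r"
      using assms by (simp add: norm_divide)
    also have "\<dots> = norm (z - w)" unfolding norm_mult complex_mod_cnj z using assms by simp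
    finally show ?thesis by simp
  qed
  hence "circ_mean r (\<lambda>z. ln (norm (z - w))) = circ_mean r (\<lambda>z. ln (norm (g z)))"
    by (intro circ_mean_cong) (use assms in auto)
  also have "\<dots> = ln (norm (g 0))"
  \<comment> \<open>The only zero of \<open>g\<close> is the mirror image r^2 / cnj w of w (there is
    none for w = 0, which is excluded), at distance r^2 / |w| > r from the origin.\<close>
  proof (rule circ_mean_ln_norm_holomorphic[where R = "r\<^sup>2 / norm w"])
    show "g z \<noteq> 0" if "z \<in> ball 0 (r\<^sup>2 / norm w)" for z
    proof
      assume "g z = 0"
      hence "z * cnj w = of_real (r ^ 2)" using assms unfolding g_def 
        by (simp add: field_simps power2_eq_square)
      hence "norm (z * cnj w) = r ^ 2" by (simp only: norm_of_real) simp
      thus False using that assms by (simp add: norm_mult field_simps)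
    qed
  qed (use assms less in \<open>auto simp: g_def field_simps power2_eq_square intro!: holomorphic_intros\<close>)
  also have "\<dots> = ln r" using assms by (simp add: g_def)
  finally show ?thesis using less assms by simp
qed

text \<open>The local factorisation at a zero is continued to the whole plane by the quotient E z /
  (z - a)^n away from a. The order is 0 if a is not a zero; \<open>w0\<close> only witnesses that E
  is not the zero function.\<close>

lemma entire_factor_zero:
  assumes "E holomorphic_on UNIV" "E w0 \<noteq> 0"
  obtains G n where "G holomorphic_on UNIV" "G a \<noteq> 0" "\<And>z. E z = (z - a) ^ n * G z"
proof (cases "E a = 0")
  case False
  thus ?thesis using that[of E 0] assms by auto
next
  case True
  have "\<not> E constant_on UNIV" using assms True by (metis UNIV_I constant_on_def)
  moreover have "connected (UNIV :: complex set)" by (simp add: connected_UNIV)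
  ultimately obtain g r n where *: "0 < n" "0 < r" "g holomorphic_on ball a r"
       "\<And>w. w \<in> ball a r \<Longrightarrow> E w = (w - a) ^ n * g w" "\<And>w. w \<in> ball a r \<Longrightarrow> g w \<noteq> 0"
    using holomorphic_factor_zero_nonconstant[OF assms(1) open_UNIV _ UNIV_I[of a] True] by (metis (no_types, lifting))
  define G where "G = (\<lambda>z. if z = a then g a else E z / (z - a) ^ n)"
  have "G z = g z" if "z \<in> ball a r" for z
    using *(4)[OF that] by (auto simp: G_def)
  hence "G holomorphic_on ball a r"
    using *(3) holomorphic_cong by metis
  moreover have "(\<lambda>z. E z / (z - a) ^ n) holomorphic_on -{a}"
    by (intro holomorphic_intros holomorphic_on_subset[OF assms(1)]) auto
  hence "G holomorphic_on -{a}"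
    by (rule holomorphic_transform) (auto simp: G_def)
  ultimately have "G holomorphic_on (ball a r \<union> -{a})"
    by (intro holomorphic_on_Un) auto
  moreover have "ball a r \<union> -{a} = UNIV" using *(2) by auto
  ultimately have "G holomorphic_on UNIV" by simp
  moreover have "E z = (z - a) ^ n * G z" for z
    using * True by (auto simp: G_def)
  moreover have "G a \<noteq> 0" using * by (auto simp: G_def)
  ultimately show ?thesis using that by blast
qed

lemma entire_factor_finite_zeros:
  assumes "finite Z" "E holomorphic_on UNIV" "E w0 \<noteq> 0"
  obtains G k where "G holomorphic_on UNIV" "\<And>w. w \<in> Z \<Longrightarrow> G w \<noteq> 0" 
    "\<And>z. E z = (\<Prod>w\<in>Z. (z - w) ^ k w) * G z"
proof -
  have "\<exists>G k. G holomorphic_on UNIV \<and> (\<forall>w\<in>Z. G w \<noteq> 0) \<and> (\<forall>z. E z = (\<Prod>w\<in>Z. (z - w) ^ k w) * G z)"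
    using assms(1)
  proof induction
    case empty
    thus ?case using assms by auto
  next
    case (insert a Z)
    then obtain G k where *: "G holomorphic_on UNIV" "\<forall>w\<in>Z. G w \<noteq> 0"
       "\<And>z. E z = (\<Prod>w\<in>Z. (z - w) ^ k w) * G z" by blast
    have "G w0 \<noteq> 0" using *(3)[of w0] assms by auto
    then obtain H n where H: "H holomorphic_on UNIV" "H a \<noteq> 0" "\<And>z. G z = (z - a) ^ n * H z"
      using entire_factor_zero[OF *(1)] by metis
    have "(\<Prod>w\<in>Z. (z - w) ^ (k(a := n)) w) = (\<Prod>w\<in>Z. (z - w) ^ k w)" for z
      by (rule prod.cong) (use insert in auto)
    hence "E z = (\<Prod>w\<in>insert a Z. (z - w) ^ (k(a := n)) w) * H z" for z
      using insert(1,2) by (simp add: *(3) H(3))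
    moreover have "\<forall>w\<in>insert a Z. H w \<noteq> 0"
      using *(2) H by auto
    ultimately show ?case using H(1) by blast
  qed
  thus ?thesis using that by blast
qed

lemma entire_finite_zeros_cball:
  assumes "E holomorphic_on UNIV" "E w0 \<noteq> 0"
  shows "finite {z \<in> cball 0 r. E z = 0}"
proof (cases "E constant_on UNIV")
  case True
  thus ?thesis using assms by (auto simp: constant_on_def)
next
  case False
  thus ?thesis using assms by (intro holomorphic_compact_finite_zeros[where S = UNIV]) auto
qed

text \<open>After division by the zeros in a slightly larger disc, the quotient contributes its
  exact value at 0, and each linear factor contributes at least ln |w|.\<close>

lemma jensen_inequality:
  assumes E: "E holomorphic_on UNIV" "E 0 \<noteq> 0" and "r > 0" and nz: "\<And>z. z \<in> sphere 0 r \<Longrightarrow> E z \<noteq> 0"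
  shows "ln (norm (E 0)) \<le> circ_mean r (\<lambda>z. ln (norm (E z)))"
proof -
  \<comment> \<open>The margin 1 makes the cofactor zero-free on a disc strictly larger than the one
    bounded by the circle, as the mean value property requires.\<close>
  define Z where "Z = {z \<in> cball 0 (r+1). E z = 0}"
  have fin: "finite Z" unfolding Z_def using E by (rule entire_finite_zeros_cball)
  obtain G k where G: "G holomorphic_on UNIV" "\<And>w. w \<in> Z \<Longrightarrow> G w \<noteq> 0" 
    "\<And>z. E z = (\<Prod>w\<in>Z. (z - w) ^ k w) * G z"
    using entire_factor_finite_zeros[OF fin E] by blast
  have G0: "G z \<noteq> 0" if "z \<in> ball 0 (r+1)" for z
    using G(2,3)[of z] that by (cases "z \<in> Z") (auto simp: Z_def)
  have Z0: "w \<noteq> 0" "r \<noteq> norm w" if "w \<in> Z" for w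
    using that nz[of w] E by (auto simp: Z_def)
  have eq: "ln (norm (E z)) = (\<Sum>w\<in>Z. k w * ln (norm (z - w))) + ln (norm (G z))" 
    if "z \<in> ball 0 (r+1)" "E z \<noteq> 0" for z
  proof -
    have "z - w \<noteq> 0" if "w \<in> Z" for w using that \<open>E z \<noteq> 0\<close> by (auto simp: Z_def)
    hence "(\<Prod>w\<in>Z. norm (z - w) ^ k w) > 0" by (intro prod_pos) auto
    hence "ln (norm (E z)) = ln (\<Prod>w\<in>Z. norm (z - w) ^ k w) + ln (norm (G z))"
      unfolding G(3) norm_mult using G0[OF that(1)] fin
      by (subst ln_mult_pos) (auto simp: prod_norm[symmetric] norm_power)
    also have "ln (\<Prod>w\<in>Z. norm (z - w) ^ k w) = (\<Sum>w\<in>Z. ln (norm (z - w) ^ k w))"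
      using fin \<open>\<And>w. w \<in> Z \<Longrightarrow> z - w \<noteq> 0\<close> by (intro ln_prod) auto
    also have "\<dots> = (\<Sum>w\<in>Z. k w * ln (norm (z - w)))"
      by (intro sum.cong) (use \<open>\<And>w. w \<in> Z \<Longrightarrow> z - w \<noteq> 0\<close> in \<open>auto simp: ln_realpow\<close>)
    finally show ?thesis .
  qed
  have c1: "continuous_on (sphere 0 r) (\<lambda>z. ln (norm (z - w)))" if "w \<in> Z" for w
    using Z0[OF that] by (auto intro!: continuous_intros)
  have c2: "continuous_on (sphere 0 r) (\<lambda>z. ln (norm (G z)))"
    using G0 by (auto intro!: continuous_intros continuous_on_subset[OF holomorphic_on_imp_continuous_on[OF G(1)]])
  have c3: "continuous_on (sphere 0 r) (\<lambda>z. \<Sum>w\<in>Z. k w * ln (norm (z - w)))"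
    by (intro continuous_on_sum continuous_on_mult_left c1)
  have c4: "circ_mean r (\<lambda>z. \<Sum>w\<in>Z. k w * ln (norm (z - w))) = (\<Sum>w\<in>Z. k w * circ_mean r (\<lambda>z. ln (norm (z - w))))"
    using \<open>r > 0\<close> fin by (subst circ_mean_sum) (auto simp: circ_mean_cmult intro!: continuous_on_mult_left c1)
  have "ln (norm (E 0)) = (\<Sum>w\<in>Z. k w * ln (norm w)) + ln (norm (G 0))"
    using eq[of 0] E \<open>r > 0\<close> by simp
  also have "\<dots> \<le> (\<Sum>w\<in>Z. k w * circ_mean r (\<lambda>z. ln (norm (z - w)))) + circ_mean r (\<lambda>z. ln (norm (G z)))"
  proof (intro add_mono sum_mono mult_left_mono circ_mean_ln_dist_ge)
    have "circ_mean r (\<lambda>z. ln (norm (G z))) = ln (norm (G 0))"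
      by (rule circ_mean_ln_norm_holomorphic[where R = "r+1"])
         (use G0 \<open>r > 0\<close> in \<open>auto intro: holomorphic_on_subset[OF G(1)]\<close>)
    thus "ln (cmod (G 0)) \<le> circ_mean r (\<lambda>z. ln (cmod (G z)))" by simp
  qed (use Z0 \<open>r > 0\<close> in auto)
  also have "\<dots> = circ_mean r (\<lambda>z. (\<Sum>w\<in>Z. k w * ln (norm (z - w))) + ln (norm (G z)))"
    using \<open>r > 0\<close> c3 c2 by (simp add: circ_mean_add c4)
  also have "\<dots> = circ_mean r (\<lambda>z. ln (norm (E z)))"
    using nz \<open>r > 0\<close> by (intro circ_mean_cong) (auto simp: eq)
  finally show ?thesis .
qed

text \<open>Take logarithms and average: the mean of -ln |E| is bounded by Jensen's inequality,
  applied to E with its zero at the origin removed. The constant depends on E alone, not on r,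
  \<psi> or B.\<close>

lemma circ_mean_le_good_radius:
  assumes E: "E holomorphic_on UNIV" "E w0 \<noteq> 0"
  obtains C where "\<And>r \<psi> B. r \<ge> 1/2 \<Longrightarrow> continuous_on (sphere 0 r) \<psi> \<Longrightarrow>
     (\<And>z. z \<in> sphere 0 r \<Longrightarrow> E z \<noteq> 0 \<and> norm (E z) * exp (\<psi> z) \<le> exp B) \<Longrightarrow> circ_mean r \<psi> \<le> B + C"
proof -
  obtain G n where G: "G holomorphic_on UNIV" "G 0 \<noteq> 0" "\<And>z. E z = (z - 0) ^ n * G z"
    using entire_factor_zero[OF E] by blast
  have "circ_mean r \<psi> \<le> B + (n * ln 2 - ln (norm (G 0)))"
    if r: "r \<ge> 1/2" and cont: "continuous_on (sphere 0 r) \<psi>"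
    and le: "\<And>z. z \<in> sphere 0 r \<Longrightarrow> E z \<noteq> 0 \<and> norm (E z) * exp (\<psi> z) \<le> exp B" for r \<psi> B
  proof -
    have Gnz: "G z \<noteq> 0" if "z \<in> sphere 0 r" for z using le[OF that] G(3)[of z] by auto
    have cG: "continuous_on (sphere 0 r) (\<lambda>z. ln (norm (G z)))"
      using Gnz by (auto intro!: continuous_intros continuous_on_subset[OF holomorphic_on_imp_continuous_on[OF G(1)]])
    have "\<psi> z \<le> B + n * ln 2 - ln (norm (G z))" if z: "z \<in> sphere 0 r" for z
    proof -
      have "ln (norm (E z) * exp (\<psi> z)) \<le> B"
        using le[OF z] ln_mono[of "norm (E z) * exp (\<psi> z)" "exp B"] by simp
      hence "ln (norm (E z)) + \<psi> z \<le> B"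
        using le[OF z] by (simp add: ln_mult)
      moreover have "ln (norm (E z)) = n * ln r + ln (norm (G z))"
        using Gnz[OF z] z r by (simp add: G(3) norm_mult norm_power ln_mult ln_realpow)
      \<comment> \<open>Admitting radii down to 1/2 instead of 1 costs n ln 2, and lets
        \<open>circ_mean_le\<close> approach r = 1 from below.\<close>
      moreover have "ln r \<ge> - ln 2"
        using r ln_mono[of "1/2" r] by (simp add: ln_div)
      hence "n * ln r \<ge> n * (- ln 2)" by (intro mult_left_mono) auto
      ultimately show ?thesis by (simp add: algebra_simps)
    qed
    hence "circ_mean r \<psi> \<le> circ_mean r (\<lambda>z. B + n * ln 2 - ln (norm (G z)))"
      by (intro circ_mean_mono) (use r cont cG in \<open>auto intro!: continuous_intros\<close>)
    also have "\<dots> = B + n * ln 2 - circ_mean r (\<lambda>z. ln (norm (G z)))"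
      using r cG by (subst circ_mean_diff) auto
    also have "\<dots> \<le> B + n * ln 2 - ln (norm (G 0))"
      using jensen_inequality[OF G(1,2), of r] Gnz r by auto
    finally show ?thesis by simp
  qed
  thus ?thesis by (rule that)
qed

lemma good_radius_exists:
  assumes "E holomorphic_on UNIV" "E w0 \<noteq> 0" "0 \<le> a" "a < b"
  obtains r where "a < r" "r < b" "\<And>z. z \<in> sphere 0 r \<Longrightarrow> E z \<noteq> 0"
proof -
  have "finite (norm ` {z \<in> cball 0 b. E z = 0})"
    by (intro finite_imageI entire_finite_zeros_cball[OF assms(1,2)])
  moreover have "infinite {a<..<b}" using assms by simp
  ultimately have "infinite ({a<..<b} - norm ` {z \<in> cball 0 b. E z = 0})" by simp
  hence "{a<..<b} - norm ` {z \<in> cball 0 b. E z = 0} \<noteq> {}" by (metis finite.emptyI)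
  then obtain r where "r \<in> {a<..<b} - norm ` {z \<in> cball 0 b. E z = 0}" by blast
  thus ?thesis using that[of r] by force
qed

lemma isCont_circ_mean:
  assumes "continuous_on UNIV \<psi>"
  shows "isCont (\<lambda>r. circ_mean r \<psi>) r"
proof -
  have "continuous_on (cbox (r - 1) (r + 1)) (\<lambda>r. integral (cbox 0 (2*pi)) (\<lambda>\<theta>. \<psi> (of_real r * cis \<theta>)))"
    by (rule integral_continuous_on_param)
       (auto simp: case_prod_beta intro!: continuous_intros continuous_on_compose2[OF assms])
  hence "continuous_on {r - 1..r + 1} (\<lambda>r. circ_mean r \<psi>)"
    unfolding circ_mean_def by (auto intro!: continuous_intros)
  hence "continuous_on {r - 1<..<r + 1} (\<lambda>r. circ_mean r \<psi>)"
    by (rule continuous_on_subset) auto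
  thus ?thesis by (simp add: continuous_on_eq_continuous_at)
qed

text \<open>The circle of radius r may meet zeros of E. Radii just below r avoid them, the bound is
  assumed on the whole disc and so holds there too, and the mean of a continuous function is
  continuous in the radius.\<close>

lemma circ_mean_le:
  assumes E: "E holomorphic_on UNIV" "E w0 \<noteq> 0"
  obtains C where "C \<ge> 0" "\<And>r \<psi> B. r \<ge> 1 \<Longrightarrow> continuous_on UNIV \<psi> \<Longrightarrow>
     (\<And>z. norm z \<le> r \<Longrightarrow> norm (E z) * exp (\<psi> z) \<le> exp B) \<Longrightarrow> circ_mean r \<psi> \<le> B + C"
proof -
  obtain C where C: "\<And>r \<psi> B. r \<ge> 1/2 \<Longrightarrow> continuous_on (sphere 0 r) \<psi> \<Longrightarrow>
     (\<And>z. z \<in> sphere 0 r \<Longrightarrow> E z \<noteq> 0 \<and> norm (E z) * exp (\<psi> z) \<le> exp B) \<Longrightarrow> circ_mean r \<psi> \<le> B + C"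
    using circ_mean_le_good_radius[OF E] by blast
  have "circ_mean r \<psi> \<le> B + max 0 C"
    if r: "r \<ge> 1" and cont: "continuous_on UNIV \<psi>" and le: "\<And>z. norm z \<le> r \<Longrightarrow> norm (E z) * exp (\<psi> z) \<le> exp B" for r \<psi> B
  proof (rule ccontr)
    assume "\<not> ?thesis"
    hence "circ_mean r \<psi> > B + C" by simp
    moreover have "(\<lambda>r. circ_mean r \<psi>) \<midarrow>r\<rightarrow> circ_mean r \<psi>"
      using isCont_circ_mean[OF cont] by (simp add: isCont_def)
    hence "((\<lambda>r. circ_mean r \<psi>) \<longlongrightarrow> circ_mean r \<psi>) (at_left r)"
      by (rule filterlim_mono[OF _ order_refl at_le]) simp
    ultimately have "eventually (\<lambda>s. circ_mean s \<psi> > B + C) (at_left r)"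
      by (simp add: order_tendstoD(1))
    then obtain a where a: "a < r" "\<And>s. a < s \<Longrightarrow> s < r \<Longrightarrow> circ_mean s \<psi> > B + C"
      unfolding eventually_at_left_field by blast
    obtain s where s: "max a (1/2) < s" "s < r" "\<And>z. z \<in> sphere 0 s \<Longrightarrow> E z \<noteq> 0"
    proof (rule good_radius_exists[OF E])
      show "0 \<le> max a (1/2)" "max a (1/2) < r" using a r by auto
    qed blast
    have "circ_mean s \<psi> \<le> B + C"
      by (rule C) (use s le in \<open>auto intro: continuous_on_subset[OF cont]\<close>)
    with a(2)[of s] s show False by simp
  qed
  thus ?thesis using that[of "max 0 C"] by auto
qed

section \<open>Growth classes of entire functions\<close>

text \<open>
  The parameter \<open>\<delta>\<close> is the loss of radius in Cauchy's estimate for derivatives. The function \<open>W\<close> is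
  \<open>0\<close> for ordinary growth of order \<open>\<tau>\<close>; it is the logarithm of the mean of the positive part of \<open>Re h\<close>
  as long as \<open>h\<close> is not known to be a polynomial.
\<close>
locale growth_scale =
  fixes \<tau> :: real and W :: "real \<Rightarrow> real"
  assumes \<tau>_pos: "\<tau> > 0" and W_nonneg: "\<And>r. W r \<ge> 0"
begin

definition scale :: "real \<Rightarrow> real \<Rightarrow> real" where
  "scale r \<delta> = r powr \<tau> + W (r + \<delta>) + ln (1 / \<delta>)"

text \<open>One constant serves all r and \<delta>, so \<delta> can be chosen last and as a function
  of r, which the later iteration relies on.\<close>

definition exp_growth :: "(complex \<Rightarrow> complex) \<Rightarrow> bool" where
  "exp_growth F \<longleftrightarrow> F holomorphic_on UNIV \<and> (\<exists>C\<ge>0. \<forall>r \<delta> z. 1 \<le> r \<longrightarrow> 0 < \<delta> \<longrightarrow> \<delta> \<le> 1 \<longrightarrow>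
     norm z \<le> r \<longrightarrow> norm (F z) \<le> exp (C * scale r \<delta>))"

text \<open>The bound by 1 absorbs multiplicative constants, the one by ln r absorbs powers of r,
  and the one by ln (1 / \<delta>) absorbs the loss in Cauchy's estimate.\<close>

lemma scale_ge:
  assumes that: "r \<ge> 1" "0 < \<delta>" "\<delta> \<le> 1"
  shows "scale r \<delta> \<ge> 1" "scale r \<delta> \<ge> r powr \<tau>" "scale r \<delta> \<ge> ln (1 / \<delta>)" 
    "scale r \<delta> \<ge> W (r + \<delta>)" "\<tau> * ln r \<le> scale r \<delta>"
proof -
  have *: "r powr \<tau> \<ge> 1" using that \<tau>_pos by (simp add: ge_one_powr_ge_zero)
  have **: "ln (1 / \<delta>) \<ge> 0" using that by simp
  show "scale r \<delta> \<ge> 1" "scale r \<delta> \<ge> r powr \<tau>" "scale r \<delta> \<ge> ln (1 / \<delta>)" "scale r \<delta> \<ge> W (r + \<delta>)"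
    using * ** W_nonneg[of "r + \<delta>"] unfolding scale_def by linarith+
  have "ln r \<le> r powr \<tau> / \<tau>" using that \<tau>_pos by (intro ln_powr_bound) auto
  hence "\<tau> * ln r \<le> r powr \<tau>" using \<tau>_pos by (simp add: field_simps)
  thus "\<tau> * ln r \<le> scale r \<delta>" using ** W_nonneg[of "r + \<delta>"] unfolding scale_def by linarith
qed

lemma exp_growthI:
  assumes "F holomorphic_on UNIV"
    and "\<And>r \<delta> z. 1 \<le> r \<Longrightarrow> 0 < \<delta> \<Longrightarrow> \<delta> \<le> 1 \<Longrightarrow> norm z \<le> r \<Longrightarrow> norm (F z) \<le> exp (C * scale r \<delta>)"
  shows "exp_growth F"
  unfolding exp_growth_def
proof (intro conjI exI[of _ "max 0 C"] allI impI)
  fix r \<delta> :: real and z assume *: "1 \<le> r" "0 < \<delta>" "\<delta> \<le> 1" "cmod z \<le> r"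
  have "norm (F z) \<le> exp (C * scale r \<delta>)" using assms * by blast
  also have "\<dots> \<le> exp (max 0 C * scale r \<delta>)"
    using scale_ge(1)[OF *(1-3)] by (simp add: mult_right_mono)
  finally show "norm (F z) \<le> exp (max 0 C * scale r \<delta>)" .
qed (use assms in auto)

lemma exp_growthE:
  assumes "exp_growth F"
  obtains C where "C \<ge> 0" "\<And>r \<delta> z. 1 \<le> r \<Longrightarrow> 0 < \<delta> \<Longrightarrow> \<delta> \<le> 1 \<Longrightarrow> norm z \<le> r \<Longrightarrow> norm (F z) \<le> exp (C * scale r \<delta>)"
  using assms unfolding exp_growth_def by metis

lemma exp_growth_holomorphic: "exp_growth F \<Longrightarrow> F holomorphic_on S"
  unfolding exp_growth_def using holomorphic_on_subset by blast

lemma exp_growth_const [intro]: "exp_growth (\<lambda>_. c)"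
proof (rule exp_growthI[where C = "norm c"])
  fix r \<delta> :: real and z assume *: "1 \<le> r" "0 < \<delta>" "\<delta> \<le> 1" "cmod z \<le> r"
  have "norm c \<le> exp (norm c * 1)" using exp_ge_add_one_self[of "norm c"] by (simp del: exp_ge_add_one_self)
  also have "\<dots> \<le> exp (norm c * scale r \<delta>)"
    using scale_ge(1)[OF *(1-3)] by (intro exp_le_cancel_iff[THEN iffD2] mult_left_mono) auto
  finally show "norm c \<le> exp (norm c * scale r \<delta>)" .
qed auto

lemma exp_growth_ident [intro]: "exp_growth (\<lambda>z. z)"
proof (rule exp_growthI[where C = "1 / \<tau>"])
  fix r \<delta> :: real and z :: complex assume *: "1 \<le> r" "0 < \<delta>" "\<delta> \<le> 1" "cmod z \<le> r"
  have "r = exp (ln r)" using * by simp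
  also have "ln r \<le> 1 / \<tau> * scale r \<delta>" using scale_ge(5)[OF *(1-3)] \<tau>_pos by (simp add: field_simps)
  finally show "norm z \<le> exp (1 / \<tau> * scale r \<delta>)" using * by simp
qed auto

text \<open>The additional 1 in the exponent pays for the factor 2, since 2 \<le> 1 + scale \<le>
  exp scale.\<close>

lemma exp_scale_add:
  assumes "1 \<le> r" "0 < \<delta>" "\<delta> \<le> 1" and "0 \<le> A" "0 \<le> B"
    and "x \<le> exp (A * scale r \<delta>)" "y \<le> exp (B * scale r \<delta>)"
  shows "x + y \<le> exp ((A + B + 1) * scale r \<delta>)"
proof -
  note g = scale_ge(1)[OF assms(1-3)]
  have "exp (A * scale r \<delta>) \<le> exp ((A + B) * scale r \<delta>)" "exp (B * scale r \<delta>) \<le> exp ((A + B) * scale r \<delta>)"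
    using assms(4,5) g by (auto intro!: mult_right_mono)
  hence "x + y \<le> exp ((A + B) * scale r \<delta>) + exp ((A + B) * scale r \<delta>)"
    using assms(6,7) by linarith
  also have "\<dots> \<le> exp ((A + B) * scale r \<delta>) * exp (1 * scale r \<delta>)"
    using g exp_ge_add_one_self[of "scale r \<delta>"] by (simp add: mult_left_mono del: exp_ge_add_one_self)
  also have "\<dots> = exp ((A + B + 1) * scale r \<delta>)" by (simp add: exp_add[symmetric] algebra_simps)
  finally show ?thesis .
qed

lemma exp_growth_add [intro]:
  assumes "exp_growth F" "exp_growth G"
  shows "exp_growth (\<lambda>z. F z + G z)"
proof -
  obtain A where A: "A \<ge> 0" "\<And>r \<delta> z. 1 \<le> r \<Longrightarrow> 0 < \<delta> \<Longrightarrow> \<delta> \<le> 1 \<Longrightarrow> norm z \<le> r \<Longrightarrow> norm (F z) \<le> exp (A * scale r \<delta>)"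
    using exp_growthE[OF assms(1)] by metis
  obtain B where B: "B \<ge> 0" "\<And>r \<delta> z. 1 \<le> r \<Longrightarrow> 0 < \<delta> \<Longrightarrow> \<delta> \<le> 1 \<Longrightarrow> norm z \<le> r \<Longrightarrow> norm (G z) \<le> exp (B * scale r \<delta>)"
    using exp_growthE[OF assms(2)] by metis
  show ?thesis
  proof (rule exp_growthI[where C = "A + B + 1"])
    fix r \<delta> :: real and z assume *: "1 \<le> r" "0 < \<delta>" "\<delta> \<le> 1" "cmod z \<le> r"
    show "norm (F z + G z) \<le> exp ((A + B + 1) * scale r \<delta>)"
      using exp_scale_add[OF *(1-3) A(1) B(1) A(2)[OF *] B(2)[OF *]] norm_triangle_ineq[of "F z" "G z"]
      by linarith
  qed (intro holomorphic_intros assms[THEN exp_growth_holomorphic])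
qed

lemma exp_growth_mult [intro]:
  assumes "exp_growth F" "exp_growth G"
  shows "exp_growth (\<lambda>z. F z * G z)"
proof -
  obtain A where A: "A \<ge> 0" "\<And>r \<delta> z. 1 \<le> r \<Longrightarrow> 0 < \<delta> \<Longrightarrow> \<delta> \<le> 1 \<Longrightarrow> norm z \<le> r \<Longrightarrow> norm (F z) \<le> exp (A * scale r \<delta>)"
    using exp_growthE[OF assms(1)] by metis
  obtain B where B: "B \<ge> 0" "\<And>r \<delta> z. 1 \<le> r \<Longrightarrow> 0 < \<delta> \<Longrightarrow> \<delta> \<le> 1 \<Longrightarrow> norm z \<le> r \<Longrightarrow> norm (G z) \<le> exp (B * scale r \<delta>)"
    using exp_growthE[OF assms(2)] by metis
  show ?thesis
  proof (rule exp_growthI[where C = "A + B"])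
    fix r \<delta> :: real and z assume *: "1 \<le> r" "0 < \<delta>" "\<delta> \<le> 1" "cmod z \<le> r"
    have "norm (F z * G z) \<le> exp (A * scale r \<delta>) * exp (B * scale r \<delta>)"
      unfolding norm_mult using A(2)[OF *] B(2)[OF *] by (intro mult_mono) auto
    also have "\<dots> = exp ((A + B) * scale r \<delta>)" by (simp add: exp_add[symmetric] algebra_simps)
    finally show "norm (F z * G z) \<le> \<dots>" .
  qed (intro holomorphic_intros assms[THEN exp_growth_holomorphic])
qed

lemma exp_growth_uminus [intro]: "exp_growth F \<Longrightarrow> exp_growth (\<lambda>z. - F z)"
  using exp_growth_mult[OF exp_growth_const[of "-1"], of F] by simp

lemma exp_growth_diff [intro]: "exp_growth F \<Longrightarrow> exp_growth G \<Longrightarrow> exp_growth (\<lambda>z. F z - G z)"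
  using exp_growth_add[of F "\<lambda>z. - G z"] by auto

lemma exp_growth_power [intro]: "exp_growth F \<Longrightarrow> exp_growth (\<lambda>z. F z ^ n)"
  by (induction n) auto

lemma exp_growth_sum [intro]: "(\<And>i. i \<in> I \<Longrightarrow> exp_growth (F i)) \<Longrightarrow> exp_growth (\<lambda>z. \<Sum>i\<in>I. F i z)"
  by (induction I rule: infinite_finite_induct) auto

lemma exp_growth_prod [intro]: "(\<And>i. i \<in> I \<Longrightarrow> exp_growth (F i)) \<Longrightarrow> exp_growth (\<lambda>z. \<Prod>i\<in>I. F i z)"
  by (induction I rule: infinite_finite_induct) auto

lemma exp_growth_poly [intro]: "exp_growth (poly p)"
proof (induction p)
  case (pCons a p)
  have "exp_growth (\<lambda>z. a + z * poly p z)"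
    by (rule exp_growth_add[OF exp_growth_const exp_growth_mult[OF exp_growth_ident pCons(2)]])
  also have "(\<lambda>z. a + z * poly p z) = poly (pCons a p)" by auto
  finally show ?case .
qed (simp add: exp_growth_const)

text \<open>Cauchy's estimate on discs of radius \<delta>/2. The factor 2/\<delta> is absorbed
  because \<open>scale\<close> contains a logarithm of 1/\<delta>.\<close>

lemma exp_growth_deriv [intro]:
  assumes "exp_growth F"
  shows "exp_growth (deriv F)"
proof -
  obtain A where A: "A \<ge> 0" "\<And>r \<delta> z. 1 \<le> r \<Longrightarrow> 0 < \<delta> \<Longrightarrow> \<delta> \<le> 1 \<Longrightarrow> norm z \<le> r \<Longrightarrow> norm (F z) \<le> exp (A * scale r \<delta>)"
    using exp_growthE[OF assms] by metis
  have hol: "F holomorphic_on S" for S using assms by (rule exp_growth_holomorphic)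
  show ?thesis
  proof (rule exp_growthI[where C = "(A + 1) * (2 powr \<tau> + 1)"])
    fix r \<delta> :: real and z assume *: "1 \<le> r" "0 < \<delta>" "\<delta> \<le> 1" "cmod z \<le> r"
    \<comment> \<open>Half of \<delta> is spent on the Cauchy disc and half is left for the bound on
      \<open>F\<close>. Hence W is evaluated at (r + \<delta>/2) + \<delta>/2 = r + \<delta>, the
      same point as in \<open>scale r \<delta>\<close>, and differentiation can be repeated without
      moving it.\<close>
    let ?g = "scale (r + \<delta> / 2) (\<delta> / 2)"
    have "norm ((deriv ^^ 1) F z) \<le> fact 1 * exp (A * ?g) / (\<delta> / 2) ^ 1"
    proof (rule Cauchy_inequality)
      fix x assume x: "norm (z - x) = \<delta> / 2"
      have "norm x \<le> r + \<delta> / 2" using x norm_triangle_ineq2[of x z] * by (simp add: norm_minus_commute)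
      thus "norm (F x) \<le> exp (A * ?g)" using * by (intro A) auto
    qed (use * in \<open>auto intro!: hol holomorphic_on_imp_continuous_on\<close>)
    also have "\<dots> = exp (A * ?g) * (1 / (\<delta> / 2))" by simp
    also have "1 / (\<delta> / 2) = exp (ln (1 / (\<delta> / 2)))" using * by (subst exp_ln) auto
    also have "ln (1 / (\<delta> / 2)) \<le> ?g" by (rule scale_ge) (use * in auto)
    hence "exp (A * ?g) * exp (ln (1 / (\<delta> / 2))) \<le> exp (A * ?g) * exp ?g" by simp
    also have "\<dots> = exp ((A + 1) * ?g)" by (simp add: exp_add[symmetric] algebra_simps)
    also have "?g \<le> (2 powr \<tau> + 1) * scale r \<delta>"
    proof -
      have "(r + \<delta> / 2) powr \<tau> \<le> (2 * r) powr \<tau>" using * \<tau>_pos by (intro powr_mono2) auto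
      also have "\<dots> = 2 powr \<tau> * r powr \<tau>" using * by (simp add: powr_mult)
      finally have 1: "(r + \<delta> / 2) powr \<tau> \<le> 2 powr \<tau> * r powr \<tau>" .
      have "ln (1 / (\<delta> / 2)) = ln (2 * (1 / \<delta>))" by simp
      also have "\<dots> = ln 2 + ln (1 / \<delta>)" using * by (subst ln_mult_pos) auto
      finally have 2: "ln (1 / (\<delta> / 2)) = ln 2 + ln (1 / \<delta>)" .
      have "ln 2 \<le> (1::real)" using ln_le_minus_one[of 2] by simp
      also have "1 \<le> r powr \<tau>" using * \<tau>_pos by (simp add: ge_one_powr_ge_zero)
      finally have 2: "ln (1 / (\<delta> / 2)) \<le> r powr \<tau> + ln (1 / \<delta>)" using 2 by linarith
      have 3: "2 powr \<tau> * W (r + \<delta>) \<ge> 0" "2 powr \<tau> * ln (1 / \<delta>) \<ge> 0"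
        using W_nonneg[of "r + \<delta>"] * by auto
      have "?g = (r + \<delta> / 2) powr \<tau> + W (r + \<delta>) + ln (1 / (\<delta> / 2))"
        by (simp only: scale_def add.assoc) simp
      also have "\<dots> \<le> 2 powr \<tau> * r powr \<tau> + W (r + \<delta>) + (r powr \<tau> + ln (1 / \<delta>))"
        using 1 2 by linarith
      also have "\<dots> \<le> (2 powr \<tau> + 1) * scale r \<delta>" using 3
        unfolding scale_def by (simp only: ring_distribs)
      finally show ?thesis .
    qed
    finally show "norm (deriv F z) \<le> exp ((A + 1) * (2 powr \<tau> + 1) * scale r \<delta>)"
      using A(1) by (simp add: mult_left_mono mult.assoc)
  qed (auto intro!: holomorphic_intros hol)
qed

end

section \<open>Polynomial exponents, and control of an entire function by the positive part of its
  real part\<close>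

lemma norm_poly_le:
  fixes Q :: "complex poly"
  assumes "real (degree Q) \<le> D"
  obtains S where "S \<ge> 0" "\<And>r z. r \<ge> 1 \<Longrightarrow> norm z \<le> r \<Longrightarrow> norm (poly Q z) \<le> S * r powr D"
proof
  show "(\<Sum>i\<le>degree Q. norm (coeff Q i)) \<ge> 0" by (simp add: sum_nonneg)
  fix r :: real and z :: complex assume *: "r \<ge> 1" "norm z \<le> r"
  have "norm (poly Q z) \<le> (\<Sum>i\<le>degree Q. norm (coeff Q i * z ^ i))"
    unfolding poly_altdef by (rule norm_sum)
  also have "\<dots> \<le> (\<Sum>i\<le>degree Q. norm (coeff Q i) * r powr D)"
  proof (intro sum_mono)
    fix i assume i: "i \<in> {..degree Q}"
    have "norm z ^ i \<le> r ^ i" using * by (intro power_mono) auto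
    also have "\<dots> = r powr i" using * by (simp add: powr_realpow)
    also have "\<dots> \<le> r powr D" using * i assms by (intro powr_mono) auto
    finally show "norm (coeff Q i * z ^ i) \<le> norm (coeff Q i) * r powr D"
      by (simp add: norm_mult norm_power mult_left_mono)
  qed
  finally show "norm (poly Q z) \<le> (\<Sum>i\<le>degree Q. norm (coeff Q i)) * r powr D"
    by (simp add: sum_distrib_right)
qed

lemma (in growth_scale) exp_growth_exp_poly:
  assumes "real (degree Q) \<le> \<tau>"
  shows "exp_growth (\<lambda>z. exp (poly Q z))"
proof -
  obtain S where S: "S \<ge> 0" "\<And>r z. r \<ge> 1 \<Longrightarrow> norm z \<le> r \<Longrightarrow> norm (poly Q z) \<le> S * r powr \<tau>"
    using norm_poly_le[OF assms] by blast
  show ?thesis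
  proof (rule exp_growthI[where C = S])
    fix r \<delta> :: real and z :: complex assume *: "1 \<le> r" "0 < \<delta>" "\<delta> \<le> 1" "cmod z \<le> r"
    have "norm (exp (poly Q z)) \<le> exp (norm (poly Q z))" by (rule norm_exp)
    also have "norm (poly Q z) \<le> S * r powr \<tau>" using S * by auto
    also have "\<dots> \<le> S * scale r \<delta>" using S scale_ge(2)[OF *(1-3)] by (intro mult_left_mono)
    finally show "norm (exp (poly Q z)) \<le> exp (S * scale r \<delta>)" by simp
  qed (auto intro!: holomorphic_intros)
qed

text \<open>For entire h this is the Nevanlinna characteristic of exp h, because log+ |exp h| = max
  0 (Re h) and exp h has no poles.\<close>

definition pos_mean :: "(complex \<Rightarrow> complex) \<Rightarrow> real \<Rightarrow> real" where
  "pos_mean h r = circ_mean r (\<lambda>z. max 0 (Re (h z)))"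

lemma pos_mean_nonneg:
  assumes "h holomorphic_on UNIV" "r \<ge> 0"
  shows "pos_mean h r \<ge> 0"
proof -
  have "circ_mean r (\<lambda>_. 0) \<le> pos_mean h r" unfolding pos_mean_def
    using assms by (intro circ_mean_mono)
      (auto intro!: continuous_intros holomorphic_on_imp_continuous_on holomorphic_on_subset[OF assms(1)])
  thus ?thesis by simp
qed

text \<open>
  Cauchy's integral for the coefficient, plus the conjugate of the vanishing integral of
  \<open>h(z) z\<^sup>k\<close>, leaves an integral in which only \<open>Re h\<close> occurs.
\<close>
lemma taylor_coeff_le_pos_mean:
  assumes h: "h holomorphic_on UNIV" and "r > 0" "k > 0"
  shows "norm ((deriv ^^ k) h 0 / fact k) * r ^ k \<le> 4 * pos_mean h r - 2 * Re (h 0)"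
proof -
  define z where "z = (\<lambda>t. of_real r * cis t)"
  define a where "a = (deriv ^^ k) h 0 / fact k"
  define e where "e = (\<lambda>t. cis (- real k * t))"
  have hS: "h holomorphic_on S" for S using h by (rule holomorphic_on_subset) auto
  have ch: "continuous_on S (\<lambda>t. h (z t))" for S
    unfolding z_def by (rule continuous_on_compose2[OF holomorphic_on_imp_continuous_on[OF h]]) (auto intro!: continuous_intros)
  have ce: "continuous_on S e" for S unfolding e_def by (auto intro!: continuous_intros)
  have ze: "z t ^ k = of_real (r ^ k) / e t" for t
  proof -
    have "cis t ^ k = inverse (e t)" by (simp add: e_def Complex.DeMoivre)
    thus ?thesis by (simp add: z_def power_mult_distrib divide_inverse)
  qed
  have cnj_e: "cnj (z t ^ k) = of_real (r ^ k) * e t" for t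
  proof -
    have "cnj (cis t ^ k) = e t" unfolding Complex.DeMoivre by (simp add: e_def cis_cnj)
    thus ?thesis by (simp add: z_def power_mult_distrib)
  qed
  have z_nz: "z t \<noteq> 0" for t using \<open>r > 0\<close> by (simp add: z_def)
  have "((\<lambda>u. h u / (u-0) ^ Suc k) has_contour_integral (2 * pi) * \<i> / fact k * (deriv ^^ k) h 0) (circlepath 0 r)"
    by (rule Cauchy_has_contour_integral_higher_derivative_circlepath)
       (use assms in \<open>auto intro!: hS holomorphic_on_imp_continuous_on\<close>)
  hence "((\<lambda>t. h (z t) / z t ^ Suc k * r * \<i> * cis t) has_integral ((2 * pi) * \<i> * a)) {0..2*pi}"
    unfolding circlepath_def
    by (subst (asm) has_contour_integral_part_circlepath_iff) (auto simp: a_def z_def)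
  hence "((\<lambda>t. (- \<i> * r ^ k) * (h (z t) / z t ^ Suc k * r * \<i> * cis t)) has_integral (- \<i> * r ^ k) * ((2 * pi) * \<i> * a)) {0..2*pi}"
    by (rule has_integral_mult_right)
  also have "(\<lambda>t. (- \<i> * r ^ k) * (h (z t) / z t ^ Suc k * r * \<i> * cis t)) = (\<lambda>t. h (z t) * e t)"
  proof
    fix t
    have "(- \<i> * r ^ k) * (h (z t) / z t ^ Suc k * r * \<i> * cis t) = r ^ k * h (z t) / z t ^ k * (of_real r * cis t / z t)"
      by (simp add: field_simps)
    also have "of_real r * cis t / z t = 1" using z_nz[of t] by (simp add: z_def)
    finally show "(- \<i> * r ^ k) * (h (z t) / z t ^ Suc k * r * \<i> * cis t) = h (z t) * e t"
      unfolding ze using \<open>r > 0\<close> by simp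
  qed
  finally have 1: "((\<lambda>t. h (z t) * e t) has_integral (2 * pi * r ^ k * a)) {0..2*pi}"
    by (simp add: mult_ac)
  have "(\<lambda>z. h z * z ^ k) holomorphic_on ball 0 (r + 1)" by (intro holomorphic_intros hS)
  hence "integral {0..2*pi} (\<lambda>t. h (z t) * z t ^ k) = 0"
    using holomorphic_mean_value[of "\<lambda>z. h z * z ^ k" "r + 1" r] assms
    by (simp add: z_def)
  moreover have "(\<lambda>t. h (z t) * z t ^ k) integrable_on {0..2*pi}"
    by (intro integrable_continuous_interval continuous_on_mult ch continuous_on_power) (auto simp: z_def intro!: continuous_intros)
  ultimately have "((\<lambda>t. h (z t) * z t ^ k) has_integral 0) {0..2*pi}"
    by (metis integrable_integral)
  from has_integral_linear[OF this bounded_linear_cnj]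
  have "((\<lambda>t. cnj (h (z t) * z t ^ k)) has_integral cnj 0) {0..2*pi}"
    by (simp only: o_def)
  hence "((\<lambda>t. of_real (1 / r ^ k) * cnj (h (z t) * z t ^ k)) has_integral (of_real (1 / r ^ k) * cnj 0)) {0..2*pi}"
    by (rule has_integral_mult_right)
  also have "(\<lambda>t. of_real (1 / r ^ k) * cnj (h (z t) * z t ^ k)) = (\<lambda>t. cnj (h (z t)) * e t)"
    using \<open>r > 0\<close> cnj_e unfolding complex_cnj_mult by (auto simp: field_simps)
  finally have 2: "((\<lambda>t. cnj (h (z t)) * e t) has_integral 0) {0..2*pi}" by simp
  have "((\<lambda>t. h (z t) * e t + cnj (h (z t)) * e t) has_integral (2 * pi * r ^ k * a + 0)) {0..2*pi}"
    by (rule has_integral_add[OF 1 2])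
  also have "(\<lambda>t. h (z t) * e t + cnj (h (z t)) * e t) = (\<lambda>t. of_real (2 * Re (h (z t))) * e t)"
    by (simp add: distrib_right[symmetric] complex_add_cnj)
  finally have 3: "((\<lambda>t. of_real (2 * Re (h (z t))) * e t) has_integral (2 * pi * r ^ k * a)) {0..2*pi}" by simp
  have "norm (2 * pi * r ^ k * a) = norm (integral {0..2*pi} (\<lambda>t. of_real (2 * Re (h (z t))) * e t))"
    using integral_unique[OF 3] by simp
  also have "\<dots> \<le> integral {0..2*pi} (\<lambda>t. 2 * \<bar>Re (h (z t))\<bar>)"
    using 3 by (intro integral_norm_bound_integral)
       (auto simp: norm_mult e_def intro!: integrable_continuous_interval continuous_intros ch)
  also have "\<dots> = 2 * pi * (2 * circ_mean r (\<lambda>z. \<bar>Re (h z)\<bar>))"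
    by (simp add: circ_mean_def z_def)
  finally have "norm a * r ^ k \<le> 2 * circ_mean r (\<lambda>z. \<bar>Re (h z)\<bar>)"
    using \<open>r > 0\<close> by (simp add: norm_mult norm_power mult_ac)
  \<comment> \<open>Since |x| = 2 max 0 x - x and the mean of Re h is Re (h 0), a bound on the
    positive part alone controls every coefficient.\<close>
  also have "circ_mean r (\<lambda>z. \<bar>Re (h z)\<bar>) = circ_mean r (\<lambda>z. 2 * max 0 (Re (h z)) - Re (h z))"
    by (intro circ_mean_cong) (use assms in auto)
  also have "\<dots> = 2 * pos_mean h r - circ_mean r (\<lambda>z. Re (h z))"
    unfolding pos_mean_def using \<open>r > 0\<close>
    by (subst circ_mean_diff)
       (auto simp: circ_mean_cmult intro!: continuous_intros holomorphic_on_imp_continuous_on hS)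
  also have "circ_mean r (\<lambda>z. Re (h z)) = Re (h 0)"
    by (rule circ_mean_Re_holomorphic[where R = "r + 1"]) (use \<open>r > 0\<close> hS in auto)
  finally show ?thesis by (simp add: a_def)
qed

text \<open>A Borel-Caratheodory inequality: the Taylor coefficients are estimated on the circle of
  radius R = r + \<delta>, and the series is dominated by a geometric one of ratio r / R with sum R
  / \<delta>. Finally R \<le> 2 r, because \<delta> \<le> 1 \<le> r.\<close>

lemma norm_le_pos_mean:
  assumes h: "h holomorphic_on UNIV" and "r \<ge> 1" "0 < \<delta>" "\<delta> \<le> 1" "norm z \<le> r"
  shows "norm (h z) \<le> (4 * pos_mean h (r + \<delta>) + 3 * norm (h 0)) * (2 * r / \<delta>)"
proof -
  define R where "R = r + \<delta>"
  define K where "K = 4 * pos_mean h R + 3 * norm (h 0)"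
  have U0: "pos_mean h R \<ge> 0" by (rule pos_mean_nonneg) (use assms in \<open>auto simp: R_def\<close>)
  have "((\<lambda>n. (deriv ^^ n) h 0 / fact n * (z - 0) ^ n) sums h z)"
    by (rule holomorphic_power_series[where r = "R"])
       (use assms in \<open>auto simp: R_def intro: holomorphic_on_subset\<close>)
  moreover have "(\<lambda>n. K * (r / R) ^ n) sums (K * (1 / (1 - r / R)))"
    by (intro sums_mult geometric_sums) (use assms in \<open>auto simp: R_def\<close>)
  moreover have "norm ((deriv ^^ n) h 0 / fact n * (z - 0) ^ n) \<le> K * (r / R) ^ n" for n
  proof (cases "n = 0")
    case True
    thus ?thesis using U0 by (simp add: K_def)
  next
    case False
    have "norm ((deriv ^^ n) h 0 / fact n) * R ^ n \<le> 4 * pos_mean h R - 2 * Re (h 0)"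
      by (rule taylor_coeff_le_pos_mean[OF h]) (use assms False in \<open>auto simp: R_def\<close>)
    also have "\<dots> \<le> K" unfolding K_def using abs_Re_le_cmod[of "h 0"] by (smt (verit) norm_ge_zero)
    finally have "norm ((deriv ^^ n) h 0 / fact n) \<le> K / R ^ n"
      using assms by (simp add: R_def field_simps)
    moreover have "norm ((z - 0) ^ n) \<le> r ^ n" using assms by (auto simp: norm_power intro!: power_mono)
    ultimately have "norm ((deriv ^^ n) h 0 / fact n * (z - 0) ^ n) \<le> K / R ^ n * r ^ n"
      unfolding norm_mult using U0 assms by (intro mult_mono) (auto simp: K_def R_def)
    thus ?thesis by (simp add: power_divide)
  qed
  ultimately have "norm (h z) \<le> K * (1 / (1 - r / R))"
    by (rule norm_sums_le)
  also have "1 / (1 - r / R) = R / \<delta>"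
  proof -
    have "1 - r / R = \<delta> / R" using assms by (simp add: R_def divide_simps)
    thus ?thesis by simp
  qed
  also have "K * (R / \<delta>) \<le> K * (2 * r / \<delta>)"
    using assms U0 by (intro mult_left_mono divide_right_mono) (auto simp: K_def R_def)
  finally show ?thesis by (simp add: K_def R_def)
qed

text \<open>The logarithm of the Borel-Caratheodory bound consists of a constant, ln r, ln (1 /
  \<delta>) and ln (1 + U(r + \<delta>)), each dominated by a multiple of \<open>scale\<close>. The
  absolute value in W makes it nonnegative for every real argument, including negative
  radii.\<close>

lemma exp_growth_of_pos_mean:
  assumes h: "h holomorphic_on UNIV" and "\<tau> > 0"
  shows "growth_scale.exp_growth \<tau> (\<lambda>r. ln (1 + \<bar>pos_mean h r\<bar>)) h"
proof -
  interpret growth_scale \<tau> "\<lambda>r. ln (1 + \<bar>pos_mean h r\<bar>)"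
    by unfold_locales (use assms in auto)
  define c where "c = 4 + 3 * norm (h 0)"
  show ?thesis
  proof (rule exp_growthI[where C = "ln (2 * c) + 1 / \<tau> + 2"])
    fix r \<delta> :: real and z :: complex assume *: "1 \<le> r" "0 < \<delta>" "\<delta> \<le> 1" "cmod z \<le> r"
    let ?U = "\<bar>pos_mean h (r + \<delta>)\<bar>"
    have "norm (h z) \<le> (4 * pos_mean h (r + \<delta>) + 3 * norm (h 0)) * (2 * r / \<delta>)"
      by (rule norm_le_pos_mean) (use * h in auto)
    also have "\<dots> \<le> (c * (1 + ?U)) * (2 * r / \<delta>)"
    proof (intro mult_right_mono)
      have "0 \<le> 3 * norm (h 0) * ?U" by simp
      thus "4 * pos_mean h (r + \<delta>) + 3 * norm (h 0) \<le> c * (1 + ?U)"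
        unfolding c_def by (simp only: ring_distribs)
    qed (use * in auto)
    also have "\<dots> = (2 * c) * (1 + ?U) * r * (1 / \<delta>)" by (simp add: mult_ac)
    also have "\<dots> = exp (ln (2 * c) + ln (1 + ?U) + ln r + ln (1 / \<delta>))"
      using * by (simp add: exp_add c_def add_pos_nonneg)
    also have "ln (2 * c) + ln (1 + ?U) + ln r + ln (1 / \<delta>) \<le> 
        ln (2 * c) * scale r \<delta> + scale r \<delta> + 1 / \<tau> * scale r \<delta> + scale r \<delta>"
    proof (intro add_mono)
      have "ln (2 * c) \<ge> 0" by (simp add: c_def)
      from mult_left_mono[OF scale_ge(1)[OF *(1-3)] this] show "ln (2 * c) \<le> ln (2 * c) * scale r \<delta>" by simp
      show "ln r \<le> 1 / \<tau> * scale r \<delta>" using scale_ge(5)[OF *(1-3)] \<tau>_pos by (simp add: field_simps)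
    qed (use scale_ge(3,4)[OF *(1-3)] in auto)
    also have "\<dots> = (ln (2 * c) + 1 / \<tau> + 2) * scale r \<delta>" by (simp add: algebra_simps)
    finally show "norm (h z) \<le> exp \<dots>" by simp
  qed (use h in auto)
qed

text \<open>Liouville's argument: the k-th Taylor coefficient times r^k is O(r^\<rho>), so it
  vanishes for k > \<rho>.\<close>

lemma polynomial_of_pos_mean_le:
  assumes h: "h holomorphic_on UNIV" and "\<rho> \<ge> 0"
    and K: "\<And>r. r \<ge> 1 \<Longrightarrow> pos_mean h r \<le> K * r powr \<rho>"
  obtains H where "\<And>z. h z = poly H z" "real (degree H) \<le> \<rho>"
proof -
  define a where "a = (\<lambda>k. (deriv ^^ k) h 0 / fact k)"
  have a0: "a k = 0" if k: "real k > \<rho>" for k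
  proof (rule ccontr)
    assume "a k \<noteq> 0"
    define M where "M = 4 * \<bar>K\<bar> + 2 * norm (h 0)"
    have "norm (a k) * r powr (k - \<rho>) \<le> M" if "r \<ge> 1" for r
    proof -
      have "norm (a k) * r ^ k \<le> 4 * pos_mean h r - 2 * Re (h 0)"
        unfolding a_def by (rule taylor_coeff_le_pos_mean[OF h]) (use that k \<open>\<rho> \<ge> 0\<close> in auto)
      also have "\<dots> \<le> 4 * (\<bar>K\<bar> * r powr \<rho>) + 2 * norm (h 0) * r powr \<rho>"
      proof -
        have "K * r powr \<rho> \<le> \<bar>K\<bar> * r powr \<rho>" by (intro mult_right_mono) auto
        moreover have "norm (h 0) * 1 \<le> norm (h 0) * r powr \<rho>"
          using that \<open>\<rho> \<ge> 0\<close> by (intro mult_left_mono) (auto simp: ge_one_powr_ge_zero)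
        ultimately show ?thesis using K[OF that] abs_Re_le_cmod[of "h 0"] by linarith
      qed
      also have "\<dots> = M * r powr \<rho>" by (simp add: M_def algebra_simps)
      finally have "norm (a k) * r powr k \<le> M * r powr \<rho>" using that by (simp add: powr_realpow)
      thus ?thesis using that by (simp add: powr_diff field_simps)
    qed
    hence "\<forall>\<^sub>F r in at_top. norm (a k) * r powr (k - \<rho>) \<le> M"
      by (auto intro!: eventually_mono[OF eventually_ge_at_top[of "1::real"]])
    moreover have "filterlim (\<lambda>r. norm (a k) * r powr (k - \<rho>)) at_top at_top"
      using k \<open>a k \<noteq> 0\<close> by real_asymp
    hence "\<forall>\<^sub>F r in at_top. norm (a k) * r powr (k - \<rho>) > M" by (simp add: filterlim_at_top_dense)
    ultimately have "\<forall>\<^sub>F r::real in at_top. False" by eventually_elim auto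
    thus False by simp
  qed
  define H where "H = (\<Sum>k\<le>nat \<lfloor>\<rho>\<rfloor>. monom (a k) k)"
  have "h z = poly H z" for z
  proof -
    have "(\<lambda>n. (deriv ^^ n) h 0 / fact n * (z - 0) ^ n) sums h z"
      by (rule holomorphic_power_series[where r = "norm z + 1"]) (auto intro: holomorphic_on_subset[OF h])
    moreover have "(\<lambda>n. (deriv ^^ n) h 0 / fact n * (z - 0) ^ n) sums (\<Sum>n\<le>nat \<lfloor>\<rho>\<rfloor>. (deriv ^^ n) h 0 / fact n * (z - 0) ^ n)"
    proof (rule sums_finite)
      fix n assume "n \<notin> {..nat \<lfloor>\<rho>\<rfloor>}"
      hence "real n > \<rho>" using \<open>\<rho> \<ge> 0\<close> by simp linarith
      thus "(deriv ^^ n) h 0 / fact n * (z - 0) ^ n = 0" using a0[of n] by (simp add: a_def)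
    qed auto
    ultimately have "h z = (\<Sum>n\<le>nat \<lfloor>\<rho>\<rfloor>. (deriv ^^ n) h 0 / fact n * (z - 0) ^ n)" by (rule sums_unique2)
    thus ?thesis by (simp add: H_def poly_sum poly_monom a_def)
  qed
  moreover have "degree H \<le> nat \<lfloor>\<rho>\<rfloor>" unfolding H_def
    by (intro degree_sum_le) (auto intro: order_trans[OF degree_monom_le])
  hence "real (degree H) \<le> \<rho>" using \<open>\<rho> \<ge> 0\<close> by linarith
  ultimately show ?thesis using that by blast
qed

text \<open>
  If \<open>U\<close> exceeded the bound at \<open>r\<^sub>0\<close>, the inequality applied successively at
  \<open>r\<^sub>0 + 1 - 2\<^bsup>-k\<^esup>\<close> would make \<open>U\<close> unbounded on \<open>[r\<^sub>0, r\<^sub>0 + 1]\<close>.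
\<close>
lemma growth_iteration:
  fixes U :: "real \<Rightarrow> real"
  assumes "\<rho> \<ge> 0" and U0: "\<And>r. r \<ge> 1 \<Longrightarrow> U r \<ge> 0"
    and bdd: "\<And>b. \<exists>M. \<forall>r\<in>{1..b}. U r \<le> M"
    and ineq: "\<And>r \<delta>. 1 \<le> r \<Longrightarrow> 0 < \<delta> \<Longrightarrow> \<delta> \<le> 1 \<Longrightarrow>
       U r \<le> C * (r powr \<rho> + ln (1 + U (r + \<delta>)) + ln (1 / \<delta>))"
  obtains K where "\<And>r. r \<ge> 1 \<Longrightarrow> U r \<le> K * r powr \<rho>"
proof -
  define D where "D = max 1 C"
  have D: "D \<ge> 1" by (simp add: D_def)
  have ineq': "U r \<le> D * (r powr \<rho> + ln (1 + U (r + \<delta>)) + ln (1 / \<delta>))"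
    if "1 \<le> r" "0 < \<delta>" "\<delta> \<le> 1" for r \<delta>
  proof -
    have "r powr \<rho> + ln (1 + U (r + \<delta>)) + ln (1 / \<delta>) \<ge> 0"
      using that U0[of "r + \<delta>"] by (intro add_nonneg_nonneg) auto
    hence "C * (r powr \<rho> + ln (1 + U (r + \<delta>)) + ln (1 / \<delta>)) \<le> D * (r powr \<rho> + ln (1 + U (r + \<delta>)) + ln (1 / \<delta>))"
      by (intro mult_right_mono) (auto simp: D_def)
    thus ?thesis using ineq[OF that] by linarith
  qed
  \<comment> \<open>Write X = S (k + 1). The factor a + 2 in M turns U \<ge> M X into L \<ge> a X
    after 2 X is lost to the other two terms of the inequality. The relation 4 M \<le> a^2 then
    gives (a X)^2 / 2 \<ge> 2 M X, twice the previous lower bound.\<close>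
  define a where "a = 8 * D + 8"
  define M where "M = D * (a + 2)"
  have M: "M \<ge> 1" "4 * M \<le> a\<^sup>2"
  proof -
    have "1 * 1 \<le> D * (a + 2)" using D by (intro mult_mono) (auto simp: a_def)
    thus "M \<ge> 1" by (simp add: M_def)
    have "a\<^sup>2 - 4 * M = 32 * D\<^sup>2 + 88 * D + 64" by (simp add: a_def M_def power2_eq_square algebra_simps)
    thus "4 * M \<le> a\<^sup>2" using D zero_le_power2[of D] by linarith
  qed
  have "U r0 \<le> (M * 2 powr \<rho>) * r0 powr \<rho>" if r0: "r0 \<ge> 1" for r0
  proof (rule ccontr)
    assume neg: "\<not> ?thesis"
    \<comment> \<open>All radii of the iteration stay below r0 + 1 \<le> 2 r0, so S dominates every
      term \<open>r powr \<rho>\<close>.\<close>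
    define S where "S = (2 * r0) powr \<rho>"
    have S: "S \<ge> 1" using r0 \<open>\<rho> \<ge> 0\<close> by (simp add: S_def ge_one_powr_ge_zero)
    have base: "U r0 > M * S"
      using neg r0 by (simp add: S_def powr_mult mult.assoc)
    \<comment> \<open>Growth linear in k already contradicts boundedness. It is also what the step
      sizes demand: \<delta> = 2^(-k-1) contributes ln (1 / \<delta>) \<le> k + 1, which S (k + 1)
      covers since S \<ge> 1.\<close>
    have claim: "U (r0 + 1 - (1/2)^k) \<ge> M * S * (k + 1)" for k :: nat
    proof (induction k)
      case 0
      thus ?case using base by simp
    next
      case (Suc k)
      define r where "r = r0 + 1 - (1/2)^k"
      define \<delta> :: real where "\<delta> = (1/2) ^ Suc k"
      have \<delta>: "0 < \<delta>" "\<delta> \<le> 1" by (auto simp: \<delta>_def intro!: power_le_one simp del: power_Suc)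
      have pk: "(1/2) ^ k \<le> (1::real)" by (intro power_le_one) auto
      have r: "1 \<le> r" "r \<le> 2 * r0" using r0 pk by (auto simp: r_def) (smt (verit) zero_le_power divide_nonneg_nonneg)
      have rd: "r + \<delta> = r0 + 1 - (1/2) ^ Suc k" by (simp add: r_def \<delta>_def)
      define X where "X = S * (k + 1)"
      define L where "L = ln (1 + U (r + \<delta>))"
      have XS: "S \<le> X" using S by (simp add: X_def algebra_simps)
      hence X: "X \<ge> 1" using S by linarith
      have "r powr \<rho> \<le> X" 
        using powr_mono2[OF \<open>\<rho> \<ge> 0\<close> _ r(2)] r XS by (simp add: S_def)
      moreover have "ln (1 / \<delta>) \<le> X"
      proof -
        have "ln (1 / \<delta>) = Suc k * ln 2" by (simp add: \<delta>_def power_divide ln_realpow del: power_Suc)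
        also have "\<dots> \<le> real (Suc k) * 1" using ln_le_minus_one[of 2] by (intro mult_left_mono) auto
        also have "\<dots> \<le> X" using S by (simp add: X_def mult_le_cancel_right1)
        finally show ?thesis .
      qed
      ultimately have "D * (r powr \<rho> + L + ln (1 / \<delta>)) \<le> D * (2 * X + L)"
        using D by (intro mult_left_mono) auto
      moreover have "U r \<le> D * (r powr \<rho> + L + ln (1 / \<delta>))"
        unfolding L_def by (rule ineq') (use r \<delta> in auto)
      moreover have "M * X \<le> U r" using Suc by (simp add: X_def r_def mult.assoc)
      ultimately have "D * ((a + 2) * X) \<le> D * (2 * X + L)" by (simp add: M_def mult.assoc)
      hence "(a + 2) * X \<le> 2 * X + L" using D by simp
      hence aX: "a * X \<le> L" by (simp add: algebra_simps)
      have aX0: "a * X \<ge> 0" using D X by (simp add: a_def)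
      \<comment> \<open>The quadratic term of the exponential series suffices to turn the bound on
        the logarithm L back into one on U.\<close>
      have "1 + a * X + (a * X)\<^sup>2 / 2 \<le> exp (a * X)" by (rule exp_lower_Taylor_quadratic[OF aX0])
      also have "\<dots> \<le> exp L" using aX by simp
      also have "\<dots> = 1 + U (r + \<delta>)" using U0[of "r + \<delta>"] r \<delta> by (simp add: L_def)
      finally have "(a * X)\<^sup>2 / 2 \<le> U (r + \<delta>)" using aX0 by linarith
      moreover have "2 * M * X \<le> (a * X)\<^sup>2 / 2"
      proof -
        have "4 * M * X \<le> a\<^sup>2 * X" using M X by (intro mult_right_mono) auto
        also have "\<dots> \<le> a\<^sup>2 * X\<^sup>2" using X by (intro mult_left_mono) (auto simp: power2_eq_square)
        finally show ?thesis by (simp add: power_mult_distrib)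
      qed
      moreover have "M * S * (Suc k + 1) \<le> 2 * M * X"
      proof -
        have "M * S * (Suc k + 1) \<le> M * S * (2 * (k + 1))"
          using M S by (intro mult_left_mono) auto
        thus ?thesis by (simp add: X_def algebra_simps)
      qed
      ultimately show ?case unfolding rd by linarith
    qed
    obtain B where B: "\<And>r. r \<in> {1..r0 + 1} \<Longrightarrow> U r \<le> B" using bdd[of "r0 + 1"] by blast
    obtain k :: nat where "real k > B" using reals_Archimedean2 by blast
    moreover have "1 * (real k + 1) \<le> M * S * (real k + 1)"
      using M S mult_mono[of 1 M 1 S] by (intro mult_right_mono) auto
    moreover have "U (r0 + 1 - (1/2)^k) \<le> B" 
      using r0 power_le_one[of "1/2::real" k] by (intro B) auto
    ultimately show False using claim[of k] by (simp add: algebra_simps)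
  qed
  thus ?thesis by (rule that)
qed

section \<open>Entire functions bounded by exp (C r^\<tau>)\<close>

abbreviation order_growth :: "real \<Rightarrow> (complex \<Rightarrow> complex) \<Rightarrow> bool" where
  "order_growth \<tau> \<equiv> growth_scale.exp_growth \<tau> (\<lambda>_. 0)"

lemma growth_scale_0: "\<tau> > 0 \<Longrightarrow> growth_scale \<tau> (\<lambda>_. 0)"
  by unfold_locales auto

lemma order_growthE:
  assumes "\<tau> > 0" "order_growth \<tau> F"
  obtains C where "C \<ge> 0" "\<And>r z. r \<ge> 1 \<Longrightarrow> norm z \<le> r \<Longrightarrow> norm (F z) \<le> exp (C * r powr \<tau>)"
proof -
  interpret growth_scale \<tau> "\<lambda>_. 0" using assms(1) by (rule growth_scale_0)
  obtain C where C: "C \<ge> 0" "\<And>r \<delta> z. 1 \<le> r \<Longrightarrow> 0 < \<delta> \<Longrightarrow> \<delta> \<le> 1 \<Longrightarrow> norm z \<le> r \<Longrightarrow> norm (F z) \<le> exp (C * scale r \<delta>)"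
    using exp_growthE[OF assms(2)] by metis
  have "scale r 1 = r powr \<tau>" for r by (simp add: scale_def)
  with C(1) C(2)[of _ 1] show ?thesis by (intro that[of C]) auto
qed

lemma order_growthI:
  assumes "\<tau> > 0" "F holomorphic_on UNIV" "\<And>r z. r \<ge> 1 \<Longrightarrow> norm z \<le> r \<Longrightarrow> norm (F z) \<le> exp (C * r powr \<tau>)"
  shows "order_growth \<tau> F"
proof -
  interpret growth_scale \<tau> "\<lambda>_. 0" using assms(1) by (rule growth_scale_0)
  show ?thesis
  proof (rule exp_growthI[where C = "max 0 C"])
    fix r \<delta> :: real and z assume *: "1 \<le> r" "0 < \<delta>" "\<delta> \<le> 1" "cmod z \<le> r"
    have "norm (F z) \<le> exp (C * r powr \<tau>)" using assms * by blast
    also have "C * r powr \<tau> \<le> max 0 C * scale r \<delta>"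
      using scale_ge(2)[OF *(1-3)] by (intro mult_mono) auto
    finally show "norm (F z) \<le> exp (max 0 C * scale r \<delta>)" by simp
  qed fact
qed

lemma order_growth_holomorphic: "\<tau> > 0 \<Longrightarrow> order_growth \<tau> F \<Longrightarrow> F holomorphic_on S"
  using growth_scale.exp_growth_holomorphic growth_scale_0 by metis

text \<open>Because |G| exp (max 0 (Re h)) is the larger of |G| and |F|, the averaged estimate
  bounds the positive mean of Re h without any division by G.\<close>

lemma polynomial_of_exp_quotient:
  assumes "\<tau> > 0" "order_growth \<tau> F" "order_growth \<tau> G" "G w0 \<noteq> 0"
    and h: "h holomorphic_on UNIV" and eq: "\<And>z. F z = G z * exp (h z)"
  obtains H where "\<And>z. h z = poly H z" "real (degree H) \<le> \<tau>"
proof -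
  obtain A where A: "A \<ge> 0" "\<And>r z. r \<ge> 1 \<Longrightarrow> norm z \<le> r \<Longrightarrow> norm (F z) \<le> exp (A * r powr \<tau>)"
    using order_growthE[OF assms(1,2)] by blast
  obtain B where B: "B \<ge> 0" "\<And>r z. r \<ge> 1 \<Longrightarrow> norm z \<le> r \<Longrightarrow> norm (G z) \<le> exp (B * r powr \<tau>)"
    using order_growthE[OF assms(1,3)] by blast
  have "G holomorphic_on UNIV" using assms(1,3) by (rule order_growth_holomorphic)
  then obtain C where C: "C \<ge> 0" "\<And>r \<psi> B. r \<ge> 1 \<Longrightarrow> continuous_on UNIV \<psi> \<Longrightarrow>
     (\<And>z. norm z \<le> r \<Longrightarrow> norm (G z) * exp (\<psi> z) \<le> exp B) \<Longrightarrow> circ_mean r \<psi> \<le> B + C"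
    using circ_mean_le[of G w0] assms(4) by metis
  have "pos_mean h r \<le> (max A B + C) * r powr \<tau>" if r: "r \<ge> 1" for r
  proof -
    have "pos_mean h r \<le> max A B * r powr \<tau> + C"
      unfolding pos_mean_def
    proof (rule C(2)[OF r])
      fix z :: complex assume z: "norm z \<le> r"
      have "norm (G z) * exp (max 0 (Re (h z))) = max (norm (G z)) (norm (F z))"
        by (auto simp: eq norm_mult max_def mult_le_cancel_left1)
      also have "\<dots> \<le> max (exp (B * r powr \<tau>)) (exp (A * r powr \<tau>))"
        using A(2)[OF r z] B(2)[OF r z] by linarith
      also have "\<dots> \<le> exp (max A B * r powr \<tau>)"
        by (auto intro!: mult_right_mono)
      finally show "norm (G z) * exp (max 0 (Re (h z))) \<le> exp (max A B * r powr \<tau>)" .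
    qed (intro continuous_intros holomorphic_on_imp_continuous_on h)
    moreover have "C * 1 \<le> C * r powr \<tau>"
      using C(1) r assms(1) by (intro mult_left_mono) (auto simp: ge_one_powr_ge_zero)
    ultimately show ?thesis by (simp add: algebra_simps)
  qed
  thus ?thesis using polynomial_of_pos_mean_le[OF h less_imp_le[OF assms(1)], of "max A B + C"] that by metis
qed

lemma degree_le_of_exp_quotient:
  assumes "\<tau> > 0" "order_growth \<tau> F" "order_growth \<tau> G" "G w0 \<noteq> 0"
    and eq: "\<And>z. F z = G z * exp (poly Q z)"
  shows "real (degree Q) \<le> \<tau>"
proof -
  have "poly Q holomorphic_on UNIV" by (intro holomorphic_intros)
  then obtain H where "\<And>z. poly Q z = poly H z" "real (degree H) \<le> \<tau>"
    using polynomial_of_exp_quotient[OF assms(1-4)] eq by metis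
  thus ?thesis by (metis poly_eq_poly_eq_iff ext)
qed

section \<open>Borel's theorem on exponential sums\<close>

text \<open>S / T has derivative 0 on a disc where T has no zero; the identity theorem extends the
  resulting relation to the plane.\<close>

lemma proportional_of_wronskian:
  assumes S: "S holomorphic_on UNIV" "T holomorphic_on UNIV" "T w0 \<noteq> 0"
    and W: "\<And>z. deriv S z * T z = S z * deriv T z"
  obtains c where "\<And>z. S z = c * T z"
proof -
  have "continuous_on UNIV T" using S by (simp add: holomorphic_on_imp_continuous_on)
  hence "open {z. T z \<noteq> 0}" by (intro open_Collect_neq) auto
  then obtain e where e: "e > 0" "\<And>z. z \<in> ball w0 e \<Longrightarrow> T z \<noteq> 0"
    using S(3) by (auto simp: open_contains_ball subset_iff)
  have dS: "(S has_field_derivative deriv S z) (at z)" and dT: "(T has_field_derivative deriv T z) (at z)" for z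
    using S holomorphic_derivI open_UNIV UNIV_I by blast+
  have "\<exists>c. \<forall>z\<in>ball w0 e. S z / T z = c"
  proof (rule has_field_derivative_zero_constant)
    fix z assume z: "z \<in> ball w0 e"
    have "((\<lambda>z. S z / T z) has_field_derivative (deriv S z * T z - S z * deriv T z) / (T z * T z)) (at z)"
      using DERIV_divide[OF dS dT e(2)[OF z]] .
    thus "((\<lambda>z. S z / T z) has_field_derivative 0) (at z within ball w0 e)"
      using W by (simp add: has_field_derivative_at_within)
  qed auto
  then obtain c where c: "\<And>z. z \<in> ball w0 e \<Longrightarrow> S z / T z = c" by blast
  have "S z - c * T z = 0" for z
  proof (rule analytic_continuation_open[of "ball w0 e" UNIV "\<lambda>z. S z - c * T z" "\<lambda>_. 0"])
    show "(\<lambda>z. S z - c * T z) holomorphic_on UNIV" by (intro holomorphic_intros S)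
    show "S z - c * T z = 0" if "z \<in> ball w0 e" for z
      using c[OF that] e(2)[OF that] by (auto simp: field_simps)
  qed (use e in \<open>auto simp: connected_UNIV\<close>)
  hence "\<And>z. S z = c * T z" by simp
  thus ?thesis by (rule that)
qed

text \<open>Induction on the number of terms, with the coefficients left arbitrary because the
  elimination changes them. The shorter relation is again admissible since growth classes are closed
  under derivatives and under products with polynomials.\<close>

lemma borel_independence:
  assumes "\<tau> > 0" "finite I"
    and "\<And>i. i \<in> I \<Longrightarrow> order_growth \<tau> (G i)"
    and "\<And>i j. i \<in> I \<Longrightarrow> j \<in> I \<Longrightarrow> i \<noteq> j \<Longrightarrow> real (degree (Q i - Q j)) > \<tau>"
    and "\<And>z. (\<Sum>i\<in>I. G i z * exp (poly (Q i) z)) = 0"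
    and "i \<in> I"
  shows "G i z = 0"
  using assms(2-)
proof (induction I arbitrary: G i z)
  case empty
  thus ?case by simp
next
  case (insert m I)
  interpret growth_scale \<tau> "\<lambda>_. 0" using assms(1) by (rule growth_scale_0)
  define S where "S = (\<lambda>i z. G i z * exp (poly (Q i) z))"
  have hG: "G i holomorphic_on UNIV" if "i \<in> insert m I" for i
    using insert.prems(1)[OF that] by (rule exp_growth_holomorphic)
  have hS: "S i holomorphic_on UNIV" if "i \<in> insert m I" for i
    unfolding S_def by (intro holomorphic_intros hG that)
  have dS: "deriv (S i) z = (deriv (G i) z + G i z * poly (pderiv (Q i)) z) * exp (poly (Q i) z)"
    if "i \<in> insert m I" for i z
  proof -
    have "(G i has_field_derivative deriv (G i) z) (at z)"
      using hG[OF that] holomorphic_derivI by blast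
    hence "(S i has_field_derivative deriv (G i) z * exp (poly (Q i) z) + 
        (exp (poly (Q i) z) * poly (pderiv (Q i)) z) * G i z) (at z)"
      unfolding S_def by (intro DERIV_mult) (auto intro!: derivative_eq_intros poly_DERIV)
    thus ?thesis by (simp add: DERIV_imp_deriv algebra_simps)
  qed
  have sumS: "(\<Sum>i\<in>insert m I. S i z) = 0" for z using insert.prems(3) by (simp add: S_def)
  have sumdS: "(\<Sum>i\<in>insert m I. deriv (S i) z) = 0" for z
  proof -
    have "((\<lambda>z. \<Sum>i\<in>insert m I. S i z) has_field_derivative (\<Sum>i\<in>insert m I. deriv (S i) z)) (at z)"
      using hS holomorphic_derivI by (intro DERIV_sum) blast
    moreover have "((\<lambda>z. \<Sum>i\<in>insert m I. S i z) has_field_derivative 0) (at z)"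
      unfolding sumS by simp
    ultimately show ?thesis by (rule DERIV_unique)
  qed
  have zero_if: "G m z = 0" if "\<And>i z. i \<in> I \<Longrightarrow> G i z = 0" for z
    using insert.prems(3)[of z] insert.hyps that by simp
  have I0: "G i z = 0" if i: "i \<in> I" for i z
  proof (cases "\<forall>z. G m z = 0")
    case True
    show ?thesis
      by (rule insert.IH) (use insert.prems insert.hyps i True in auto)
  next
    case False
    then obtain w0 where w0: "G m w0 \<noteq> 0" by blast
    \<comment> \<open>differentiating the relation and eliminating its \<open>m\<close>-th term gives a shorter relation with
      coefficients \<open>H i\<close>; their vanishing says that the Wronskian of \<open>S i\<close> and \<open>S m\<close> is zero\<close>
    define H where "H = (\<lambda>i z. G m z * (deriv (G i) z + G i z * poly (pderiv (Q i)) z)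
         - (deriv (G m) z + G m z * poly (pderiv (Q m)) z) * G i z)"
    have H: "H i z * exp (poly (Q i) z) = G m z * deriv (S i) z - (deriv (G m) z + G m z * poly (pderiv (Q m)) z) * S i z"
      if "i \<in> insert m I" for i z
      unfolding dS[OF that] by (simp add: H_def S_def algebra_simps)
    have H0: "H i z = 0" for z
    proof (rule insert.IH[of H])
      show "exp_growth (H j)" if "j \<in> I" for j
        unfolding H_def using that insert.prems(1) by (intro exp_growth_diff exp_growth_mult exp_growth_add exp_growth_deriv exp_growth_poly) auto
      show "(\<Sum>i\<in>I. H i z * exp (poly (Q i) z)) = 0" for z
      proof -
        have "H m z = 0" by (simp add: H_def)
        hence "(\<Sum>i\<in>I. H i z * exp (poly (Q i) z)) = (\<Sum>i\<in>insert m I. H i z * exp (poly (Q i) z))"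
          using insert.hyps by simp
        also have "\<dots> = (\<Sum>i\<in>insert m I. G m z * deriv (S i) z - (deriv (G m) z + G m z * poly (pderiv (Q m)) z) * S i z)"
          by (intro sum.cong refl H)
        also have "\<dots> = 0"
          unfolding sum_subtractf sum_distrib_left[symmetric] sumS sumdS by simp
        finally show ?thesis .
      qed
    qed (use insert.prems i in auto)
    have W: "deriv (S i) z * S m z = S i z * deriv (S m) z" for z
    proof -
      have "deriv (S i) z * G m z = (deriv (G m) z + G m z * poly (pderiv (Q m)) z) * S i z"
        using H[of i z] H0[of z] i by (simp add: algebra_simps)
      hence "deriv (S i) z * G m z * exp (poly (Q m) z) = S i z * deriv (S m) z"
        by (simp add: dS)
      thus ?thesis by (simp add: S_def mult.assoc)
    qed
    have "S m w0 \<noteq> 0" using w0 by (simp add: S_def)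
    then obtain c where c: "\<And>z. S i z = c * S m z"
      using proportional_of_wronskian[OF hS hS] i W by (metis insertCI)
    show ?thesis
    proof (cases "c = 0")
      case True
      thus ?thesis using c[of z] by (simp add: S_def)
    next
      case False
      \<comment> \<open>A nonzero ratio c would write exp (Q m - Q i) as a quotient of two functions
        of growth \<tau>, which limits the degree.\<close>
      have "real (degree (Q m - Q i)) \<le> \<tau>"
      proof (rule degree_le_of_exp_quotient[OF assms(1)])
        show "exp_growth (G i)" "exp_growth (\<lambda>z. c * G m z)" using insert.prems(1) i by auto
        show "c * G m w0 \<noteq> 0" using w0 False by simp
        show "G i z = c * G m z * exp (poly (Q m - Q i) z)" for z
          using c[of z] by (simp add: S_def exp_diff field_simps)
      qed
      moreover have "m \<noteq> i" using i insert.hyps by auto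
      hence "real (degree (Q m - Q i)) > \<tau>" using insert.prems(2)[of m i] i by simp
      ultimately show ?thesis by linarith
    qed
  qed
  show ?case using I0 zero_if insert.prems(4) by auto
qed

text \<open>Having a difference of degree \<le> \<tau> is an equivalence relation on the exponents.
  In each class the exponential of a representative is factored out; what remains, exp (Q i - Q j)
  with a small exponent, is absorbed into the coefficient. Ungrouped independence then applies to
  the representatives.\<close>

lemma borel_independence_grouped:
  assumes "\<tau> > 0" "finite I" "\<And>i. i \<in> I \<Longrightarrow> order_growth \<tau> (G i)"
    and sum0: "\<And>z. (\<Sum>i\<in>I. G i z * exp (poly (Q i) z)) = 0" and "k \<in> I"
  shows "(\<Sum>i | i \<in> I \<and> real (degree (Q i - Q k)) \<le> \<tau>. G i z * exp (poly (Q i) z)) = 0"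
proof -
  interpret growth_scale \<tau> "\<lambda>_. 0" using assms(1) by (rule growth_scale_0)
  define R where "R = (\<lambda>i j. real (degree (Q i - Q j)) \<le> \<tau>)"
  have refl: "R i i" for i using assms(1) by (simp add: R_def)
  have sym: "R i j \<Longrightarrow> R j i" for i j unfolding R_def by (metis degree_minus minus_diff_eq)
  have trans: "R i l" if "R i j" "R j l" for i j l
  proof -
    have "degree ((Q i - Q j) + (Q j - Q l)) \<le> max (degree (Q i - Q j)) (degree (Q j - Q l))"
      by (rule degree_add_le_max)
    thus ?thesis using that unfolding R_def by (simp add: max_def split: if_splits)
  qed
  \<comment> \<open>The choice depends only on the predicate \<open>R i\<close>, and equivalent
    indices have the same predicate, hence the same representative.\<close>
  define rep where "rep = (\<lambda>i. SOME j. j \<in> I \<and> R i j)"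
  have rep: "rep i \<in> I" "R i (rep i)" if "i \<in> I" for i
    using someI[of "\<lambda>j. j \<in> I \<and> R i j" i] that refl unfolding rep_def by auto
  have rep_eq: "rep i = rep j" if "R i j" for i j
  proof -
    have "R i = R j" using that sym trans by (intro ext) blast
    thus ?thesis by (simp add: rep_def)
  qed
  have rep_iff: "rep i = rep j \<longleftrightarrow> R i j" if "i \<in> I" "j \<in> I" for i j
    using rep_eq rep[OF that(1)] rep[OF that(2)] sym trans by metis
  define H where "H = (\<lambda>j z. \<Sum>i | i \<in> I \<and> rep i = j. G i z * exp (poly (Q i - Q j) z))"
  have *: "(\<Sum>i | i \<in> I \<and> rep i = j. G i z * exp (poly (Q i) z)) = H j z * exp (poly (Q j) z)" for j z
    unfolding H_def sum_distrib_right by (intro sum.cong) (auto simp: exp_diff)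
  have "H (rep k) z = 0"
  proof (rule borel_independence[OF assms(1), of "rep ` I" H Q])
    show "order_growth \<tau> (H j)" if "j \<in> rep ` I" for j
      unfolding H_def
    proof (intro exp_growth_sum exp_growth_mult exp_growth_exp_poly)
      fix i assume "i \<in> {i \<in> I. rep i = j}"
      thus "exp_growth (G i)" "real (degree (Q i - Q j)) \<le> \<tau>" using assms(3) rep(2)[of i] by (auto simp: R_def)
    qed
    show "real (degree (Q i - Q j)) > \<tau>" if ij: "i \<in> rep ` I" "j \<in> rep ` I" "i \<noteq> j" for i j
    proof (rule ccontr)
      assume "\<not> ?thesis"
      hence "R i j" by (simp add: R_def)
      then obtain i' j' where "i' \<in> I" "i = rep i'" "j' \<in> I" "j = rep j'" using ij by auto
      thus False using rep_eq[OF \<open>R i j\<close>] rep rep_eq ij(3) by metis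
    qed
    show "(\<Sum>j\<in>rep ` I. H j z * exp (poly (Q j) z)) = 0" for z
      unfolding *[symmetric] using sum.image_gen[OF assms(2), of "\<lambda>i. G i z * exp (poly (Q i) z)" rep] sum0[of z] by simp
  qed (use assms in auto)
  hence "(\<Sum>i | i \<in> I \<and> rep i = rep k. G i z * exp (poly (Q i) z)) = 0" unfolding * by simp
  also have "{i. i \<in> I \<and> rep i = rep k} = {i. i \<in> I \<and> real (degree (Q i - Q k)) \<le> \<tau>}"
    using rep_iff assms(5) by (auto simp: R_def)
  finally show ?thesis .
qed

section \<open>Canonical products and factorization\<close>

lemma entire_eventually_nonzero:
  assumes "F holomorphic_on UNIV" "F w0 \<noteq> 0"
  shows "eventually (\<lambda>w. F w \<noteq> 0) (at z)"
  using non_zero_neighbour_alt[OF assms(1) open_UNIV connected_UNIV, of z w0] assms(2) by simp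

lemma entire_nonzero_cosparse:
  assumes "F holomorphic_on UNIV" "F w0 \<noteq> 0"
  shows "\<forall>\<^sub>\<approx>z\<in>UNIV. F z \<noteq> 0"
  using entire_eventually_nonzero[OF assms] by (simp add: eventually_cosparse_open_eq)

lemma entire_exp_exists:
  assumes "F holomorphic_on UNIV" "\<And>z. F z \<noteq> 0"
  obtains g where "g holomorphic_on UNIV" "\<And>z. F z = exp (g z)"
  using holomorphic_logarithm_exists[of UNIV F 0] assms by (metis UNIV_I convex_UNIV open_UNIV)

text \<open>Near 0 the factor differs from 1 by O(|w|^(p+1)), and \<tau> \<le> p + 1; away from 0
  its logarithm is O(|w|^p + ln |w|), up to constants, and p \<le> \<tau>.\<close>

lemma weierstrass_factor_norm_le:
  assumes "\<tau> > 0" "real p \<le> \<tau>" "\<tau> \<le> real p + 1"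
  obtains K where "K \<ge> 0" "\<And>w. norm (weierstrass_factor p w) \<le> exp (K * norm w powr \<tau>)"
proof -
  \<comment> \<open>The 3 is the constant of the estimate for |w| \<le> 1/2. In p + 1 + 1/\<tau> the
    summands come from the polynomial in the exponent, from ln 2, and from ln x \<le> x^\<tau> /
    \<tau>.\<close>
  define K where "K = max 3 ((p + 1 + 1 / \<tau>) * 2 powr \<tau>)"
  have "norm (weierstrass_factor p w) \<le> exp (K * norm w powr \<tau>)" for w
  proof (cases "norm w \<le> 1 / 2")
    case True
    have "norm w ^ Suc p \<le> norm w powr \<tau>"
    proof (cases "w = 0")
      case False
      hence "norm w ^ Suc p = norm w powr (real p + 1)" by (simp add: powr_add powr_realpow)
      also have "\<dots> \<le> norm w powr \<tau>" using True False assms by (intro powr_mono') auto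
      finally show ?thesis .
    qed auto
    hence *: "3 * norm w ^ Suc p \<le> K * norm w powr \<tau>" by (intro mult_mono) (auto simp: K_def)
    have "norm (weierstrass_factor p w) \<le> 1 + norm (weierstrass_factor p w - 1)"
      using norm_triangle_ineq[of 1 "weierstrass_factor p w - 1"] by simp
    also have "\<dots> \<le> 1 + 3 * norm w ^ Suc p" using weierstrass_factor_bound[OF True] by simp
    also have "\<dots> \<le> exp (3 * norm w ^ Suc p)" by simp
    also have "\<dots> \<le> exp (K * norm w powr \<tau>)" using * by simp
    finally show ?thesis .
  next
    case False
    \<comment> \<open>Doubling |w| gives a base above 1, for which powers increase with the
      exponent.\<close>
    define x where "x = 2 * norm w"
    have x: "x > 1" using False by (simp add: x_def)
    have xt: "1 \<le> x powr \<tau>" using x assms by (simp add: ge_one_powr_ge_zero)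
    have "norm (\<Sum>k=1..p. w ^ k / of_nat k) \<le> (\<Sum>k=1..p. x powr \<tau>)"
    proof (rule sum_norm_le)
      fix k assume k: "k \<in> {1..p}"
      have "norm (w ^ k / of_nat k) = norm w ^ k / k" by (simp add: norm_divide norm_power)
      also have "\<dots> \<le> norm w ^ k / 1" using k by (intro divide_left_mono) auto
      also have "\<dots> \<le> x ^ k" unfolding x_def using power_mono[of "norm w" "2 * norm w" k] by simp
      also have "\<dots> = x powr k" using x by (simp add: powr_realpow)
      also have "\<dots> \<le> x powr \<tau>" using x k assms by (intro powr_mono) auto
      finally show "norm (w ^ k / of_nat k) \<le> x powr \<tau>" .
    qed
    hence S: "norm (\<Sum>k=1..p. w ^ k / of_nat k) \<le> p * x powr \<tau>" by simp
    have "norm (1 - w) \<le> 1 + norm w" using norm_triangle_ineq4[of 1 w] by simp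
    also have "\<dots> \<le> 2 * x" using x by (simp add: x_def)
    also have "\<dots> = exp (ln 2 + ln x)" using x by (simp add: exp_add)
    also have "ln x \<le> x powr \<tau> / \<tau>" using x assms by (intro ln_powr_bound) auto
    also have "ln 2 \<le> x powr \<tau>" using ln_le_minus_one[of "2::real"] xt by simp
    finally have L: "norm (1 - w) \<le> exp (x powr \<tau> + x powr \<tau> / \<tau>)" by simp
    have "norm (weierstrass_factor p w) \<le> exp (x powr \<tau> + x powr \<tau> / \<tau>) * exp (p * x powr \<tau>)"
      unfolding weierstrass_factor_def norm_mult
      by (intro mult_mono L order_trans[OF norm_exp]) (use S in auto)
    also have "\<dots> = exp ((p + 1 + 1 / \<tau>) * x powr \<tau>)"
      by (simp add: exp_add[symmetric] algebra_simps)
    also have "x powr \<tau> = 2 powr \<tau> * norm w powr \<tau>" by (simp add: x_def powr_mult)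
    also have "exp ((p + 1 + 1 / \<tau>) * (2 powr \<tau> * norm w powr \<tau>)) \<le> exp (K * norm w powr \<tau>)"
      unfolding K_def exp_le_cancel_iff mult.assoc[symmetric] by (intro mult_right_mono) auto
    finally show ?thesis .
  qed
  thus ?thesis using that[of K] by (simp add: K_def)
qed

text \<open>With the constant genus p = floor \<tau>, the product converges since p + 1 \<ge> \<tau>
  and |a n| \<ge> 1 eventually. Multiplying the bounds of the single factors gives exp (K S
  |z|^\<tau>), where S is the sum of |a n|^(-\<tau>).\<close>

lemma order_growth_canonical_product:
  fixes a :: "nat \<Rightarrow> complex"
  assumes "\<tau> > 0" and a: "\<And>n. a n \<noteq> 0" "filterlim a at_infinity at_top"
    and summ: "summable (\<lambda>n. norm (a n) powr (-\<tau>))"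
  obtains p where "weierstrass_product a p" "order_growth \<tau> (weierstrass_product.f a p)"
proof -
  define p where "p = nat \<lfloor>\<tau>\<rfloor>"
  have p: "real p \<le> \<tau>" "\<tau> \<le> real p + 1" using assms(1) by (auto simp: p_def)
  have *: "weierstrass_product a (\<lambda>_. p)"
  proof
    fix r :: real assume r: "r > 0"
    show "summable (\<lambda>n. (r / norm (a n)) ^ Suc p)"
    proof (rule summable_comparison_test_ev)
      show "summable (\<lambda>n. r ^ Suc p * norm (a n) powr (-\<tau>))" by (intro summable_mult summ)
      have "eventually (\<lambda>n. norm (a n) \<ge> 1) at_top"
        using a(2) by (metis filterlim_at_infinity_imp_norm_at_top filterlim_at_top)
      thus "eventually (\<lambda>n. norm ((r / norm (a n)) ^ Suc p) \<le> r ^ Suc p * norm (a n) powr (-\<tau>)) at_top"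
      proof eventually_elim
        case (elim n)
        have "norm (a n) powr (- (real p + 1)) = inverse (norm (a n) ^ Suc p)"
          using powr_realpow[of "norm (a n)" "Suc p"] a(1)[of n]
          by (subst powr_minus) (simp add: add.commute)
        hence "norm ((r / norm (a n)) ^ Suc p) = r ^ Suc p * norm (a n) powr (- (real p + 1))"
          using r by (simp add: divide_inverse abs_mult power_mult_distrib power_inverse)
        also have "\<dots> \<le> r ^ Suc p * norm (a n) powr (-\<tau>)"
          using r p elim by (intro mult_left_mono powr_mono) auto
        finally show ?case .
      qed
    qed
  qed (use a in auto)
  interpret w: weierstrass_product a "\<lambda>_. p" by (rule *)
  obtain K where K: "K \<ge> 0" "\<And>w. norm (weierstrass_factor p w) \<le> exp (K * norm w powr \<tau>)"
    using weierstrass_factor_norm_le[OF assms(1) p] by blast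
  define S where "S = suminf (\<lambda>n. norm (a n) powr (-\<tau>))"
  have bound: "norm (w.f z) \<le> exp (K * S * norm z powr \<tau>)" for z
  proof -
    have "(\<lambda>n. norm (\<Prod>i\<le>n. weierstrass_factor p (z / a i))) \<longlonglongrightarrow> norm (w.f z)"
      unfolding w.f_def by (intro tendsto_norm convergent_prod_LIMSEQ w.convergent)
    moreover have "norm (\<Prod>i\<le>n. weierstrass_factor p (z / a i)) \<le> exp (K * S * norm z powr \<tau>)" for n
    proof -
      have "norm (\<Prod>i\<le>n. weierstrass_factor p (z / a i)) \<le> (\<Prod>i\<le>n. exp (K * norm (z / a i) powr \<tau>))"
        unfolding prod_norm[symmetric] by (intro prod_mono conjI K(2)) auto
      also have "\<dots> = exp (\<Sum>i\<le>n. K * norm (z / a i) powr \<tau>)" by (simp add: exp_sum)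
      also have "(\<Sum>i\<le>n. K * norm (z / a i) powr \<tau>) = (\<Sum>i\<le>n. norm (a i) powr (-\<tau>)) * (K * norm z powr \<tau>)"
        unfolding sum_distrib_right
      proof (intro sum.cong refl)
        fix i
        have "norm (z / a i) powr \<tau> = norm z powr \<tau> * norm (a i) powr (-\<tau>)"
          unfolding norm_divide by (subst powr_divide) (auto simp: powr_minus divide_inverse)
        thus "K * norm (z / a i) powr \<tau> = norm (a i) powr (-\<tau>) * (K * norm z powr \<tau>)" by simp
      qed
      also have "\<dots> \<le> S * (K * norm z powr \<tau>)"
        unfolding S_def using K by (intro mult_right_mono sum_le_suminf summ) auto
      finally show ?thesis by (simp add: mult_ac)
    qed
    ultimately show ?thesis by (intro LIMSEQ_le_const2) auto
  qed
  have "S \<ge> 0" unfolding S_def by (intro suminf_nonneg summ) auto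
  have "order_growth \<tau> w.f"
  proof (rule order_growthI[OF \<open>\<tau> > 0\<close> w.holomorphic])
    fix r :: real and z :: complex assume *: "r \<ge> 1" "norm z \<le> r"
    have "K * S * norm z powr \<tau> \<le> K * S * r powr \<tau>"
      using K(1) \<open>S \<ge> 0\<close> * \<open>\<tau> > 0\<close> by (intro mult_left_mono powr_mono2) auto
    thus "norm (w.f z) \<le> exp (K * S * r powr \<tau>)" using bound[of z] by (smt (verit) exp_le_cancel_iff)
  qed
  thus ?thesis using that * by blast
qed

text \<open>Passes from a sum over distinct zeros weighted by multiplicity to a series over a
  sequence that repeats each zero accordingly. Partial sums suffice because all terms are
  nonnegative.\<close>

lemma summable_of_multiplicities:
  fixes a :: "nat \<Rightarrow> 'a" and g :: "'a \<Rightarrow> real" and c :: "'a \<Rightarrow> nat"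
  assumes "(\<lambda>z. real (c z) * g z) summable_on Z" "range a = Z"
    and "\<And>z. z \<in> Z \<Longrightarrow> finite (a -` {z}) \<and> card (a -` {z}) = c z" "\<And>z. g z \<ge> 0"
  shows "summable (\<lambda>n. g (a n))"
proof (rule summableI_nonneg_bounded)
  fix n
  have "(\<Sum>i<n. g (a i)) = (\<Sum>z\<in>a ` {..<n}. \<Sum>i | i \<in> {..<n} \<and> a i = z. g (a i))"
    by (rule sum.image_gen) auto
  also have "\<dots> = (\<Sum>z\<in>a ` {..<n}. card {i. i \<in> {..<n} \<and> a i = z} * g z)"
    by (intro sum.cong refl) simp
  also have "\<dots> \<le> (\<Sum>z\<in>a ` {..<n}. c z * g z)"
  proof (intro sum_mono mult_right_mono)
    fix z assume "z \<in> a ` {..<n}"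
    hence *: "finite (a -` {z}) \<and> card (a -` {z}) = c z" using assms(2) by (intro assms(3)) auto
    have "card {i. i \<in> {..<n} \<and> a i = z} \<le> card (a -` {z})"
      by (intro card_mono) (use * in auto)
    thus "real (card {i. i \<in> {..<n} \<and> a i = z}) \<le> c z" using * by simp
  qed (use assms in auto)
  also have "\<dots> \<le> infsum (\<lambda>z. real (c z) * g z) Z"
    by (rule finite_sum_le_infsum[OF assms(1)]) (use assms(2,4) in auto)
  finally show "(\<Sum>i<n. g (a i)) \<le> infsum (\<lambda>z. real (c z) * g z) Z" .
qed (use assms in auto)

text \<open>The zero at the origin is split off and the other zeros are collected in a canonical
  product. The remaining quotient is zero-free, hence an exponential.\<close>

lemma entire_factorization:
  assumes E: "E holomorphic_on UNIV" "E w0 \<noteq> 0" and "\<tau> > 0"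
    and summ: "(\<lambda>z. real (nat (zorder E z)) * norm z powr (-\<tau>)) summable_on {z. z \<noteq> 0 \<and> E z = 0}"
  obtains d g where "order_growth \<tau> d" "g holomorphic_on UNIV" "\<And>z. E z = d z * exp (g z)"
proof -
  interpret growth_scale \<tau> "\<lambda>_. 0" using assms(3) by (rule growth_scale_0)
  obtain E1 m where E1: "E1 holomorphic_on UNIV" "E1 0 \<noteq> 0" "\<And>z. E z = (z - 0) ^ m * E1 z"
    using entire_factor_zero[OF E] by metis
  define Z where "Z = {z. E1 z = 0}"
  have Z: "Z = {z. z \<noteq> 0 \<and> E z = 0}" using E1(2,3) by (auto simp: Z_def)
  have fin: "finite (Z \<inter> cball 0 r)" for r
    using entire_finite_zeros_cball[OF E1(1,2), of r] by (rule finite_subset[rotated]) (auto simp: Z_def)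
  have "\<exists>d g. order_growth \<tau> d \<and> g holomorphic_on UNIV \<and> (\<forall>z. E1 z = d z * exp (g z))"
  \<comment> \<open>A canonical product is indexed by an infinite sequence, so finitely many zeros
    are collected in a finite product instead.\<close>
  proof (cases "finite Z")
    case True
    obtain G k where G: "G holomorphic_on UNIV" "\<And>w. w \<in> Z \<Longrightarrow> G w \<noteq> 0" 
      "\<And>z. E1 z = (\<Prod>w\<in>Z. (z - w) ^ k w) * G z"
      using entire_factor_finite_zeros[OF True E1(1,2)] by metis
    have "G z \<noteq> 0" for z using G(2,3)[of z] by (cases "z \<in> Z") (auto simp: Z_def)
    then obtain g where g: "g holomorphic_on UNIV" "\<And>z. G z = exp (g z)"
      using entire_exp_exists[OF G(1)] by metis
    have "order_growth \<tau> (\<lambda>z. \<Prod>w\<in>Z. (z - w) ^ k w)"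
      by (intro exp_growth_prod exp_growth_power exp_growth_diff exp_growth_ident exp_growth_const)
    thus ?thesis using g G(3) by (intro exI[of _ "\<lambda>z. \<Prod>w\<in>Z. (z - w) ^ k w"] exI[of _ g]) auto
  next
    case False
    have "closed Z" unfolding Z_def
      by (intro closed_Collect_eq holomorphic_on_imp_continuous_on[OF E1(1)] continuous_intros)
    have ana: "E1 analytic_on {z}" for z using E1(1) by (simp add: analytic_at_imp_no_pole analytic_on_holomorphic) (metis open_UNIV UNIV_I)
    have freq: "frequently (\<lambda>z. E1 z \<noteq> 0) (at z)" for z
      using entire_eventually_nonzero[OF E1(1,2)] by (intro eventually_frequently) auto
    have pos: "zorder E1 z > 0" if "z \<in> Z" for z
      using zorder_pos_iff'[OF ana freq, of z] that by (auto simp: Z_def)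
    have zo: "zorder E z = zorder E1 z" if "z \<noteq> 0" for z
    proof -
      have "zorder (\<lambda>z. z ^ m * E1 z) z = zorder (\<lambda>z. z ^ m) z + zorder E1 z"
      proof (rule zorder_mult)
        show "E1 meromorphic_on {z}" using ana analytic_on_imp_meromorphic_on by blast
        have "eventually (\<lambda>w. w \<noteq> 0) (at z)" by (rule eventually_neq_at_within)
        hence "eventually (\<lambda>w. w ^ m \<noteq> 0) (at z)" by eventually_elim simp
        thus "frequently (\<lambda>z. z ^ m \<noteq> 0) (at z)" by (intro eventually_frequently at_neq_bot)
      qed (auto intro!: meromorphic_intros freq)
      moreover have "zorder (\<lambda>z. z ^ m) z = 0"
        by (rule zorder_eq_0I) (use that in \<open>auto intro!: analytic_intros\<close>)
      moreover have "E = (\<lambda>z. z ^ m * E1 z)" using E1(3) by auto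
      ultimately show ?thesis by simp
    qed
    obtain a :: "nat \<Rightarrow> complex" where a: "range a = Z" "filterlim a at_infinity at_top"
       "\<And>z. z \<in> Z \<Longrightarrow> finite (a -` {z}) \<and> card (a -` {z}) = nat (zorder E1 z)"
      using sequence_of_sparse_set_exists'[OF False \<open>closed Z\<close> fin, of "\<lambda>z. nat (zorder E1 z)"] pos
      by (metis zero_less_nat_eq)
    have a0: "a n \<noteq> 0" for n using a(1) Z by blast
    have "(\<lambda>z. real (nat (zorder E1 z)) * norm z powr (-\<tau>)) summable_on Z"
      using summ unfolding Z[symmetric] by (rule summable_on_cong[THEN iffD1, rotated]) (use zo Z in auto)
    hence "summable (\<lambda>n. norm (a n) powr (-\<tau>))"
      by (rule summable_of_multiplicities[OF _ a(1,3)]) auto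
    then obtain p where p: "weierstrass_product a p" "order_growth \<tau> (weierstrass_product.f a p)"
      using order_growth_canonical_product[OF \<open>\<tau> > 0\<close> a0 a(2)] by blast
    interpret w: weierstrass_product a p by (rule p)
    obtain h where h: "h holomorphic_on UNIV" "\<And>z. h z \<noteq> 0" "\<And>z. E1 z = h z * w.f z"
    proof (rule holomorphic_zorder_factorization[OF E1(1) open_UNIV connected_UNIV w.holomorphic])
      show "w.f z = 0 \<longleftrightarrow> E1 z = 0" for z using w.zero a(1) by (auto simp: Z_def)
      show "zorder w.f z = zorder E1 z" for z
      proof (cases "z \<in> Z")
        case True
        thus ?thesis using w.zorder[of z] a(3)[of z] pos[of z] by simp
      next
        case False
        have "zorder w.f z = 0" by (rule zorder_eq_0I) (use False w.zero a(1) in \<open>auto intro!: w.analytic\<close>)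
        moreover have "zorder E1 z = 0" by (rule zorder_eq_0I) (use False ana in \<open>auto simp: Z_def\<close>)
        ultimately show ?thesis by simp
      qed
    qed auto
    obtain g where "g holomorphic_on UNIV" "\<And>z. h z = exp (g z)"
      using entire_exp_exists[OF h(1,2)] by metis
    thus ?thesis using p(2) h(3) by (intro exI[of _ w.f] exI[of _ g]) auto
  qed
  then obtain d g where "order_growth \<tau> d" "g holomorphic_on UNIV" "\<And>z. E1 z = d z * exp (g z)" by blast
  moreover from this(1) have "order_growth \<tau> (\<lambda>z. z ^ m * d z)" 
    by (intro exp_growth_mult exp_growth_power exp_growth_ident)
  ultimately show ?thesis using E1(3) by (intro that[of "\<lambda>z. z ^ m * d z" g]) auto
qed

lemma order_growth_mono:
  assumes "0 < \<sigma>" "\<sigma> \<le> \<tau>" "order_growth \<sigma> F"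
  shows "order_growth \<tau> F"
proof -
  obtain C where C: "C \<ge> 0" "\<And>r z. r \<ge> 1 \<Longrightarrow> norm z \<le> r \<Longrightarrow> norm (F z) \<le> exp (C * r powr \<sigma>)"
    using order_growthE[OF assms(1,3)] by blast
  show ?thesis
  proof (rule order_growthI[where C = C])
    fix r :: real and z :: complex assume *: "r \<ge> 1" "norm z \<le> r"
    have "C * r powr \<sigma> \<le> C * r powr \<tau>" using C(1) * assms by (intro mult_left_mono powr_mono) auto
    thus "norm (F z) \<le> exp (C * r powr \<tau>)" using C(2)[OF *] by (smt (verit) exp_le_cancel_iff)
  qed (use assms order_growth_holomorphic[OF assms(1,3)] in auto)
qed

text \<open>Weierstrass factorisation writes f as a quotient of entire functions without common
  zeros, up to a unit. Numerator and denominator are then replaced by functions of growth \<tau>,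
  and all exponential factors are merged into h. The exponents \<open>\<tau>1\<close> and
  \<open>\<tau>2\<close> differ because zeros and poles have separate convergence sums.\<close>

lemma meromorphic_factorization:
  assumes f: "f meromorphic_on UNIV" "\<not> (\<forall>\<^sub>\<approx>z\<in>UNIV. f z = 0)"
    and \<tau>: "0 < \<tau>1" "\<tau>1 \<le> \<tau>" "0 < \<tau>2" "\<tau>2 \<le> \<tau>"
    and sumZ: "(\<lambda>z. real (nat (zorder f z)) * norm z powr (-\<tau>1)) summable_on {z. z \<noteq> 0 \<and> isolated_zero f z}"
    and sumP: "(\<lambda>z. real (nat (- zorder f z)) * norm z powr (-\<tau>2)) summable_on {z. z \<noteq> 0 \<and> is_pole f z}"
  obtains d1 d2 h w1 w2 where "order_growth \<tau> d1" "order_growth \<tau> d2" "h holomorphic_on UNIV"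
    "d1 w1 \<noteq> 0" "d2 w2 \<noteq> 0" "\<forall>\<^sub>\<approx>z\<in>UNIV. f z = d1 z / d2 z * exp (h z)"
proof -
  \<comment> \<open>The values of f on a sparse set are arbitrary; removing singularities normalises
    them, and changes neither poles nor orders.\<close>
  define g where "g = remove_sings f"
  have iso: "isolated_singularity_at f z" "not_essential f z" for z
    using f(1) meromorphic_on_altdef by auto
  have gf: "\<forall>\<^sub>\<approx>z\<in>UNIV. g z = f z" unfolding g_def using f(1) by (rule eventually_remove_sings_eq)
  have "g nicely_meromorphic_on UNIV" unfolding g_def using f(1) by (rule remove_sings_nicely_meromorphic)
  then obtain H f1 f2 where w: "H holomorphic_on UNIV" "f1 holomorphic_on UNIV" "f2 holomorphic_on UNIV"
    "\<forall>z. f1 z = 0 \<longleftrightarrow> \<not>is_pole g z \<and> g z = 0"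
    "\<forall>z. f2 z = 0 \<longleftrightarrow> is_pole g z"
    "\<forall>z. \<not>is_pole g z \<longrightarrow> zorder f1 z = zorder g z"
    "\<forall>z. is_pole g z \<longrightarrow> zorder f2 z = -zorder g z"
    "\<forall>z. H z \<noteq> 0" "\<forall>z. g z = H z * f1 z / f2 z"
    by (rule weierstrass_factorization_meromorphic_UNIV) blast
  have "\<exists>w1. f1 w1 \<noteq> 0"
  proof (rule ccontr)
    assume "\<not> ?thesis"
    hence "g z = 0" for z using w(9) by simp
    hence "\<forall>\<^sub>\<approx>z\<in>UNIV. f z = 0" using gf by (auto elim: eventually_mono)
    thus False using f(2) by simp
  qed
  then obtain w1 where w1: "f1 w1 \<noteq> 0" by blast
  have "\<exists>w2. f2 w2 \<noteq> 0"
  proof (rule ccontr)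
    assume "\<not> ?thesis"
    hence "is_pole f z" for z using w(5) iso by (simp add: g_def)
    hence "\<forall>\<^sub>\<approx>z\<in>(UNIV::complex set). False" using meromorphic_on_imp_not_pole_cosparse[OF f(1)] by simp
    thus False by (simp add: eventually_False)
  qed
  then obtain w2 where w2: "f2 w2 \<noteq> 0" by blast
  \<comment> \<open>A limit 0 at z is an isolated zero only if f does not vanish at points near
    z.\<close>
  have ev: "eventually (\<lambda>z. f z \<noteq> 0) (at z)" for z
  proof -
    have "eventually (\<lambda>z. g z = f z) (at z)" using gf by (simp add: eventually_cosparse_open_eq)
    thus ?thesis using entire_eventually_nonzero[OF w(2) w1, of z] entire_eventually_nonzero[OF w(3) w2, of z]
      by eventually_elim (use w(8,9) in auto)
  qed
  have Z1: "isolated_zero f z \<and> zorder f1 z = zorder f z" if "f1 z = 0" for z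
  proof -
    have *: "\<not>is_pole f z" "g z = 0" using that w(4) iso by (auto simp: g_def)
    hence "f \<midarrow>z\<rightarrow> 0" using remove_sings_eq_0_iff[OF iso(2)] by (auto simp: g_def)
    thus ?thesis using ev w(6) * iso by (auto simp: isolated_zero_def g_def)
  qed
  have Z2: "is_pole f z \<and> zorder f2 z = - zorder f z" if "f2 z = 0" for z
    using that w(5,7) iso by (auto simp: g_def)
  have "(\<lambda>z. real (nat (zorder f1 z)) * norm z powr (-\<tau>1)) summable_on {z. z \<noteq> 0 \<and> f1 z = 0}"
    by (rule summable_on_cong[THEN iffD1, OF _ summable_on_subset_banach[OF sumZ]]) (use Z1 in auto)
  then obtain d1 g1 where 1: "order_growth \<tau>1 d1" "g1 holomorphic_on UNIV" "\<And>z. f1 z = d1 z * exp (g1 z)"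
    using entire_factorization[OF w(2) w1 \<tau>(1)] by blast
  have "(\<lambda>z. real (nat (zorder f2 z)) * norm z powr (-\<tau>2)) summable_on {z. z \<noteq> 0 \<and> f2 z = 0}"
    by (rule summable_on_cong[THEN iffD1, OF _ summable_on_subset_banach[OF sumP]]) (use Z2 in auto)
  then obtain d2 g2 where 2: "order_growth \<tau>2 d2" "g2 holomorphic_on UNIV" "\<And>z. f2 z = d2 z * exp (g2 z)"
    using entire_factorization[OF w(3) w2 \<tau>(3)] by blast
  obtain g3 where g3: "g3 holomorphic_on UNIV" "\<And>z. H z = exp (g3 z)"
    using entire_exp_exists[OF w(1)] w(8) by metis
  show ?thesis
  proof (rule that)
    show "order_growth \<tau> d1" "order_growth \<tau> d2" using 1 2 \<tau> order_growth_mono by blast+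
    show "(\<lambda>z. g1 z - g2 z + g3 z) holomorphic_on UNIV" by (intro holomorphic_intros 1 2 g3)
    show "d1 w1 \<noteq> 0" "d2 w2 \<noteq> 0" using w1 w2 1(3) 2(3) by auto
    show "\<forall>\<^sub>\<approx>z\<in>UNIV. f z = d1 z / d2 z * exp (g1 z - g2 z + g3 z)"
      using gf
    proof eventually_elim
      case (elim z)
      have "f z = H z * f1 z / f2 z" using elim w(9) by simp
      thus ?case by (simp add: g3 1(3) 2(3) exp_add exp_diff field_simps)
    qed
  qed
qed

section \<open>Nevanlinna characteristic and order\<close>

text \<open>A sparse set meets a circle in finitely many points, so identities on cosparse sets may
  be used under the integral over the angle.\<close>

lemma finite_bad_angles:
  assumes "\<forall>\<^sub>\<approx>z\<in>UNIV. P z" "r > 0"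
  shows "finite {\<theta> \<in> {0..2*pi}. \<not> P (of_real r * cis \<theta>)}"
proof -
  have "{z. \<not> P z} sparse_in UNIV" using assms(1) by (simp add: eventually_cosparse)
  hence "{z. \<not> P z} sparse_in sphere 0 r" by (rule sparse_in_subset) auto
  hence "finite (sphere 0 r \<inter> {z. \<not> P z})" by (rule sparse_in_compact_finite) auto
  moreover have "inj_on (\<lambda>\<theta>. of_real r * cis \<theta>) {0..<2*pi}"
  proof (rule inj_onI)
    fix x y assume *: "x \<in> {0..<2*pi}" "y \<in> {0..<2*pi}" "of_real r * cis x = of_real r * cis y"
    have "cis x = cis y" using * assms(2) by simp
    hence "sin x = sin y \<and> cos x = cos y" by (auto simp: cis.code)
    then obtain k :: int where k: "x = y + 2 * pi * k" using sin_cos_eq_iff[of x y] by auto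
    have "\<bar>2 * pi * k\<bar> < 2 * pi * 1" using * k by auto
    hence "\<bar>real_of_int k\<bar> < 1" by (simp add: abs_mult)
    hence "k = 0" by linarith
    thus "x = y" using k by simp
  qed
  ultimately have "finite ((\<lambda>\<theta>. of_real r * cis \<theta>) -` (sphere 0 r \<inter> {z. \<not> P z}) \<inter> {0..<2*pi})"
    by (rule finite_vimage_IntI)
  \<comment> \<open>The parametrisation is injective only on the half-open interval; the end point 2
    pi is added separately.\<close>
  hence "finite (insert (2*pi) ((\<lambda>\<theta>. of_real r * cis \<theta>) -` (sphere 0 r \<inter> {z. \<not> P z}) \<inter> {0..<2*pi}))"
    by simp
  thus ?thesis by (rule finite_subset[rotated]) (use assms(2) in \<open>auto simp: norm_mult\<close>)
qed

lemma circ_mean_cosparse_cong: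
  assumes "\<forall>\<^sub>\<approx>z\<in>UNIV. f z = g z" "r > 0"
  shows "circ_mean r f = circ_mean r g"
  unfolding circ_mean_def
  by (subst integral_spike[where S = "{\<theta> \<in> {0..2*pi}. f (of_real r * cis \<theta>) \<noteq> g (of_real r * cis \<theta>)}"])
     (use finite_bad_angles[OF assms] in \<open>auto intro!: negligible_finite\<close>)

lemma proximity_eq_circ_mean: "proximity r f = circ_mean r (\<lambda>z. log_plus (norm (f z)))"
  by (simp add: proximity_def circ_mean_def)

text \<open>The integral of a non-integrable function is 0 by convention, so no integrability has to
  be established.\<close>

lemma integral_nonneg_or_not:
  fixes g :: "real \<Rightarrow> real"
  assumes "\<And>x. x \<in> S \<Longrightarrow> g x \<ge> 0"
  shows "integral S g \<ge> 0"
  using assms by (cases "g integrable_on S") (auto intro: integral_nonneg simp: not_integrable_integral)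

text \<open>
  For \<open>\<epsilon> \<rightarrow> 0\<close> the continuous functions \<open>ln (1 + b / (a + \<epsilon>))\<close> increase to a majorant of
  \<open>log_plus (b / a)\<close>; hence poles on the circle need no separate treatment. (If the integrand of the
  proximity function were not integrable, its integral would be \<open>0\<close>.)
\<close>
lemma log_plus_mean_le:
  assumes f: "\<forall>\<^sub>\<approx>z\<in>UNIV. norm (f z) = b z / a z" and r: "r > 0"
    and a: "continuous_on UNIV a" "\<And>z. a z \<ge> 0" "\<forall>\<^sub>\<approx>z\<in>UNIV. a z \<noteq> 0"
    and b: "continuous_on UNIV b" "\<And>z. b z \<ge> 0"
    and M: "\<And>\<psi>. continuous_on UNIV \<psi> \<Longrightarrow> (\<And>z. norm z \<le> r \<Longrightarrow> a z * exp (\<psi> z) \<le> a z + b z) \<Longrightarrow> circ_mean r \<psi> \<le> M"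
  shows "proximity r f \<le> M"
proof -
  define z where "z = (\<lambda>\<theta>. of_real r * cis \<theta>)"
  define N where "N = {\<theta> \<in> {0..2*pi}. \<not> (norm (f (z \<theta>)) = b (z \<theta>) / a (z \<theta>) \<and> a (z \<theta>) \<noteq> 0)}"
  have "finite N" unfolding N_def z_def
    by (rule finite_bad_angles) (use eventually_conj[OF f a(3)] r in auto)
  hence N: "negligible N" by (rule negligible_finite)
  define \<psi> where "\<psi> = (\<lambda>(k::nat) z. ln (1 + b z / (a z + 1 / real (Suc k))))"
  have pos: "a z + 1 / real (Suc k) > 0" for z k using a(2)[of z] by (intro add_nonneg_pos) auto
  have nz: "a z + 1 / real (Suc k) \<noteq> 0" for z k using pos[of z k] by linarith
  have quot: "b z / (a z + 1 / real (Suc k)) \<ge> 0" for z k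
    using b(2)[of z] pos[of z k] by (intro divide_nonneg_nonneg) auto
  have nz': "1 + b z / (a z + 1 / real (Suc k)) \<noteq> 0" for z k using quot[of z k] by linarith
  have c\<psi>: "continuous_on UNIV (\<psi> k)" for k
    unfolding \<psi>_def using nz nz'
    by (intro continuous_on_ln continuous_on_add continuous_on_divide continuous_on_const a b) auto
  have "circ_mean r (\<psi> k) \<le> M" for k
  proof (rule M[OF c\<psi>])
    fix z
    have "a z * exp (\<psi> k z) = a z + b z * (a z / (a z + 1 / real (Suc k)))"
      using quot[of z k] unfolding \<psi>_def by (subst exp_ln) (auto simp: algebra_simps intro!: add_pos_nonneg)
    also have "a z / (a z + 1 / real (Suc k)) \<le> 1" using pos[of z k] by simp
    hence "b z * (a z / (a z + 1 / real (Suc k))) \<le> b z * 1" using b(2)[of z] by (rule mult_left_mono)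
    finally show "a z * exp (\<psi> k z) \<le> a z + b z" by simp
  qed
  hence int_le: "integral {0..2*pi} (\<lambda>\<theta>. \<psi> k (z \<theta>)) \<le> 2 * pi * M" for k
    by (simp add: circ_mean_def z_def field_simps)
  have c: "continuous_on UNIV (\<lambda>\<theta>. \<psi> k (z \<theta>))" for k
    unfolding z_def by (rule continuous_on_compose2[OF c\<psi>]) (auto intro!: continuous_intros)
  hence int: "(\<lambda>\<theta>. \<psi> k (z \<theta>)) integrable_on {0..2*pi}" for k
    by (intro integrable_continuous_interval) (auto intro: continuous_on_subset)
  define F where "F = (\<lambda>k \<theta>. if \<theta> \<in> N then 0 else \<psi> k (z \<theta>))"
  define G where "G = (\<lambda>\<theta>. if \<theta> \<in> N then 0 else ln (1 + b (z \<theta>) / a (z \<theta>)))"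
  have F_int: "F k integrable_on {0..2*pi}" for k
    by (rule integrable_spike[OF int N]) (auto simp: F_def)
  have F_le: "integral {0..2*pi} (F k) \<le> 2 * pi * M" for k
    using int_le[of k] integral_spike[OF N, of "{0..2*pi}" "F k" "\<lambda>\<theta>. \<psi> k (z \<theta>)"] by (simp add: F_def)
  have F0: "F k \<theta> \<ge> 0" for k \<theta> using quot by (simp add: F_def \<psi>_def)
  have "G integrable_on {0..2*pi} \<and> (\<lambda>k. integral {0..2*pi} (F k)) \<longlonglongrightarrow> integral {0..2*pi} G"
  proof (rule monotone_convergence_increasing[OF F_int])
    fix k \<theta>
    have "b (z \<theta>) / (a (z \<theta>) + 1 / real (Suc k)) \<le> b (z \<theta>) / (a (z \<theta>) + 1 / real (Suc (Suc k)))"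
      using pos[of "z \<theta>" k] pos[of "z \<theta>" "Suc k"] b(2)
      by (intro divide_left_mono add_mono mult_pos_pos) (auto simp: field_simps)
    thus "F k \<theta> \<le> F (Suc k) \<theta>" using quot[of "z \<theta>" k] by (auto simp: F_def \<psi>_def)
  next
    fix \<theta> assume "\<theta> \<in> {0..2*pi}"
    show "(\<lambda>k. F k \<theta>) \<longlonglongrightarrow> G \<theta>"
    proof (cases "\<theta> \<in> N")
      case False
      hence "a (z \<theta>) \<noteq> 0" using \<open>\<theta> \<in> {0..2*pi}\<close> by (auto simp: N_def)
      moreover have "(\<lambda>k. 1 / real (Suc k)) \<longlonglongrightarrow> 0" by real_asymp
      ultimately have "(\<lambda>k. b (z \<theta>) / (a (z \<theta>) + 1 / real (Suc k))) \<longlonglongrightarrow> b (z \<theta>) / (a (z \<theta>) + 0)"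
        by (intro tendsto_divide tendsto_add tendsto_const) auto
      hence "(\<lambda>k. 1 + b (z \<theta>) / (a (z \<theta>) + 1 / real (Suc k))) \<longlonglongrightarrow> 1 + b (z \<theta>) / a (z \<theta>)"
        by (intro tendsto_add tendsto_const) auto
      moreover have "1 + b (z \<theta>) / a (z \<theta>) > 0" using a(2) b(2) by (intro add_pos_nonneg) auto
      ultimately have "(\<lambda>k. \<psi> k (z \<theta>)) \<longlonglongrightarrow> ln (1 + b (z \<theta>) / a (z \<theta>))"
        unfolding \<psi>_def by (intro tendsto_ln) auto
      thus ?thesis using False by (simp add: F_def G_def)
    qed (simp add: F_def G_def)
  next
    have "norm (integral {0..2*pi} (F k)) \<le> \<bar>2 * pi * M\<bar>" for k
    proof -
      have "integral {0..2*pi} (F k) \<ge> 0" by (intro integral_nonneg F_int F0)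
      thus ?thesis using F_le[of k] by simp
    qed
    thus "bounded (range (\<lambda>k. integral {0..2*pi} (F k)))" unfolding bounded_iff by blast
  qed
  hence G: "G integrable_on {0..2*pi}" "integral {0..2*pi} G \<le> 2 * pi * M"
    using F_le by (auto intro: LIMSEQ_le_const2)
  define L where "L = (\<lambda>\<theta>. if \<theta> \<in> N then 0 else log_plus (norm (f (z \<theta>))))"
  have "integral {0..2*pi} (\<lambda>\<theta>. log_plus (norm (f (z \<theta>)))) = integral {0..2*pi} L"
    by (rule integral_spike[OF N]) (auto simp: L_def)
  also have "\<dots> \<le> integral {0..2*pi} G"
  proof (cases "L integrable_on {0..2*pi}")
    case True
    thus ?thesis
    proof (rule integral_le[OF _ G(1)])
      fix \<theta> assume \<theta>: "\<theta> \<in> {0..2*pi}"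
      have "max 1 (b (z \<theta>) / a (z \<theta>)) \<le> 1 + b (z \<theta>) / a (z \<theta>)" using a(2) b(2) by auto
      thus "L \<theta> \<le> G \<theta>" using \<theta> by (auto simp: L_def G_def N_def log_plus_def intro!: ln_mono)
    qed
  next
    case False
    have "integral {0..2*pi} G \<ge> 0"
      using a(2) b(2) by (intro integral_nonneg G) (auto simp: G_def)
    thus ?thesis using False by (simp add: not_integrable_integral)
  qed
  also note G(2)
  finally show ?thesis by (simp add: proximity_def z_def field_simps)
qed

text \<open>|f| is the quotient of |e| by |d2|. The averaged estimate for \<open>d2\<close> handles
  its zeros, that is, possible poles of f on or near the circle.\<close>

lemma proximity_upper:
  assumes "0 < \<kappa>" "order_growth \<kappa> d1" "order_growth \<kappa> d2" "d2 w2 \<noteq> 0" "real (degree H) \<le> \<kappa>"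
    and f: "\<forall>\<^sub>\<approx>z\<in>UNIV. f z = d1 z / d2 z * exp (poly H z)"
  obtains C where "\<And>r. r \<ge> 1 \<Longrightarrow> proximity r f \<le> C * r powr \<kappa>"
proof -
  interpret growth_scale \<kappa> "\<lambda>_. 0" using assms(1) by (rule growth_scale_0)
  define e where "e = (\<lambda>z. d1 z * exp (poly H z))"
  have "order_growth \<kappa> e" unfolding e_def using assms by (intro exp_growth_mult exp_growth_exp_poly) auto
  then obtain A where A: "A \<ge> 0" "\<And>r z. r \<ge> 1 \<Longrightarrow> norm z \<le> r \<Longrightarrow> norm (e z) \<le> exp (A * r powr \<kappa>)"
    using order_growthE[OF assms(1)] by blast
  obtain B where B: "B \<ge> 0" "\<And>r z. r \<ge> 1 \<Longrightarrow> norm z \<le> r \<Longrightarrow> norm (d2 z) \<le> exp (B * r powr \<kappa>)"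
    using order_growthE[OF assms(1,3)] by blast
  have hol: "d2 holomorphic_on UNIV" "e holomorphic_on UNIV"
    using assms(3) \<open>order_growth \<kappa> e\<close> by (auto intro: exp_growth_holomorphic)
  obtain C where C: "C \<ge> 0" "\<And>r \<psi> B. r \<ge> 1 \<Longrightarrow> continuous_on UNIV \<psi> \<Longrightarrow>
     (\<And>z. norm z \<le> r \<Longrightarrow> norm (d2 z) * exp (\<psi> z) \<le> exp B) \<Longrightarrow> circ_mean r \<psi> \<le> B + C"
    using circ_mean_le[OF hol(1) assms(4)] by metis
  have nz: "\<forall>\<^sub>\<approx>z\<in>UNIV. d2 z \<noteq> 0" using entire_nonzero_cosparse[OF hol(1) assms(4)] .
  have "proximity r f \<le> (A + B + 1 + C) * r powr \<kappa>" if r: "r \<ge> 1" for r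
  proof (rule log_plus_mean_le[where a = "\<lambda>z. norm (d2 z)" and b = "\<lambda>z. norm (e z)"])
    show "\<forall>\<^sub>\<approx>z\<in>UNIV. norm (f z) = norm (e z) / norm (d2 z)"
      using f by eventually_elim (simp add: e_def norm_mult norm_divide)
    show "\<forall>\<^sub>\<approx>z\<in>UNIV. norm (d2 z) \<noteq> 0" using nz by simp
    fix \<psi> :: "complex \<Rightarrow> real" assume \<psi>: "continuous_on UNIV \<psi>"
      "\<And>z. norm z \<le> r \<Longrightarrow> norm (d2 z) * exp (\<psi> z) \<le> norm (d2 z) + norm (e z)"
    have r1: "r powr \<kappa> \<ge> 1" using r assms(1) by (simp add: ge_one_powr_ge_zero)
    have "circ_mean r \<psi> \<le> ((A + B) * r powr \<kappa> + 1) + C"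
    proof (rule C(2)[OF r \<psi>(1)])
      fix z :: complex assume z: "norm z \<le> r"
      have "norm (d2 z) * exp (\<psi> z) \<le> exp (B * r powr \<kappa>) + exp (A * r powr \<kappa>)"
        using \<psi>(2)[OF z] A(2)[OF r z] B(2)[OF r z] by linarith
      also have "\<dots> \<le> 2 * exp ((A + B) * r powr \<kappa>)"
        using A(1) B(1) add_mono[of "exp (B * r powr \<kappa>)" "exp ((A + B) * r powr \<kappa>)" "exp (A * r powr \<kappa>)" "exp ((A + B) * r powr \<kappa>)"]
        by (simp add: mult_right_mono)
      also have "\<dots> \<le> exp 1 * exp ((A + B) * r powr \<kappa>)"
        using exp_ge_add_one_self[of 1] by (intro mult_right_mono) (auto simp del: exp_ge_add_one_self)
      finally show "norm (d2 z) * exp (\<psi> z) \<le> exp ((A + B) * r powr \<kappa> + 1)"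
        by (simp add: exp_add[symmetric] add.commute)
    qed
    also have "\<dots> \<le> (A + B) * r powr \<kappa> + 1 * r powr \<kappa> + C * r powr \<kappa>"
      using mult_left_mono[OF r1 C(1)] r1 by simp
    finally show "circ_mean r \<psi> \<le> (A + B + 1 + C) * r powr \<kappa>" by (simp add: algebra_simps)
  qed (use r in \<open>auto intro!: continuous_on_norm holomorphic_on_imp_continuous_on hol\<close>)
  thus ?thesis by (rule that)
qed

lemma higher_deriv_poly: "(deriv ^^ k) (poly p) = poly ((pderiv ^^ k) (p :: complex poly))"
proof (induction k)
  case (Suc k)
  have "deriv (poly q) = poly (pderiv q)" for q :: "complex poly"
    by (intro ext DERIV_imp_deriv poly_DERIV)
  thus ?case using Suc by simp
qed auto

text \<open>The positive mean of Re H is at least a multiple of r^(degree H), by the bound on its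
  leading Taylor coefficient. It exceeds the proximity function by only O(r^\<tau>), because
  Jensen's inequality for \<open>d1\<close> limits how much its small values can reduce |f|.\<close>

lemma proximity_lower:
  assumes "0 < \<tau>" "order_growth \<tau> d1" "order_growth \<tau> d2" "d1 w1 \<noteq> 0" "d2 w2 \<noteq> 0" "\<tau> < real (degree H)"
    and f: "\<forall>\<^sub>\<approx>z\<in>UNIV. f z = d1 z / d2 z * exp (poly H z)"
  obtains c where "c > 0" "\<exists>\<^sub>F r in at_top. c * r powr real (degree H) \<le> proximity r f"
proof -
  interpret growth_scale \<tau> "\<lambda>_. 0" using assms(1) by (rule growth_scale_0)
  define q where "q = degree H"
  define a where "a = (deriv ^^ q) (poly H) 0 / fact q"
  have q: "q > 0" using assms by (auto simp: q_def intro: Nat.gr0I)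
  hence "H \<noteq> 0" by (auto simp: q_def)
  hence a: "a \<noteq> 0"
    using pochhammer_pos[of "1::real" q] pochhammer_of_real[of 1 q, where 'a = complex]
    by (auto simp: a_def higher_deriv_poly poly_0_coeff_0 coeff_higher_pderiv q_def)
  obtain A where A: "A \<ge> 0" "\<And>r z. r \<ge> 1 \<Longrightarrow> norm z \<le> r \<Longrightarrow> norm (d1 z) \<le> exp (A * r powr \<tau>)"
    using order_growthE[OF assms(1,2)] by blast
  obtain B where B: "B \<ge> 0" "\<And>r z. r \<ge> 1 \<Longrightarrow> norm z \<le> r \<Longrightarrow> norm (d2 z) \<le> exp (B * r powr \<tau>)"
    using order_growthE[OF assms(1,3)] by blast
  have hol: "d1 holomorphic_on UNIV" "d2 holomorphic_on UNIV"
    using assms by (auto intro: exp_growth_holomorphic)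
  obtain C where C: "\<And>r \<psi> B. r \<ge> 1/2 \<Longrightarrow> continuous_on (sphere 0 r) \<psi> \<Longrightarrow>
     (\<And>z. z \<in> sphere 0 r \<Longrightarrow> d1 z \<noteq> 0 \<and> norm (d1 z) * exp (\<psi> z) \<le> exp B) \<Longrightarrow> circ_mean r \<psi> \<le> B + C"
    using circ_mean_le_good_radius[OF hol(1) assms(4)] by metis
  have lower: "norm a / 4 * r powr q - (A + B) * r powr \<tau> - C - norm (poly H 0) \<le> proximity r f"
    if r: "r \<ge> 1" and good: "\<And>z. z \<in> sphere 0 r \<Longrightarrow> d1 z * d2 z \<noteq> 0" for r
  proof -
    define F where "F = (\<lambda>z. d1 z / d2 z * exp (poly H z))"
    \<comment> \<open>The defect between the positive part of Re H and log+ |F|. Multiplying exp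
      \<psi> by |d1| leaves at most the larger of |d1| and |d2|: the first if Re H \<le> 0, the
      second otherwise.\<close>
    define \<psi> where "\<psi> = (\<lambda>z. max 0 (Re (poly H z)) - log_plus (norm (F z)))"
    have cont_d: "continuous_on (sphere 0 r) d1" "continuous_on (sphere 0 r) d2"
      using hol by (auto intro: holomorphic_on_imp_continuous_on holomorphic_on_subset)
    have cF: "continuous_on (sphere 0 r) F" unfolding F_def using good
      by (intro continuous_intros cont_d) auto
    have cL: "continuous_on (sphere 0 r) (\<lambda>z. log_plus (norm (F z)))"
    proof -
      have "max 1 (norm (F z)) \<noteq> 0" for z by linarith
      thus ?thesis unfolding log_plus_def by (intro continuous_intros cF) auto
    qed
    have cH: "continuous_on (sphere 0 r) (\<lambda>z. max 0 (Re (poly H z)))" by (intro continuous_intros)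
    have "circ_mean r \<psi> \<le> (A + B) * r powr \<tau> + C"
    proof (rule C)
      fix z :: complex assume z: "z \<in> sphere 0 r"
      have nz: "d1 z \<noteq> 0" "d2 z \<noteq> 0" using good[OF z] by auto
      have "exp (\<psi> z) = exp (max 0 (Re (poly H z))) / max 1 (norm (F z))"
        by (simp add: \<psi>_def exp_diff log_plus_def)
      hence "norm (d1 z) * exp (\<psi> z) = norm (d1 z) * exp (max 0 (Re (poly H z))) / max 1 (norm (F z))"
        by simp
      also have "\<dots> \<le> max (norm (d1 z)) (norm (d2 z))"
      proof (cases "Re (poly H z) \<le> 0")
        case True
        have "norm (d1 z) * 1 \<le> norm (d1 z) * max 1 (norm (F z))" by (intro mult_left_mono) auto
        hence "norm (d1 z) * exp (max 0 (Re (poly H z))) / max 1 (norm (F z)) \<le> norm (d1 z)"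
          using True by (subst pos_divide_le_eq) auto
        thus ?thesis by simp
      next
        case False
        have "norm (d1 z) * exp (max 0 (Re (poly H z))) = norm (F z) * norm (d2 z)"
          using False nz by (simp add: F_def norm_mult norm_divide)
        also have "\<dots> \<le> max 1 (norm (F z)) * norm (d2 z)" by (intro mult_right_mono) auto
        finally have "norm (d1 z) * exp (max 0 (Re (poly H z))) / max 1 (norm (F z)) \<le> norm (d2 z)"
          by (subst pos_divide_le_eq) (auto simp: mult.commute)
        thus ?thesis by simp
      qed
      also have "\<dots> \<le> max (exp (A * r powr \<tau>)) (exp (B * r powr \<tau>))"
        using A(2)[OF r, of z] B(2)[OF r, of z] z by (intro max.mono) auto
      also have "\<dots> \<le> exp ((A + B) * r powr \<tau>)" using A(1) B(1) by (auto intro!: mult_right_mono)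
      finally show "d1 z \<noteq> 0 \<and> norm (d1 z) * exp (\<psi> z) \<le> exp ((A + B) * r powr \<tau>)" using nz by simp
    qed (use r cL cH in \<open>auto simp: \<psi>_def intro!: continuous_on_diff\<close>)
    moreover have "circ_mean r \<psi> = pos_mean (poly H) r - circ_mean r (\<lambda>z. log_plus (norm (F z)))"
      unfolding \<psi>_def pos_mean_def using r by (intro circ_mean_diff cH cL) auto
    moreover have "circ_mean r (\<lambda>z. log_plus (norm (F z))) = proximity r f"
      unfolding proximity_eq_circ_mean
      by (rule circ_mean_cosparse_cong) (use r f in \<open>auto elim!: eventually_mono simp: F_def\<close>)
    moreover have "norm a * r ^ q \<le> 4 * pos_mean (poly H) r - 2 * Re (poly H 0)"
      unfolding a_def by (rule taylor_coeff_le_pos_mean) (use r q in \<open>auto intro: holomorphic_intros\<close>)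
    hence "norm a / 4 * r powr q - norm (poly H 0) \<le> pos_mean (poly H) r"
      using abs_Re_le_cmod[of "poly H 0"] r norm_ge_zero[of "poly H 0"] unfolding powr_realpow[OF less_le_trans[OF zero_less_one r]] by linarith
    ultimately show ?thesis by linarith
  qed
  \<comment> \<open>Half of the coefficient |a| / 4 is given up to absorb all terms of lower
    order.\<close>
  have ev: "eventually (\<lambda>r. norm a / 8 * r powr q \<le> norm a / 4 * r powr q - (A + B) * r powr \<tau> - C - norm (poly H 0)) at_top"
  proof -
    have "((\<lambda>r. (A + B) * r powr (\<tau> - q) + (C + norm (poly H 0)) * r powr (- real q)) \<longlongrightarrow> (A + B) * 0 + (C + norm (poly H 0)) * 0) at_top"
      using assms(6) q by (intro tendsto_intros) (real_asymp simp: q_def, real_asymp)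
    hence "eventually (\<lambda>r. (A + B) * r powr (\<tau> - q) + (C + norm (poly H 0)) * r powr (- real q) < norm a / 8) at_top"
      using a by (intro order_tendstoD) auto
    thus ?thesis using eventually_gt_at_top[of 0]
    proof eventually_elim
      case (elim r)
      have "((A + B) * r powr (\<tau> - q) + (C + norm (poly H 0)) * r powr (- real q)) * r powr q \<le> norm a / 8 * r powr q"
        using elim by (intro mult_right_mono) auto
      also have "((A + B) * r powr (\<tau> - q) + (C + norm (poly H 0)) * r powr (- real q)) * r powr q = (A + B) * r powr \<tau> + (C + norm (poly H 0))"
        using elim by (simp add: distrib_right mult.assoc powr_add[symmetric])
      finally show ?case by linarith
    qed
  qed
  \<comment> \<open>Radii without zeros on the circle exist beyond every bound. This is enough,
    since the order is a limes superior.\<close>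
  have "\<exists>\<^sub>F r in at_top. r \<ge> 1 \<and> (\<forall>z\<in>sphere 0 r. d1 z * d2 z \<noteq> 0)"
    unfolding frequently_def
  proof
    assume "\<forall>\<^sub>F r in at_top. \<not> (r \<ge> 1 \<and> (\<forall>z\<in>sphere 0 r. d1 z * d2 z \<noteq> 0))"
    then obtain R where R: "\<And>r. r \<ge> R \<Longrightarrow> \<not> (r \<ge> 1 \<and> (\<forall>z\<in>sphere 0 r. d1 z * d2 z \<noteq> 0))"
      by (auto simp: eventually_at_top_linorder)
    have "eventually (\<lambda>z. d1 z \<noteq> 0 \<and> d2 z \<noteq> 0) (at 0)"
      using entire_eventually_nonzero[OF hol(1) assms(4), of 0] entire_eventually_nonzero[OF hol(2) assms(5), of 0]
      by eventually_elim auto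
    then obtain w where "d1 w * d2 w \<noteq> 0" using eventually_happens[of _ "at (0::complex)"] by auto
    moreover have "(\<lambda>z. d1 z * d2 z) holomorphic_on UNIV" by (intro holomorphic_intros hol)
    ultimately obtain r where "max 1 R < r" "\<And>z. z \<in> sphere 0 r \<Longrightarrow> d1 z * d2 z \<noteq> 0"
      using good_radius_exists[of "\<lambda>z. d1 z * d2 z" w "max 1 R" "max 1 R + 1"] by (metis less_add_one max.coboundedI1 zero_le_one)
    thus False using R[of r] by auto
  qed
  hence "\<exists>\<^sub>F r in at_top. norm a / 8 * r powr q \<le> proximity r f"
  proof (rule frequently_rev_mp)
    show "\<forall>\<^sub>F r in at_top. r \<ge> 1 \<and> (\<forall>z\<in>sphere 0 r. d1 z * d2 z \<noteq> 0) \<longrightarrow> norm a / 8 * r powr q \<le> proximity r f"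
      using ev
    proof eventually_elim
      case (elim r)
      thus ?case using lower[of r] by auto
    qed
  qed
  thus ?thesis using a that[of "norm a / 8"] by (simp add: q_def)
qed

text \<open>Every pole with 0 < |z| \<le> t has (t / |z|)^\<tau> \<ge> 1, so the count is at most
  t^\<tau> times the convergent sum. Dividing by t and integrating gives the factor 1 / \<tau>; the
  pole at 0 only adds a multiple of ln r.\<close>

lemma integrated_pole_count_bounds:
  assumes f: "f meromorphic_on UNIV" and "0 < \<tau>"
    and summ: "(\<lambda>z. real (nat (- zorder f z)) * norm z powr (-\<tau>)) summable_on {z. z \<noteq> 0 \<and> is_pole f z}"
  obtains C where "\<And>r. r \<ge> 1 \<Longrightarrow> 0 \<le> integrated_pole_count r f \<and> integrated_pole_count r f \<le> C * r powr \<tau>"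
proof -
  define S where "S = infsum (\<lambda>z. real (nat (- zorder f z)) * norm z powr (-\<tau>)) {z. z \<noteq> 0 \<and> is_pole f z}"
  have fin: "finite {z. z \<in> cball 0 t \<and> is_pole f z}" for t
  proof -
    have "{z. is_pole f z} sparse_in UNIV"
      using meromorphic_on_imp_not_pole_cosparse[OF f] by (simp add: eventually_cosparse)
    hence "{z. is_pole f z} sparse_in cball 0 t" by (rule sparse_in_subset) auto
    hence "finite (cball 0 t \<inter> {z. is_pole f z})" by (rule sparse_in_compact_finite) auto
    thus ?thesis by (rule finite_subset[rotated]) auto
  qed
  have pc: "0 \<le> real (pole_count t f) - real (pole_count 0 f) \<and> real (pole_count t f) - real (pole_count 0 f) \<le> S * t powr \<tau>"
    if t: "t > 0" for t
  proof -
    define P where "P = {z. z \<in> cball 0 t \<and> is_pole f z \<and> z \<noteq> 0}"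
    have "pole_count t f = (\<Sum>z\<in>P \<union> {z. z \<in> cball 0 0 \<and> is_pole f z}. nat (- zorder f z))"
      unfolding pole_count_def by (intro sum.cong) (use t in \<open>auto simp: P_def\<close>)
    also have "\<dots> = (\<Sum>z\<in>P. nat (- zorder f z)) + pole_count 0 f"
      unfolding pole_count_def
      by (rule sum.union_disjoint) (auto simp: P_def intro: finite_subset[OF _ fin[of t]] finite_subset[OF _ fin[of 0]])
    finally have eq: "real (pole_count t f) - real (pole_count 0 f) = (\<Sum>z\<in>P. real (nat (- zorder f z)))" by simp
    also have "\<dots> \<le> (\<Sum>z\<in>P. real (nat (- zorder f z)) * norm z powr (-\<tau>) * t powr \<tau>)"
    proof (intro sum_mono)
      fix z assume z: "z \<in> P"
      have "norm z powr (-\<tau>) * t powr \<tau> \<ge> norm z powr (-\<tau>) * norm z powr \<tau>"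
        using z \<open>0 < \<tau>\<close> by (intro mult_left_mono powr_mono2) (auto simp: P_def)
      also have "norm z powr (-\<tau>) * norm z powr \<tau> = 1" using z by (simp add: powr_add[symmetric] P_def)
      finally show "real (nat (- zorder f z)) \<le> real (nat (- zorder f z)) * norm z powr (-\<tau>) * t powr \<tau>"
        unfolding mult.assoc by (simp add: mult_le_cancel_left1)
    qed
    also have "\<dots> \<le> S * t powr \<tau>"
      unfolding sum_distrib_right[symmetric] S_def
      by (intro mult_right_mono finite_sum_le_infsum[OF summ]) 
         (auto simp: P_def intro: finite_subset[OF _ fin[of t]])
    finally show ?thesis unfolding eq by (auto intro: sum_nonneg)
  qed
  have S0: "S \<ge> 0" unfolding S_def by (intro infsum_nonneg) auto
  have "0 \<le> integrated_pole_count r f \<and> integrated_pole_count r f \<le> (S / \<tau> + real (pole_count 0 f) / \<tau>) * r powr \<tau>"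
    if r: "r \<ge> 1" for r
  proof -
    define g where "g = (\<lambda>t. (real (pole_count t f) - real (pole_count 0 f)) / t)"
    have g: "0 \<le> g t" "g t \<le> S * t powr (\<tau> - 1)" if "t \<in> {0..r}" for t
    proof -
      show "0 \<le> g t" using that pc[of t] by (cases "t = 0") (auto simp: g_def)
      show "g t \<le> S * t powr (\<tau> - 1)"
      proof (cases "t = 0")
        case False
        hence "t > 0" using that by simp
        hence "g t \<le> (S * t powr \<tau>) / t" unfolding g_def using pc[of t] by (intro divide_right_mono) auto
        also have "\<dots> = S * t powr (\<tau> - 1)" using \<open>t > 0\<close> by (simp add: powr_diff)
        finally show ?thesis .
      qed (simp add: g_def)
    qed
    have hi: "((\<lambda>t. S * t powr (\<tau> - 1)) has_integral S * (r powr (\<tau> - 1 + 1) / (\<tau> - 1 + 1))) {0..r}"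
      by (intro has_integral_mult_right has_integral_powr_from_0) (use r \<open>0 < \<tau>\<close> in auto)
    \<comment> \<open>Both bounds on the integral also hold if it takes its default value 0. At t =
      0 the integrand is 0, being a division by 0.\<close>
    have 1: "0 \<le> integral {0..r} g"
      by (rule integral_nonneg_or_not) (use g in auto)
    have 2: "integral {0..r} g \<le> S / \<tau> * r powr \<tau>"
    proof (cases "g integrable_on {0..r}")
      case True
      have "integral {0..r} g \<le> integral {0..r} (\<lambda>t. S * t powr (\<tau> - 1))"
        by (rule integral_le[OF True]) (use hi g in auto)
      thus ?thesis using integral_unique[OF hi] by simp
    next
      case False
      thus ?thesis using S0 \<open>0 < \<tau>\<close> by (simp add: not_integrable_integral)
    qed
    have "ln r \<le> r powr \<tau> / \<tau>" using r \<open>0 < \<tau>\<close> by (intro ln_powr_bound) auto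
    hence 3: "real (pole_count 0 f) * ln r \<le> real (pole_count 0 f) * (r powr \<tau> / \<tau>)" by (intro mult_left_mono) auto
    have 4: "0 \<le> real (pole_count 0 f) * ln r" using r by simp
    have "integrated_pole_count r f = integral {0..r} g + real (pole_count 0 f) * ln r"
      by (simp add: integrated_pole_count_def g_def)
    moreover have "(S / \<tau> + real (pole_count 0 f) / \<tau>) * r powr \<tau> = S / \<tau> * r powr \<tau> + real (pole_count 0 f) * (r powr \<tau> / \<tau>)"
      by (simp add: distrib_right)
    ultimately show ?thesis using 1 2 3 4 by linarith
  qed
  thus ?thesis by (rule that)
qed

lemma growth_order_le:
  assumes "\<kappa> > 0" "\<And>r. r \<ge> 1 \<Longrightarrow> nevanlinna_char r f \<le> C * r powr \<kappa>"
  shows "growth_order f \<le> ereal \<kappa>"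
proof -
  define D where "D = max 1 C"
  have "eventually (\<lambda>r. ereal (log_plus (nevanlinna_char r f) / ln r) \<le> ereal (ln D / ln r + \<kappa>)) at_top"
    using eventually_gt_at_top[of 1]
  proof eventually_elim
    case (elim r)
    have r1: "r powr \<kappa> \<ge> 1" using elim assms(1) by (simp add: ge_one_powr_ge_zero)
    have "1 * 1 \<le> D * r powr \<kappa>" using r1 by (intro mult_mono) (auto simp: D_def)
    moreover have "C * r powr \<kappa> \<le> D * r powr \<kappa>" by (intro mult_right_mono) (auto simp: D_def)
    ultimately have "max 1 (nevanlinna_char r f) \<le> D * r powr \<kappa>"
      using assms(2)[of r] elim by linarith
    hence "log_plus (nevanlinna_char r f) \<le> ln (D * r powr \<kappa>)"
      unfolding log_plus_def by (intro ln_mono) auto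
    also have "\<dots> = ln D + \<kappa> * ln r" using elim by (subst ln_mult_pos) (auto simp: D_def ln_powr)
    finally have "log_plus (nevanlinna_char r f) / ln r \<le> (ln D + \<kappa> * ln r) / ln r"
      using elim by (intro divide_right_mono) auto
    also have "\<dots> = ln D / ln r + \<kappa>" using elim by (simp add: add_divide_distrib)
    finally show ?case by simp
  qed
  hence "growth_order f \<le> Limsup at_top (\<lambda>r. ereal (ln D / ln r + \<kappa>))"
    unfolding growth_order_def by (rule Limsup_mono)
  also have "((\<lambda>r. ln D / ln r + \<kappa>) \<longlongrightarrow> \<kappa>) at_top" by real_asymp
  hence "Limsup at_top (\<lambda>r. ereal (ln D / ln r + \<kappa>)) = ereal \<kappa>"
    by (intro lim_imp_Limsup) auto
  finally show ?thesis .
qed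

lemma growth_order_ge:
  assumes "c > 0" "\<exists>\<^sub>F r in at_top. c * r powr q \<le> nevanlinna_char r f"
  shows "ereal q \<le> growth_order f"
proof (rule ccontr)
  assume "\<not> ?thesis"
  hence "growth_order f < ereal q" by simp
  then obtain y where y: "growth_order f < ereal y" "y < q" using ereal_dense2 less_ereal.simps(1) by metis
  have "eventually (\<lambda>r. ereal (log_plus (nevanlinna_char r f) / ln r) < ereal y) at_top"
    using y(1) unfolding growth_order_def by (rule Limsup_lessD)
  moreover have "eventually (\<lambda>r. ln c / ln r + q > y) at_top"
  proof -
    have "((\<lambda>r. ln c / ln r + q) \<longlongrightarrow> q) at_top" by real_asymp
    thus ?thesis using y(2) by (rule order_tendstoD(1))
  qed
  ultimately have "eventually (\<lambda>r. \<not> c * r powr q \<le> nevanlinna_char r f) at_top"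
    using eventually_gt_at_top[of 1]
  proof eventually_elim
    case (elim r)
    show ?case
    proof
      assume "c * r powr q \<le> nevanlinna_char r f"
      hence "ln (c * r powr q) \<le> log_plus (nevanlinna_char r f)"
        unfolding log_plus_def using assms(1) elim by (intro ln_mono) auto
      also have "ln (c * r powr q) = ln c + q * ln r" using elim assms(1) by (subst ln_mult_pos) (auto simp: ln_powr)
      finally have "(ln c + q * ln r) / ln r \<le> log_plus (nevanlinna_char r f) / ln r"
        using elim(3) by (intro divide_right_mono) auto
      also have "(ln c + q * ln r) / ln r = ln c / ln r + q" using elim(3) by (simp add: add_divide_distrib)
      finally have "ln c / ln r + q \<le> log_plus (nevanlinna_char r f) / ln r" .
      thus False using elim by simp
    qed
  qed
  thus False using assms(2) by (simp add: frequently_def)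
qed

lemma growth_order_upper:
  assumes "0 < \<kappa>" "order_growth \<kappa> d1" "order_growth \<kappa> d2" "d2 w2 \<noteq> 0" "real (degree H) \<le> \<kappa>"
    and f: "\<forall>\<^sub>\<approx>z\<in>UNIV. f z = d1 z / d2 z * exp (poly H z)" "f meromorphic_on UNIV"
    and \<tau>: "0 < \<tau>" "\<tau> \<le> \<kappa>"
    and summ: "(\<lambda>z. real (nat (- zorder f z)) * norm z powr (-\<tau>)) summable_on {z. z \<noteq> 0 \<and> is_pole f z}"
  shows "growth_order f \<le> ereal \<kappa>"
proof -
  obtain A where A: "\<And>r. r \<ge> 1 \<Longrightarrow> proximity r f \<le> A * r powr \<kappa>"
    using proximity_upper[OF assms(1-5) f(1)] by blast
  obtain B where B: "\<And>r. r \<ge> 1 \<Longrightarrow> 0 \<le> integrated_pole_count r f \<and> integrated_pole_count r f \<le> B * r powr \<tau>"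
    using integrated_pole_count_bounds[OF f(2) \<tau>(1) summ] by blast
  show ?thesis
  proof (rule growth_order_le[OF assms(1)])
    fix r :: real assume r: "r \<ge> 1"
    have "B * r powr \<tau> \<le> \<bar>B\<bar> * r powr \<tau>" by (intro mult_right_mono) auto
    also have "\<dots> \<le> \<bar>B\<bar> * r powr \<kappa>" using r \<tau> by (intro mult_left_mono powr_mono) auto
    finally show "nevanlinna_char r f \<le> (A + \<bar>B\<bar>) * r powr \<kappa>"
      using A[OF r] B[OF r] by (simp add: nevanlinna_char_def algebra_simps)
  qed
qed

lemma growth_order_lower:
  assumes "0 < \<tau>" "order_growth \<tau> d1" "order_growth \<tau> d2" "d1 w1 \<noteq> 0" "d2 w2 \<noteq> 0" "\<tau> < real (degree H)"
    and f: "\<forall>\<^sub>\<approx>z\<in>UNIV. f z = d1 z / d2 z * exp (poly H z)" "f meromorphic_on UNIV"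
    and summ: "(\<lambda>z. real (nat (- zorder f z)) * norm z powr (-\<tau>)) summable_on {z. z \<noteq> 0 \<and> is_pole f z}"
  shows "ereal (real (degree H)) \<le> growth_order f"
proof -
  obtain c where c: "c > 0" "\<exists>\<^sub>F r in at_top. c * r powr real (degree H) \<le> proximity r f"
    using proximity_lower[OF assms(1-6) f(1)] by blast
  obtain B where B: "\<And>r. r \<ge> 1 \<Longrightarrow> 0 \<le> integrated_pole_count r f \<and> integrated_pole_count r f \<le> B * r powr \<tau>"
    using integrated_pole_count_bounds[OF f(2) assms(1) summ] by blast
  have "\<exists>\<^sub>F r in at_top. c * r powr real (degree H) \<le> nevanlinna_char r f"
  proof (rule frequently_rev_mp[OF c(2)])
    show "\<forall>\<^sub>F r in at_top. c * r powr real (degree H) \<le> proximity r f \<longrightarrow> c * r powr real (degree H) \<le> nevanlinna_char r f"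
      using eventually_ge_at_top[of 1]
    proof eventually_elim
      case (elim r)
      thus ?case using B[of r] by (simp add: nevanlinna_char_def)
    qed
  qed
  thus ?thesis by (rule growth_order_ge[OF c(1)])
qed

section \<open>Expansion of differential polynomials\<close>

lemma cosparse_ex: "(\<forall>\<^sub>\<approx>z\<in>(UNIV::complex set). P z) \<Longrightarrow> \<exists>z. P z"
  using eventually_happens'[of "cosparse (UNIV::complex set)" P] by simp

lemma poly_nonzero_cosparse:
  assumes "p \<noteq> 0"
  shows "\<forall>\<^sub>\<approx>z\<in>UNIV. poly (p :: complex poly) z \<noteq> 0"
proof -
  obtain w where "poly p w \<noteq> 0" using assms poly_all_0_iff_0 by blast
  thus ?thesis by (intro entire_nonzero_cosparse) (auto intro: holomorphic_intros)
qed

lemma entire_zero_of_cosparse: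
  assumes "F holomorphic_on UNIV" "\<forall>\<^sub>\<approx>z\<in>UNIV. F z = 0"
  shows "F z = 0"
proof (rule ccontr)
  assume "F z \<noteq> 0"
  hence "\<forall>\<^sub>\<approx>z\<in>UNIV. F z \<noteq> 0" by (rule entire_nonzero_cosparse[OF assms(1)])
  with assms(2) have "\<forall>\<^sub>\<approx>z\<in>(UNIV::complex set). False" by eventually_elim simp
  thus False using cosparse_ex by blast
qed

lemma ratfunE:
  fixes R :: ratfun
  obtains a b where "b \<noteq> 0" "R = Fract a b" "\<And>z. ratfun_eval R z = poly a z / poly b z"
  using that[of "snd (quot_of_fract R)" "fst (quot_of_fract R)"] by (simp add: ratfun_eval_def)

text \<open>The identity can fail at poles of p or q, where both are evaluated as 0 while the pole
  may cancel in the sum.\<close>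

lemma ratfun_eval_add_mult_const:
  "\<forall>\<^sub>\<approx>z\<in>UNIV. ratfun_eval (ratfun_const c * p + ratfun_const d * q) z = c * ratfun_eval p z + d * ratfun_eval q z"
proof -
  obtain a b where p: "b \<noteq> 0" "p = Fract a b" "\<And>z. ratfun_eval p z = poly a z / poly b z" by (rule ratfunE[of p]) blast
  obtain a' b' where q: "b' \<noteq> 0" "q = Fract a' b'" "\<And>z. ratfun_eval q z = poly a' z / poly b' z" by (rule ratfunE[of q]) blast
  have "ratfun_const c * p + ratfun_const d * q = Fract (smult c a * b' + smult d a' * b) (b * b')"
    using p(1) q(1) by (simp add: ratfun_const_def to_fract_def p(2) q(2))
  moreover have "\<forall>\<^sub>\<approx>z\<in>UNIV. poly (b * b') z \<noteq> 0" by (rule poly_nonzero_cosparse) (use p q in auto)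
  hence "\<forall>\<^sub>\<approx>z\<in>UNIV. ratfun_eval (Fract (smult c a * b' + smult d a' * b) (b * b')) z = c * ratfun_eval p z + d * ratfun_eval q z"
    by eventually_elim (subst ratfun_eval_Fract, auto simp: p(3) q(3) field_simps)
  ultimately show ?thesis by simp
qed

lemma ratfun_const_1 [simp]: "ratfun_const 1 = 1"
  by (simp add: ratfun_const_def one_pCons[symmetric])

text \<open>The numerator N in f^(j) = N / d2^(j+1) exp h, from the quotient rule. Only the
  derivative of h enters the recursion, never h itself.\<close>

primrec deriv_numerator :: "(complex \<Rightarrow> complex) \<Rightarrow> (complex \<Rightarrow> complex) \<Rightarrow> (complex \<Rightarrow> complex) \<Rightarrow> nat \<Rightarrow> complex \<Rightarrow> complex" where
  "deriv_numerator d1 d2 h 0 = d1"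
| "deriv_numerator d1 d2 h (Suc j) = (\<lambda>z. deriv (deriv_numerator d1 d2 h j) z * d2 z
     - of_nat (Suc j) * deriv_numerator d1 d2 h j z * deriv d2 z + deriv_numerator d1 d2 h j z * d2 z * deriv h z)"

lemma (in growth_scale) exp_growth_deriv_numerator:
  assumes "exp_growth d1" "exp_growth d2" "exp_growth (deriv h)"
  shows "exp_growth (deriv_numerator d1 d2 h j)"
proof (induction j)
  case (Suc j)
  show ?case unfolding deriv_numerator.simps
    by (intro exp_growth_add exp_growth_diff exp_growth_mult exp_growth_deriv exp_growth_const Suc assms)
qed (use assms in simp)

text \<open>The quotient rule with D for d2 and X for d2^j. One factor X cancels, so that a
  derivative raises the power of d2 in the denominator by one instead of doubling it.\<close>

lemma deriv_numerator_algebra: "(a * (D * X) - n * (s * (b * X))) / ((D * X) * (D * X)) * e + e * k * (n / (D * X)) =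
      (a * D - s * n * b + n * D * k) / (D * (D * X)) * e" if "D \<noteq> 0" "X \<noteq> 0" for a b n s e k D X :: complex
proof -
  have e1: "(a * (D * X) - n * (s * (b * X))) / ((D * X) * (D * X)) = (a * D - n * s * b) / (D * (D * X))"
    using that(2) mult_divide_mult_cancel_right[OF that(2), of "a * D - n * s * b" "D * (D * X)"] by (simp add: algebra_simps)
  have e2: "n / (D * X) = n * D / (D * (D * X))" using that by simp
  have e3: "p / Y * e + e * k * (q / Y) = (p + q * k) / Y * e" for p q Y :: complex
    by (simp add: add_divide_distrib algebra_simps)
  show ?thesis unfolding e1 unfolding e2 unfolding e3 by (simp only: mult_ac)
qed

text \<open>S is open because derivatives at z depend on f near z, where the formula for f must
  hold.\<close>

lemma higher_deriv_quotient_exp: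
  assumes hol: "d1 holomorphic_on UNIV" "d2 holomorphic_on UNIV" "h holomorphic_on UNIV" and "open S"
    and f: "\<And>z. z \<in> S \<Longrightarrow> f z = d1 z / d2 z * exp (h z)" and nz: "\<And>z. z \<in> S \<Longrightarrow> d2 z \<noteq> 0" and "z \<in> S"
  shows "(deriv ^^ j) f z = deriv_numerator d1 d2 h j z / d2 z ^ Suc j * exp (h z)"
  using \<open>z \<in> S\<close>
proof (induction j arbitrary: z)
  case 0
  thus ?case by (simp add: f)
next
  case (Suc j)
  define N where "N = deriv_numerator d1 d2 h j"
  have "N holomorphic_on UNIV" unfolding N_def
  proof (induction j)
    case (Suc j)
    show ?case unfolding deriv_numerator.simps by (intro holomorphic_intros Suc hol) auto
  qed (use hol in simp)
  hence dN: "(N has_field_derivative deriv N z) (at z)" using holomorphic_derivI by blast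
  have dd: "(d2 has_field_derivative deriv d2 z) (at z)" and dh: "(h has_field_derivative deriv h z) (at z)"
    using hol holomorphic_derivI by blast+
  have nz': "d2 z ^ Suc j \<noteq> 0" using nz[OF Suc.prems] by simp
  note D = DERIV_mult[OF DERIV_divide[OF dN DERIV_power[OF dd, of "Suc j"] nz'] DERIV_fun_exp[OF dh]]
  have "deriv (\<lambda>z. N z / d2 z ^ Suc j * exp (h z)) z = deriv_numerator d1 d2 h (Suc j) z / d2 z ^ Suc (Suc j) * exp (h z)"
    unfolding DERIV_imp_deriv[OF D] deriv_numerator.simps N_def[symmetric]
    unfolding power_Suc diff_Suc_Suc diff_zero
    by (rule deriv_numerator_algebra) (use nz[OF Suc.prems] in auto)
  moreover have "deriv ((deriv ^^ j) f) z = deriv (\<lambda>z. N z / d2 z ^ Suc j * exp (h z)) z"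
  proof (rule deriv_cong_ev)
    have "eventually (\<lambda>z. z \<in> S) (nhds z)" using \<open>open S\<close> Suc.prems by (rule eventually_nhds_in_open)
    thus "eventually (\<lambda>z. (deriv ^^ j) f z = N z / d2 z ^ Suc j * exp (h z)) (nhds z)"
      by eventually_elim (use Suc.IH in \<open>simp add: N_def\<close>)
  qed simp
  ultimately show ?case by simp
qed

definition mon_degree :: "(nat \<Rightarrow>\<^sub>0 nat) \<Rightarrow> nat" where
  "mon_degree l = (\<Sum>j\<in>Poly_Mapping.keys l. Poly_Mapping.lookup l j)"

text \<open>The power of d2 in the denominator of the monomial: a factor f^(j) contributes j +
  1.\<close>

definition mon_weight :: "(nat \<Rightarrow>\<^sub>0 nat) \<Rightarrow> nat" where
  "mon_weight l = (\<Sum>j\<in>Poly_Mapping.keys l. Suc j * Poly_Mapping.lookup l j)"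

text \<open>A monomial of total degree k contributes to exp (k h) only, so collecting monomials by
  degree gives the coefficients. Q clears the denominators of the rational coefficients, and a power
  of d2 clears those of the derivatives.\<close>

lemma (in growth_scale) diffpoly_expansion:
  assumes d: "exp_growth d1" "exp_growth d2" "exp_growth (deriv h)" and h: "h holomorphic_on UNIV" and d2: "d2 w2 \<noteq> 0"
    and f: "\<forall>\<^sub>\<approx>z\<in>UNIV. f z = d1 z / d2 z * exp (h z)"
    and m: "diffpoly_degree P \<le> m"
  obtains Q M A where "Q \<noteq> 0" "M \<ge> K" "\<And>j. exp_growth (A j)"
    "\<forall>\<^sub>\<approx>z\<in>UNIV. poly Q z * d2 z ^ M * diffpoly_eval P f z = (\<Sum>j\<le>m. A j z * exp (of_nat j * h z))"
proof -
  have hol: "d1 holomorphic_on UNIV" "d2 holomorphic_on UNIV" using d by (auto intro: exp_growth_holomorphic)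
  define num where "num = (\<lambda>l. fst (quot_of_fract (Poly_Mapping.lookup P l)))"
  define den where "den = (\<lambda>l. snd (quot_of_fract (Poly_Mapping.lookup P l)))"
  have den: "den l \<noteq> 0" for l by (simp add: den_def)
  let ?K = "Poly_Mapping.keys P"
  define Q where "Q = (\<Prod>l\<in>?K. den l)"
  \<comment> \<open>The free summand \<open>K\<close> lets the caller enlarge the power of d2, so
    that it also clears the denominator of f^n.\<close>
  define M where "M = K + (\<Sum>l\<in>?K. mon_weight l)"
  define N where "N = deriv_numerator d1 d2 h"
  define T where "T = (\<lambda>l z. poly (num l * (\<Prod>l'\<in>?K - {l}. den l')) z *
      (\<Prod>i\<in>Poly_Mapping.keys l. N i z ^ Poly_Mapping.lookup l i) * d2 z ^ (M - mon_weight l))"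
  define A where "A = (\<lambda>j z. \<Sum>l | l \<in> ?K \<and> mon_degree l = j. T l z)"
  have "exp_growth (T l)" for l
    unfolding T_def N_def
    by (intro exp_growth_mult exp_growth_prod exp_growth_power exp_growth_poly exp_growth_deriv_numerator d)
  hence A: "exp_growth (A j)" for j unfolding A_def by (intro exp_growth_sum)
  have Q: "Q \<noteq> 0" using den by (simp add: Q_def)
  have deg: "mon_degree l \<le> m" if "l \<in> ?K" for l
  proof -
    have "mon_degree l \<le> diffpoly_degree P"
      unfolding diffpoly_degree_def mon_degree_def using that by (intro Max_ge) auto
    thus ?thesis using m by simp
  qed
  have wt: "mon_weight l \<le> M" if "l \<in> ?K" for l
    unfolding M_def using member_le_sum[OF that, of mon_weight] by simp
  have "\<forall>\<^sub>\<approx>z\<in>UNIV. f z = d1 z / d2 z * exp (h z) \<and> d2 z \<noteq> 0"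
    using f entire_nonzero_cosparse[OF hol(2) d2] by (rule eventually_conj)
  hence "{z. \<not> (f z = d1 z / d2 z * exp (h z) \<and> d2 z \<noteq> 0)} sparse_in UNIV" by (simp only: eventually_cosparse)
  \<comment> \<open>The good points must form an open set before derivatives of f can be computed
    there; a sparse subset of the plane is closed.\<close>
  hence "closed {z. \<not> (f z = d1 z / d2 z * exp (h z) \<and> d2 z \<noteq> 0)}" by (rule sparse_in_UNIV_imp_closed)
  moreover define S where "S = {z. f z = d1 z / d2 z * exp (h z) \<and> d2 z \<noteq> 0}"
  ultimately have "open S" by (simp add: closed_def Collect_neg_eq[symmetric])
  have "\<forall>\<^sub>\<approx>z\<in>UNIV. z \<in> S" unfolding S_def using \<open>\<forall>\<^sub>\<approx>z\<in>UNIV. f z = _ \<and> _\<close> by simp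
  moreover have "\<forall>\<^sub>\<approx>z\<in>UNIV. poly Q z \<noteq> 0" by (rule poly_nonzero_cosparse[OF Q])
  ultimately have "\<forall>\<^sub>\<approx>z\<in>UNIV. poly Q z * d2 z ^ M * diffpoly_eval P f z = (\<Sum>j\<le>m. A j z * exp (of_nat j * h z))"
  proof eventually_elim
    case (elim z)
    have nz: "d2 z \<noteq> 0" using elim by (simp add: S_def)
    have der: "(deriv ^^ j) f z = N j z / d2 z ^ Suc j * exp (h z)" for j
      unfolding N_def
    proof (rule higher_deriv_quotient_exp[OF hol h \<open>open S\<close> _ _ elim(1)])
      fix w assume "w \<in> S"
      thus "f w = d1 w / d2 w * exp (h w)" "d2 w \<noteq> 0" unfolding S_def mem_Collect_eq by blast+
    qed
    have "poly Q z * d2 z ^ M * (ratfun_eval (Poly_Mapping.lookup P l) z *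
        (\<Prod>j\<in>Poly_Mapping.keys l. (deriv ^^ j) f z ^ Poly_Mapping.lookup l j)) = T l z * exp (of_nat (mon_degree l) * h z)"
      if l: "l \<in> ?K" for l
    proof -
      have "poly (den l) z \<noteq> 0" using elim(2) l by (auto simp: Q_def poly_prod)
      have "Q = den l * (\<Prod>l'\<in>?K - {l}. den l')" unfolding Q_def using l by (simp add: prod.remove)
      hence 1: "poly Q z * ratfun_eval (Poly_Mapping.lookup P l) z = poly (num l * (\<Prod>l'\<in>?K - {l}. den l')) z"
        using \<open>poly (den l) z \<noteq> 0\<close> by (simp add: ratfun_eval_def num_def den_def)
      have "(\<Prod>j\<in>Poly_Mapping.keys l. (deriv ^^ j) f z ^ Poly_Mapping.lookup l j) =
         (\<Prod>j\<in>Poly_Mapping.keys l. N j z ^ Poly_Mapping.lookup l j / d2 z ^ (Suc j * Poly_Mapping.lookup l j) * exp (h z) ^ Poly_Mapping.lookup l j)"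
        unfolding der by (intro prod.cong refl) (simp only: power_mult_distrib power_divide power_mult)
      also have "\<dots> = (\<Prod>j\<in>Poly_Mapping.keys l. N j z ^ Poly_Mapping.lookup l j) / d2 z ^ mon_weight l * exp (h z) ^ mon_degree l"
        unfolding prod.distrib prod_dividef power_sum[symmetric] mon_weight_def mon_degree_def ..
      finally have 2: "(\<Prod>j\<in>Poly_Mapping.keys l. (deriv ^^ j) f z ^ Poly_Mapping.lookup l j) = \<dots>" .
      have 3: "d2 z ^ M = d2 z ^ (M - mon_weight l) * d2 z ^ mon_weight l"
        using wt[OF l] by (simp add: power_add[symmetric])
      have "poly Q z * d2 z ^ M * (ratfun_eval (Poly_Mapping.lookup P l) z *
        (\<Prod>j\<in>Poly_Mapping.keys l. (deriv ^^ j) f z ^ Poly_Mapping.lookup l j)) = 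
        (poly Q z * ratfun_eval (Poly_Mapping.lookup P l) z) * (d2 z ^ M * (\<Prod>j\<in>Poly_Mapping.keys l. (deriv ^^ j) f z ^ Poly_Mapping.lookup l j))"
        by (simp only: mult_ac)
      also have "\<dots> = T l z * exp (of_nat (mon_degree l) * h z)"
        unfolding 1 2 3 T_def using nz by (simp add: exp_of_nat_mult)
      finally show ?thesis .
    qed
    hence "poly Q z * d2 z ^ M * diffpoly_eval P f z = (\<Sum>l\<in>?K. T l z * exp (of_nat (mon_degree l) * h z))"
      unfolding diffpoly_eval_def sum_distrib_left by (intro sum.cong refl)
    also have "\<dots> = (\<Sum>j\<le>m. \<Sum>l | l \<in> ?K \<and> mon_degree l = j. T l z * exp (of_nat (mon_degree l) * h z))"
      by (rule sum.group[symmetric]) (use deg in auto)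
    also have "\<dots> = (\<Sum>j\<le>m. A j z * exp (of_nat j * h z))"
      unfolding A_def sum_distrib_right by (intro sum.cong refl) auto
    finally show ?case .
  qed
  thus ?thesis using that[of Q M A] A Q by (simp add: M_def)
qed

text \<open>E is the common factor by which the equation is multiplied. It is kept in the
  conclusion, together with its relation to the original terms, so that a statement about the
  cleared identity can be divided by E again. The identity is checked off a sparse set; it then
  holds everywhere since both sides are entire.\<close>

lemma (in growth_scale) main_equation:
  assumes d: "exp_growth d1" "exp_growth d2" "exp_growth (deriv h)" and h: "h holomorphic_on UNIV" 
    and nz: "d1 w1 \<noteq> 0" "d2 w2 \<noteq> 0"
    and f: "\<forall>\<^sub>\<approx>z\<in>UNIV. f z = d1 z / d2 z * exp (h z)"
    and n: "diffpoly_degree P < n"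
    and eq: "\<forall>\<^sub>\<approx>z\<in>UNIV. f z ^ n + diffpoly_eval P f z =
           ratfun_eval p1 z * exp (poly \<alpha>1 z) + ratfun_eval p2 z * exp (poly \<alpha>2 z)"
  obtains E G A B1 B2 where "\<forall>\<^sub>\<approx>z\<in>UNIV. E z \<noteq> 0" "\<forall>\<^sub>\<approx>z\<in>UNIV. G z \<noteq> 0"
    "exp_growth G" "\<And>j. exp_growth (A j)" "exp_growth B1" "exp_growth B2"
    "\<forall>\<^sub>\<approx>z\<in>UNIV. G z * exp (of_nat n * h z) = E z * f z ^ n"
    "\<forall>\<^sub>\<approx>z\<in>UNIV. B1 z = E z * ratfun_eval p1 z" "\<forall>\<^sub>\<approx>z\<in>UNIV. B2 z = E z * ratfun_eval p2 z"
    "\<And>z. G z * exp (of_nat n * h z) + (\<Sum>j<n. A j z * exp (of_nat j * h z)) =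
       B1 z * exp (poly \<alpha>1 z) + B2 z * exp (poly \<alpha>2 z)"
proof -
  have hol: "d1 holomorphic_on UNIV" "d2 holomorphic_on UNIV" using d by (auto intro: exp_growth_holomorphic)
  obtain m where m: "n = Suc m" using n by (cases n) auto
  obtain Q M A where Q: "Q \<noteq> 0" "M \<ge> n" "\<And>j. exp_growth (A j)"
    "\<forall>\<^sub>\<approx>z\<in>UNIV. poly Q z * d2 z ^ M * diffpoly_eval P f z = (\<Sum>j\<le>m. A j z * exp (of_nat j * h z))"
    by (rule diffpoly_expansion[OF d h nz(2) f, of P m n]) (use n m in simp, rule that)
  obtain a1 b1 where p1: "b1 \<noteq> 0" "p1 = Fract a1 b1" "\<And>z. ratfun_eval p1 z = poly a1 z / poly b1 z" by (rule ratfunE[of p1]) blast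
  obtain a2 b2 where p2: "b2 \<noteq> 0" "p2 = Fract a2 b2" "\<And>z. ratfun_eval p2 z = poly a2 z / poly b2 z" by (rule ratfunE[of p2]) blast
  define E where "E = (\<lambda>z. poly (Q * b1 * b2) z * d2 z ^ M)"
  define G where "G = (\<lambda>z. poly (Q * b1 * b2) z * (d1 z ^ n * d2 z ^ (M - n)))"
  define A' where "A' = (\<lambda>j z. poly (b1 * b2) z * A j z)"
  define B1 where "B1 = (\<lambda>z. poly (Q * a1 * b2) z * d2 z ^ M)"
  define B2 where "B2 = (\<lambda>z. poly (Q * a2 * b1) z * d2 z ^ M)"
  have g: "exp_growth G" "exp_growth (A' j)" "exp_growth B1" "exp_growth B2" for j
    unfolding G_def A'_def B1_def B2_def
    by (intro exp_growth_mult exp_growth_power exp_growth_poly d Q)+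
  have pnz: "\<forall>\<^sub>\<approx>z\<in>UNIV. poly (Q * b1 * b2) z \<noteq> 0"
    by (rule poly_nonzero_cosparse) (use Q p1 p2 in auto)
  note dnz = entire_nonzero_cosparse[OF hol(1) nz(1)] entire_nonzero_cosparse[OF hol(2) nz(2)]
  have E0: "\<forall>\<^sub>\<approx>z\<in>UNIV. E z \<noteq> 0" using pnz dnz(2) by eventually_elim (simp add: E_def)
  have G0: "\<forall>\<^sub>\<approx>z\<in>UNIV. G z \<noteq> 0" using pnz dnz by eventually_elim (simp add: G_def)
  have GE: "\<forall>\<^sub>\<approx>z\<in>UNIV. G z * exp (of_nat n * h z) = E z * f z ^ n"
    using f dnz(2)
  proof eventually_elim
    case (elim z)
    have "d2 z ^ M = d2 z ^ (M - n) * d2 z ^ n" using Q(2) by (simp add: power_add[symmetric])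
    thus ?case using elim by (simp add: E_def G_def power_mult_distrib power_divide exp_of_nat_mult)
  qed
  have B1E: "\<forall>\<^sub>\<approx>z\<in>UNIV. B1 z = E z * ratfun_eval p1 z"
    using pnz by eventually_elim (simp add: B1_def E_def p1(3))
  have B2E: "\<forall>\<^sub>\<approx>z\<in>UNIV. B2 z = E z * ratfun_eval p2 z"
    using pnz by eventually_elim (simp add: B2_def E_def p2(3))
  have "G z * exp (of_nat n * h z) + (\<Sum>j<n. A' j z * exp (of_nat j * h z)) - 
       (B1 z * exp (poly \<alpha>1 z) + B2 z * exp (poly \<alpha>2 z)) = 0" for z
  proof (rule entire_zero_of_cosparse[where F = "\<lambda>z. G z * exp (of_nat n * h z) + (\<Sum>j<n. A' j z * exp (of_nat j * h z)) - 
       (B1 z * exp (poly \<alpha>1 z) + B2 z * exp (poly \<alpha>2 z))"])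
    show "(\<lambda>z. G z * exp (of_nat n * h z) + (\<Sum>j<n. A' j z * exp (of_nat j * h z)) - 
       (B1 z * exp (poly \<alpha>1 z) + B2 z * exp (poly \<alpha>2 z))) holomorphic_on UNIV"
      by (intro holomorphic_intros g[THEN exp_growth_holomorphic] h)
    show "\<forall>\<^sub>\<approx>z\<in>UNIV. G z * exp (of_nat n * h z) + (\<Sum>j<n. A' j z * exp (of_nat j * h z)) - 
       (B1 z * exp (poly \<alpha>1 z) + B2 z * exp (poly \<alpha>2 z)) = 0"
      using GE B1E B2E Q(4) eq
    proof eventually_elim
      case (elim z)
      have "(\<Sum>j<n. A' j z * exp (of_nat j * h z)) = poly (b1 * b2) z * (\<Sum>j\<le>m. A j z * exp (of_nat j * h z))"
        unfolding sum_distrib_left m lessThan_Suc_atMost by (intro sum.cong refl) (simp add: A'_def mult.assoc)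
      also have "\<dots> = E z * diffpoly_eval P f z" unfolding elim(4)[symmetric] by (simp add: E_def mult_ac)
      finally have "G z * exp (of_nat n * h z) + (\<Sum>j<n. A' j z * exp (of_nat j * h z)) = 
        E z * (f z ^ n + diffpoly_eval P f z)" using elim(1) by (simp add: distrib_left)
      thus "G z * exp (of_nat n * h z) + (\<Sum>j<n. A' j z * exp (of_nat j * h z)) - 
       (B1 z * exp (poly \<alpha>1 z) + B2 z * exp (poly \<alpha>2 z)) = 0"
        by (simp only: elim(2,3,5) distrib_left mult.assoc diff_self)
    qed
  qed
  hence "G z * exp (of_nat n * h z) + (\<Sum>j<n. A' j z * exp (of_nat j * h z)) =
       B1 z * exp (poly \<alpha>1 z) + B2 z * exp (poly \<alpha>2 z)" for z by (metis eq_iff_diff_eq_0)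
  thus ?thesis using that[of E G A' B1 B2] E0 G0 g GE B1E B2E by blast
qed

section \<open>The exponent h is a polynomial\<close>

lemma (in growth_scale) exp_growth_of_order_growth:
  assumes "order_growth \<tau> F"
  shows "exp_growth F"
proof -
  obtain C where C: "C \<ge> 0" "\<And>r z. r \<ge> 1 \<Longrightarrow> norm z \<le> r \<Longrightarrow> norm (F z) \<le> exp (C * r powr \<tau>)"
    using order_growthE[OF \<tau>_pos assms] by blast
  show ?thesis
  proof (rule exp_growthI[where C = C])
    fix r \<delta> :: real and z assume *: "1 \<le> r" "0 < \<delta>" "\<delta> \<le> 1" "cmod z \<le> r"
    have "norm (F z) \<le> exp (C * r powr \<tau>)" using C * by blast
    also have "C * r powr \<tau> \<le> C * scale r \<delta>"
      using scale_ge(2)[OF *(1-3)] C by (intro mult_left_mono) auto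
    finally show "norm (F z) \<le> exp (C * scale r \<delta>)" by simp
  qed (rule order_growth_holomorphic[OF \<tau>_pos assms])
qed

text \<open>A sum of norms is not holomorphic, hence outside the class itself, but obeys the same
  kind of bound.\<close>

lemma (in growth_scale) exp_growth_norm_sum:
  assumes "finite I" "\<And>i. i \<in> I \<Longrightarrow> exp_growth (F i)"
  shows "\<exists>C\<ge>0. \<forall>r \<delta> z. 1 \<le> r \<longrightarrow> 0 < \<delta> \<longrightarrow> \<delta> \<le> 1 \<longrightarrow> norm z \<le> r \<longrightarrow> (\<Sum>i\<in>I. norm (F i z)) \<le> exp (C * scale r \<delta>)"
  using assms
proof (induction I)
  case empty
  thus ?case by (intro exI[of _ 0]) auto
next
  case (insert i I)
  obtain A where A: "A \<ge> 0" "\<And>r \<delta> z. 1 \<le> r \<Longrightarrow> 0 < \<delta> \<Longrightarrow> \<delta> \<le> 1 \<Longrightarrow> norm z \<le> r \<Longrightarrow> norm (F i z) \<le> exp (A * scale r \<delta>)"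
    using exp_growthE[of "F i"] insert by (metis insertI1)
  obtain B where B: "B \<ge> 0" "\<And>r \<delta> z. 1 \<le> r \<Longrightarrow> 0 < \<delta> \<Longrightarrow> \<delta> \<le> 1 \<Longrightarrow> norm z \<le> r \<Longrightarrow> (\<Sum>i\<in>I. norm (F i z)) \<le> exp (B * scale r \<delta>)"
    using insert by (metis insertI2)
  show ?case
  proof (intro exI[of _ "A + B + 1"] conjI allI impI)
    fix r \<delta> :: real and z assume *: "1 \<le> r" "0 < \<delta>" "\<delta> \<le> 1" "cmod z \<le> r"
    show "(\<Sum>i\<in>insert i I. norm (F i z)) \<le> exp ((A + B + 1) * scale r \<delta>)"
      using exp_scale_add[OF *(1-3) A(1) B(1) A(2)[OF *] B(2)[OF *]] insert.hyps by simp
  qed (use A B in auto)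
qed

lemma exponent_polynomial:
  assumes "0 < \<tau>" and d: "order_growth \<tau> d1" "order_growth \<tau> d2" and h: "h holomorphic_on UNIV" 
    and nz: "d1 w1 \<noteq> 0" "d2 w2 \<noteq> 0"
    and f: "\<forall>\<^sub>\<approx>z\<in>UNIV. f z = d1 z / d2 z * exp (h z)"
    and n: "diffpoly_degree P < n"
    and eq: "\<forall>\<^sub>\<approx>z\<in>UNIV. f z ^ n + diffpoly_eval P f z =
           ratfun_eval p1 z * exp (poly \<alpha>1 z) + ratfun_eval p2 z * exp (poly \<alpha>2 z)"
  obtains H where "\<And>z. h z = poly H z"
proof -
  \<comment> \<open>With this exponent the class contains exp \<alpha>1 and exp \<alpha>2 as well,
    so that the whole right-hand side counts as a coefficient.\<close>
  define \<rho> where "\<rho> = max \<tau> (max (degree \<alpha>1) (degree \<alpha>2))"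
  have \<rho>: "\<rho> > 0" "\<tau> \<le> \<rho>" "degree \<alpha>1 \<le> \<rho>" "degree \<alpha>2 \<le> \<rho>" using assms(1) by (auto simp: \<rho>_def)
  interpret growth_scale \<rho> "\<lambda>r. ln (1 + \<bar>pos_mean h r\<bar>)" by unfold_locales (use \<rho> in auto)
  have d': "exp_growth d1" "exp_growth d2" 
    using d order_growth_mono[OF assms(1) \<rho>(2)] by (auto intro: exp_growth_of_order_growth)
  have h': "exp_growth (deriv h)" by (intro exp_growth_deriv exp_growth_of_pos_mean h \<rho>)
  obtain E G A B1 B2 where *: "\<forall>\<^sub>\<approx>z\<in>UNIV. E z \<noteq> 0" "\<forall>\<^sub>\<approx>z\<in>UNIV. G z \<noteq> 0"
    "exp_growth G" "\<And>j. exp_growth (A j)" "exp_growth B1" "exp_growth B2"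
    "\<forall>\<^sub>\<approx>z\<in>UNIV. G z * exp (of_nat n * h z) = E z * f z ^ n"
    "\<forall>\<^sub>\<approx>z\<in>UNIV. B1 z = E z * ratfun_eval p1 z" "\<forall>\<^sub>\<approx>z\<in>UNIV. B2 z = E z * ratfun_eval p2 z"
    "\<And>z. G z * exp (of_nat n * h z) + (\<Sum>j<n. A j z * exp (of_nat j * h z)) =
       B1 z * exp (poly \<alpha>1 z) + B2 z * exp (poly \<alpha>2 z)"
    by (rule main_equation[OF d' h' h nz f n eq]) (rule that)
  \<comment> \<open>All functions that bound the leading term are listed together. \<open>G\<close>
    is among them for the region Re h \<le> 0, where the left-hand side below is just |G|.\<close>
  define F where "F = (\<lambda>j. if j < n then A j else if j = n then (\<lambda>z. B1 z * exp (poly \<alpha>1 z)) 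
     else if j = n + 1 then (\<lambda>z. B2 z * exp (poly \<alpha>2 z)) else G)"
  have F: "exp_growth (F j)" for j
    unfolding F_def using *(3-6) \<rho> by (simp add: exp_growth_mult exp_growth_exp_poly)
  have "\<exists>C\<ge>0. \<forall>r \<delta> z. 1 \<le> r \<longrightarrow> 0 < \<delta> \<longrightarrow> \<delta> \<le> 1 \<longrightarrow> norm z \<le> r \<longrightarrow> (\<Sum>i\<in>{..n+2}. norm (F i z)) \<le> exp (C * scale r \<delta>)"
    by (rule exp_growth_norm_sum[OF finite_atMost F])
  then obtain C where C: "C \<ge> 0" "\<And>r \<delta> z. 1 \<le> r \<Longrightarrow> 0 < \<delta> \<Longrightarrow> \<delta> \<le> 1 \<Longrightarrow> norm z \<le> r \<Longrightarrow> (\<Sum>i\<in>{..n+2}. norm (F i z)) \<le> exp (C * scale r \<delta>)"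
    by blast
  have split: "(\<Sum>i\<in>{..n+2}. norm (F i z)) = (\<Sum>j<n. norm (A j z)) + norm (B1 z * exp (poly \<alpha>1 z)) + norm (B2 z * exp (poly \<alpha>2 z)) + norm (G z)" for z
  proof -
    have "{..n+2} = {..<n} \<union> {n, n+1, n+2}" by auto
    hence "(\<Sum>i\<in>{..n+2}. norm (F i z)) = (\<Sum>i\<in>{..<n}. norm (F i z)) + (\<Sum>i\<in>{n, n+1, n+2}. norm (F i z))"
      by (simp only:) (rule sum.union_disjoint, auto)
    also have "(\<Sum>i\<in>{..<n}. norm (F i z)) = (\<Sum>j<n. norm (A j z))" by (intro sum.cong) (auto simp: F_def)
    finally show ?thesis by (simp add: F_def)
  qed
  \<comment> \<open>Where Re h > 0, every term other than the leading one is at most its coefficient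
    times x^(n-1), with x = exp (Re h). Cancelling x^(n-1) leaves a single factor x beside |G|. This
    uses that the degree of P is below n.\<close>
  have key: "norm (G z) * exp (max 0 (Re (h z))) \<le> (\<Sum>i\<in>{..n+2}. norm (F i z))" for z
  proof (cases "Re (h z) \<le> 0")
    case True
    thus ?thesis unfolding split by (simp add: sum_nonneg add_nonneg_nonneg)
  next
    case False
    obtain m where m: "n = Suc m" using n by (cases n) auto
    define x where "x = exp (Re (h z))"
    have x: "x \<ge> 1" using False by (simp add: x_def)
    have ex: "norm (exp (of_nat j * h z)) = x ^ j" for j
      by (simp add: x_def exp_of_nat_mult[symmetric])
    have "norm (G z) * x ^ n = norm (G z * exp (of_nat n * h z))" by (simp only: norm_mult ex)
    also have "G z * exp (of_nat n * h z) = B1 z * exp (poly \<alpha>1 z) + B2 z * exp (poly \<alpha>2 z) - (\<Sum>j<n. A j z * exp (of_nat j * h z))"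
      using *(10)[of z] by (simp add: eq_diff_eq)
    also have "norm \<dots> \<le> norm (B1 z * exp (poly \<alpha>1 z)) + norm (B2 z * exp (poly \<alpha>2 z)) + (\<Sum>j<n. norm (A j z * exp (of_nat j * h z)))"
      by (intro order_trans[OF norm_triangle_ineq4] add_mono norm_triangle_ineq norm_sum)
    also have "\<dots> \<le> norm (B1 z * exp (poly \<alpha>1 z)) * x ^ m + norm (B2 z * exp (poly \<alpha>2 z)) * x ^ m + (\<Sum>j<n. norm (A j z) * x ^ m)"
    proof (intro add_mono sum_mono)
      show "norm (B1 z * exp (poly \<alpha>1 z)) \<le> norm (B1 z * exp (poly \<alpha>1 z)) * x ^ m"
        "norm (B2 z * exp (poly \<alpha>2 z)) \<le> norm (B2 z * exp (poly \<alpha>2 z)) * x ^ m"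
        using x one_le_power[OF x, of m] by (simp_all add: mult_le_cancel_left1)
      fix j assume "j \<in> {..<n}"
      hence "x ^ j \<le> x ^ m" using x m by (intro power_increasing) auto
      thus "norm (A j z * exp (of_nat j * h z)) \<le> norm (A j z) * x ^ m"
        unfolding norm_mult ex by (intro mult_left_mono) auto
    qed
    also have "\<dots> = ((\<Sum>j<n. norm (A j z)) + norm (B1 z * exp (poly \<alpha>1 z)) + norm (B2 z * exp (poly \<alpha>2 z))) * x ^ m"
      by (simp only: distrib_right sum_distrib_right add_ac)
    finally have "(norm (G z) * x) * x ^ m \<le> ((\<Sum>j<n. norm (A j z)) + norm (B1 z * exp (poly \<alpha>1 z)) + norm (B2 z * exp (poly \<alpha>2 z))) * x ^ m"
      by (simp add: m mult.assoc)
    moreover have "x ^ m > 0" using x by simp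
    ultimately have "norm (G z) * x \<le> (\<Sum>j<n. norm (A j z)) + norm (B1 z * exp (poly \<alpha>1 z)) + norm (B2 z * exp (poly \<alpha>2 z))"
      by (rule mult_right_le_imp_le)
    moreover have "max 0 (Re (h z)) = Re (h z)" using False by simp
    ultimately show ?thesis unfolding split x_def using norm_ge_zero[of "G z"] by linarith
  qed
  have "G holomorphic_on UNIV" using *(3) by (rule exp_growth_holomorphic)
  moreover obtain w where "G w \<noteq> 0" using cosparse_ex[OF *(2)] by blast
  ultimately obtain D where D: "D \<ge> 0" "\<And>r \<psi> B. r \<ge> 1 \<Longrightarrow> continuous_on UNIV \<psi> \<Longrightarrow>
     (\<And>z. norm z \<le> r \<Longrightarrow> norm (G z) * exp (\<psi> z) \<le> exp B) \<Longrightarrow> circ_mean r \<psi> \<le> B + D"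
    using circ_mean_le by metis
  have ch: "continuous_on UNIV (\<lambda>z. max 0 (Re (h z)))"
    by (intro continuous_intros holomorphic_on_imp_continuous_on h)
  have U0: "pos_mean h r \<ge> 0" if "r \<ge> 0" for r using pos_mean_nonneg[OF h that] .
  have ineq: "pos_mean h r \<le> (C + D) * (r powr \<rho> + ln (1 + pos_mean h (r + \<delta>)) + ln (1 / \<delta>))"
    if r: "1 \<le> r" "0 < \<delta>" "\<delta> \<le> 1" for r \<delta>
  proof -
    have "pos_mean h r \<le> C * scale r \<delta> + D"
      unfolding pos_mean_def[of h r] using D(2)[OF r(1) ch] order_trans[OF key C(2)[OF r]] .
    also have "\<dots> \<le> (C + D) * scale r \<delta>"
      using mult_left_mono[OF scale_ge(1)[OF r] D(1)] by (simp add: distrib_right)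
    also have "scale r \<delta> = r powr \<rho> + ln (1 + pos_mean h (r + \<delta>)) + ln (1 / \<delta>)"
      using U0[of "r + \<delta>"] r by (simp add: scale_def)
    finally show ?thesis .
  qed
  \<comment> \<open>Continuity of the mean in the radius supplies the local boundedness against
    which the iteration derives its contradiction.\<close>
  have bdd: "\<exists>M. \<forall>r\<in>{1..b}. pos_mean h r \<le> M" for b
  proof -
    have "continuous_on {1..b} (pos_mean h)"
      unfolding pos_mean_def by (intro continuous_at_imp_continuous_on ballI isCont_circ_mean ch)
    hence "compact (pos_mean h ` {1..b})" by (intro compact_continuous_image) auto
    hence "bounded (pos_mean h ` {1..b})" by (rule compact_imp_bounded)
    thus ?thesis unfolding bounded_iff by (metis abs_le_D1 image_eqI real_norm_def)
  qed
  obtain K where K: "\<And>r. r \<ge> 1 \<Longrightarrow> pos_mean h r \<le> K * r powr \<rho>"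
    by (rule growth_iteration[OF less_imp_le[OF \<rho>(1)] _ bdd ineq]) (use U0 that in auto)
  show ?thesis
    by (rule polynomial_of_pos_mean_le[OF h less_imp_le[OF \<rho>(1)] K]) (use that in auto)
qed

section \<open>Roots of exponential sums and the main theorem\<close>

text \<open>In the group of the exponent n H no j H with j < n occurs, because the difference has
  the full degree of H, which exceeds \<tau>. So G exp (n H) is the sum of those right-hand terms
  that belong to the group; \<open>c1\<close> and \<open>c2\<close> record which ones.\<close>

lemma leading_power_cases:
  assumes "0 < \<tau>" and d: "order_growth \<tau> d1" "order_growth \<tau> d2" and nz: "d1 w1 \<noteq> 0" "d2 w2 \<noteq> 0"
    and f: "\<forall>\<^sub>\<approx>z\<in>UNIV. f z = d1 z / d2 z * exp (poly H z)" and H: "\<tau> < real (degree H)"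
    and n: "diffpoly_degree P < n"
    and eq: "\<forall>\<^sub>\<approx>z\<in>UNIV. f z ^ n + diffpoly_eval P f z =
           ratfun_eval p1 z * exp (poly \<alpha>1 z) + ratfun_eval p2 z * exp (poly \<alpha>2 z)"
  obtains c1 c2 where "\<forall>\<^sub>\<approx>z\<in>UNIV. f z ^ n = (if c1 then ratfun_eval p1 z * exp (poly \<alpha>1 z) else 0)
     + (if c2 then ratfun_eval p2 z * exp (poly \<alpha>2 z) else 0)"
proof -
  interpret growth_scale \<tau> "\<lambda>_. 0" using assms(1) by (rule growth_scale_0)
  have h: "poly H holomorphic_on UNIV" by (intro holomorphic_intros)
  have h': "exp_growth (deriv (poly H))" by (intro exp_growth_deriv exp_growth_poly)
  obtain E G A B1 B2 where *: "\<forall>\<^sub>\<approx>z\<in>UNIV. E z \<noteq> 0" "\<forall>\<^sub>\<approx>z\<in>UNIV. G z \<noteq> 0"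
    "exp_growth G" "\<And>j. exp_growth (A j)" "exp_growth B1" "exp_growth B2"
    "\<forall>\<^sub>\<approx>z\<in>UNIV. G z * exp (of_nat n * poly H z) = E z * f z ^ n"
    "\<forall>\<^sub>\<approx>z\<in>UNIV. B1 z = E z * ratfun_eval p1 z" "\<forall>\<^sub>\<approx>z\<in>UNIV. B2 z = E z * ratfun_eval p2 z"
    "\<And>z. G z * exp (of_nat n * poly H z) + (\<Sum>j<n. A j z * exp (of_nat j * poly H z)) =
       B1 z * exp (poly \<alpha>1 z) + B2 z * exp (poly \<alpha>2 z)"
    by (rule main_equation[OF d h' h nz f n eq]) (rule that)
  define F where "F = (\<lambda>j. if j < n then A j else if j = n then G else if j = n + 1 then (\<lambda>z. - B1 z) else (\<lambda>z. - B2 z))"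
  define Q where "Q = (\<lambda>j. if j \<le> n then smult (of_nat j) H else if j = n + 1 then \<alpha>1 else \<alpha>2)"
  have split: "(\<Sum>i\<in>{..n+2}. g i) = (\<Sum>i<n. g i) + g n + g (n+1) + g (n+2)" for g :: "nat \<Rightarrow> complex"
  proof -
    have "{..n+2} = {..<n} \<union> {n, n+1, n+2}" by auto
    hence "sum g {..n+2} = sum g {..<n} + sum g {n, n+1, n+2}"
      by (simp only:) (rule sum.union_disjoint, auto)
    thus ?thesis by (simp add: add.assoc)
  qed
  define c1 where "c1 \<longleftrightarrow> real (degree (\<alpha>1 - smult (of_nat n) H)) \<le> \<tau>"
  define c2 where "c2 \<longleftrightarrow> real (degree (\<alpha>2 - smult (of_nat n) H)) \<le> \<tau>"
  have F: "exp_growth (F j)" for j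
    unfolding F_def using *(3-6) by (simp add: exp_growth_uminus)
  have sum0: "(\<Sum>i\<in>{..n+2}. F i z * exp (poly (Q i) z)) = 0" for z
  proof -
    have "(\<Sum>i<n. F i z * exp (poly (Q i) z)) = (\<Sum>j<n. A j z * exp (of_nat j * poly H z))"
      by (intro sum.cong) (auto simp: F_def Q_def)
    thus ?thesis unfolding split using *(10)[of z] by (simp add: F_def Q_def algebra_simps)
  qed
  have "G z * exp (of_nat n * poly H z) = (if c1 then B1 z * exp (poly \<alpha>1 z) else 0) + (if c2 then B2 z * exp (poly \<alpha>2 z) else 0)" for z
  proof -
    let ?R = "\<lambda>i. real (degree (Q i - Q n)) \<le> \<tau>"
    define X where "X = (if c1 then B1 z * exp (poly \<alpha>1 z) else 0)"
    define Y where "Y = (if c2 then B2 z * exp (poly \<alpha>2 z) else 0)"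
    have "(\<Sum>i | i \<in> {..n+2} \<and> ?R i. F i z * exp (poly (Q i) z)) = 0"
      by (rule borel_independence_grouped[OF assms(1) _ F sum0]) auto
    also have "(\<Sum>i | i \<in> {..n+2} \<and> ?R i. F i z * exp (poly (Q i) z)) = (\<Sum>i\<in>{..n+2}. if ?R i then F i z * exp (poly (Q i) z) else 0)"
      using sum.inter_filter[of "{..n+2}" "\<lambda>i. F i z * exp (poly (Q i) z)" ?R] by simp
    also have "\<dots> = (\<Sum>i<n. if ?R i then F i z * exp (poly (Q i) z) else 0) + G z * exp (of_nat n * poly H z)
      - X - Y"
      unfolding split using assms(1) by (simp add: F_def Q_def c1_def c2_def X_def Y_def)
    also have "(\<Sum>i<n. if ?R i then F i z * exp (poly (Q i) z) else 0) = 0"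
    proof (intro sum.neutral ballI)
      fix i assume i: "i \<in> {..<n}"
      have "Q i - Q n = smult (of_nat i - of_nat n) H" using i by (simp add: Q_def smult_diff_left)
      moreover have "of_nat i - of_nat n \<noteq> (0::complex)" using i by simp
      ultimately have "degree (Q i - Q n) = degree H" by simp
      thus "(if ?R i then F i z * exp (poly (Q i) z) else 0) = 0" using H by simp
    qed
    finally have "G z * exp (of_nat n * poly H z) = X + Y" by (simp add: diff_diff_eq)
    thus ?thesis by (simp only: X_def Y_def)
  qed
  note key = this
  have "\<forall>\<^sub>\<approx>z\<in>UNIV. f z ^ n = (if c1 then ratfun_eval p1 z * exp (poly \<alpha>1 z) else 0)
     + (if c2 then ratfun_eval p2 z * exp (poly \<alpha>2 z) else 0)"
    using *(1,7,8,9)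
  proof eventually_elim
    case (elim z)
    have "E z * f z ^ n = E z * ((if c1 then ratfun_eval p1 z * exp (poly \<alpha>1 z) else 0)
     + (if c2 then ratfun_eval p2 z * exp (poly \<alpha>2 z) else 0))"
      using key[of z] elim by (auto simp: distrib_left mult.assoc)
    thus ?case using elim(1) mult_left_cancel by blast
  qed
  thus ?thesis by (rule that)
qed

text \<open>At a pole of g the power would tend to infinity, whereas V is finite there. So all
  singularities of g are removable.\<close>

lemma entire_root:
  assumes g: "g meromorphic_on UNIV" and V: "V holomorphic_on UNIV" and "n > 0"
    and eq: "\<forall>\<^sub>\<approx>z\<in>UNIV. g z ^ n = V z"
  obtains v where "v holomorphic_on UNIV" "\<forall>\<^sub>\<approx>z\<in>UNIV. g z = v z" "\<And>z. v z ^ n = V z"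
proof -
  have iso: "isolated_singularity_at g z" "not_essential g z" for z
    using g meromorphic_on_altdef by auto
  have np: "\<not> is_pole g z" for z
  proof
    assume "is_pole g z"
    hence "filterlim (\<lambda>z. norm (g z)) at_top (at z)"
      unfolding is_pole_def using filterlim_at_infinity_imp_norm_at_top by blast
    hence "filterlim (\<lambda>z. norm (g z) ^ n) at_top (at z)"
      by (rule filterlim_pow_at_top[OF \<open>n > 0\<close>])
    moreover have "eventually (\<lambda>z. g z ^ n = V z) (at z)" using eq by (simp add: eventually_cosparse_open_eq)
    hence ev: "eventually (\<lambda>z. norm (g z) ^ n = norm (V z)) (at z)"
      by eventually_elim (simp add: norm_power[symmetric])
    ultimately have "filterlim (\<lambda>z. norm (V z)) at_top (at z)"
      using filterlim_cong[OF refl refl ev] by simp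
    hence "is_pole V z" unfolding is_pole_def by (simp add: filterlim_at_infinity_conv_norm_at_top)
    moreover have "V analytic_on {z}" using V analytic_on_open[of UNIV V] analytic_on_subset by blast
    ultimately show False using analytic_at_imp_no_pole by blast
  qed
  define v where "v = remove_sings g"
  have "v analytic_on {z}" for z
  proof -
    obtain c where "g \<midarrow>z\<rightarrow> c" using iso(2)[of z] np[of z] by (auto simp: not_essential_def)
    thus ?thesis unfolding v_def by (rule remove_sings_analytic_at[OF iso(1)])
  qed
  hence v: "v holomorphic_on UNIV"
    by (intro analytic_imp_holomorphic) (use analytic_on_analytic_at in blast)
  have gv: "\<forall>\<^sub>\<approx>z\<in>UNIV. g z = v z"
    using eventually_remove_sings_eq[OF g] by eventually_elim (simp add: v_def)
  have "v z ^ n - V z = 0" for z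
  proof (rule entire_zero_of_cosparse[where F = "\<lambda>z. v z ^ n - V z"])
    show "\<forall>\<^sub>\<approx>z\<in>UNIV. v z ^ n - V z = 0" using gv eq by eventually_elim simp
  qed (intro holomorphic_intros v V)
  thus ?thesis using that[OF v gv] by simp
qed

text \<open>|v| \<le> 1 + |v|^n transfers the polynomial growth of the power to v, and Liouville's
  theorem concludes.\<close>

lemma polynomial_of_power:
  assumes v: "v holomorphic_on UNIV" "n > 0" and eq: "\<And>z. v z ^ n = poly q z"
  obtains w where "\<And>z. v z = poly w z"
proof -
  obtain S where S: "S \<ge> 0" "\<And>r z. r \<ge> 1 \<Longrightarrow> norm z \<le> r \<Longrightarrow> norm (poly q z) \<le> S * r powr real (degree q)"
    using norm_poly_le[of q "real (degree q)"] by auto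
  have "norm (v z) \<le> (1 + S) * norm z ^ degree q" if "1 \<le> norm z" for z
  proof -
    have "norm (v z) \<le> 1 + norm (v z) ^ n"
      using self_le_power[of "norm (v z)" n] \<open>n > 0\<close> by (cases "norm (v z) \<ge> 1") (auto simp: add_increasing2)
    also have "norm (v z) ^ n = norm (poly q z)" by (simp add: eq norm_power[symmetric])
    also have "\<dots> \<le> S * norm z ^ degree q"
      using S(2)[OF that order_refl] powr_realpow[OF less_le_trans[OF zero_less_one that], of "degree q"] by simp
    also have "1 \<le> norm z ^ degree q" using that by simp
    finally show ?thesis by (simp add: distrib_right)
  qed
  hence "v z = (\<Sum>k\<le>degree q. (deriv ^^ k) v 0 / fact k * z ^ k)" for z
    using Liouville_polynomial[OF v(1), of 1 "1 + S" "degree q" z] by simp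
  hence "v z = poly (\<Sum>k\<le>degree q. monom ((deriv ^^ k) v 0 / fact k) k) z" for z
    by (simp add: poly_sum poly_monom)
  thus ?thesis by (rule that)
qed

lemma meromorphic_on_poly_exp:
  assumes "f meromorphic_on UNIV" "n > 0"
  shows "(\<lambda>z. poly c z * f z * exp (- poly \<alpha> z / of_nat n)) meromorphic_on UNIV"
proof -
  have "(\<lambda>z. exp (- poly \<alpha> z / of_nat n)) holomorphic_on UNIV" "poly c holomorphic_on UNIV"
    using assms(2) by (auto intro!: holomorphic_intros)
  hence "(\<lambda>z. exp (- poly \<alpha> z / of_nat n)) meromorphic_on UNIV" "poly c meromorphic_on UNIV"
    by (auto intro!: analytic_on_imp_meromorphic_on simp: analytic_on_open)
  thus ?thesis by (intro meromorphic_on_mult assms)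
qed

lemma exp_scaled_power: "n > 0 \<Longrightarrow> exp (- (a :: complex) / of_nat n) ^ n = exp (- a)"
  by (simp add: exp_of_nat_mult[symmetric])

text \<open>Dividing by exp (\<alpha> / n) and clearing the denominator c turns f into a root of a
  polynomial, hence into a polynomial w; the rational root of p is w / c.\<close>

lemma root_of_exponential:
  assumes f: "f meromorphic_on UNIV" and "n > 0"
    and eq: "\<forall>\<^sub>\<approx>z\<in>UNIV. f z ^ n = ratfun_eval p z * exp (poly \<alpha> z)"
  obtains w c where "c \<noteq> 0" "Fract w c ^ n = p" 
    "\<forall>\<^sub>\<approx>z\<in>UNIV. f z = poly w z / poly c z * exp (poly \<alpha> z / of_nat n)"
    "\<forall>\<^sub>\<approx>z\<in>UNIV. f z = ratfun_eval (Fract w c) z * exp (poly \<alpha> z / of_nat n)"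
proof -
  obtain a c where p: "c \<noteq> 0" "p = Fract a c" "\<And>z. ratfun_eval p z = poly a z / poly c z" by (rule ratfunE[of p]) blast
  \<comment> \<open>One factor c is enough: c^n (a / c) = a c^(n-1) is a polynomial.\<close>
  define g where "g = (\<lambda>z. poly c z * f z * exp (- poly \<alpha> z / of_nat n))"
  have g: "g meromorphic_on UNIV" unfolding g_def using f \<open>n > 0\<close> by (rule meromorphic_on_poly_exp)
  have cnz: "\<forall>\<^sub>\<approx>z\<in>UNIV. poly c z \<noteq> 0" using p(1) by (rule poly_nonzero_cosparse)
  have "\<forall>\<^sub>\<approx>z\<in>UNIV. g z ^ n = poly (a * c ^ (n - 1)) z"
    using eq cnz
  proof eventually_elim
    case (elim z)
    obtain m where m: "n = Suc m" using \<open>n > 0\<close> by (cases n) auto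
    have "g z ^ n = poly c z ^ n * f z ^ n * exp (- poly \<alpha> z)"
      unfolding g_def power_mult_distrib exp_scaled_power[OF \<open>n > 0\<close>] ..
    also have "\<dots> = poly c z ^ n * (poly a z / poly c z)"
      unfolding elim(1) p(3) by (simp add: exp_minus)
    also have "\<dots> = poly (a * c ^ (n - 1)) z" using elim(2) by (simp add: m)
    finally show ?case .
  qed
  note gV = this
  have "poly (a * c ^ (n - 1)) holomorphic_on UNIV" by (intro holomorphic_intros)
  then obtain v where v: "v holomorphic_on UNIV" "\<forall>\<^sub>\<approx>z\<in>UNIV. g z = v z" "\<And>z. v z ^ n = poly (a * c ^ (n - 1)) z"
    by (rule entire_root[OF g _ \<open>n > 0\<close> gV]) (rule that)
  obtain w where w: "\<And>z. v z = poly w z" using polynomial_of_power[OF v(1) \<open>n > 0\<close> v(3)] by blast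
  have "poly (w ^ n) z = poly (a * c ^ (n - 1)) z" for z using v(3)[of z] by (simp add: w)
  hence wn: "w ^ n = a * c ^ (n - 1)" using poly_eq_poly_eq_iff by blast
  have "Fract w c ^ n = Fract (w ^ n) (c ^ n)" for n
    using p(1) by (induction n) (auto simp: One_fract_def)
  also have "Fract (w ^ n) (c ^ n) = p"
    using p(1) \<open>n > 0\<close> unfolding p(2) wn by (cases n) (auto simp: eq_fract)
  finally have 1: "Fract w c ^ n = p" .
  have 2: "\<forall>\<^sub>\<approx>z\<in>UNIV. f z = poly w z / poly c z * exp (poly \<alpha> z / of_nat n)"
    using v(2) cnz
  proof eventually_elim
    case (elim z)
    have "poly w z * exp (poly \<alpha> z / of_nat n) = poly c z * f z * (exp (- poly \<alpha> z / of_nat n) * exp (poly \<alpha> z / of_nat n))"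
      using elim(1) by (simp add: g_def w[symmetric] mult.assoc[symmetric])
    also have "exp (- poly \<alpha> z / of_nat n) * exp (poly \<alpha> z / of_nat n) = 1" by (simp add: exp_add[symmetric])
    finally have "poly w z * exp (poly \<alpha> z / of_nat n) = poly c z * f z" by simp
    thus ?case using elim(2) by (simp add: field_simps)
  qed
  have "\<forall>\<^sub>\<approx>z\<in>UNIV. f z = ratfun_eval (Fract w c) z * exp (poly \<alpha> z / of_nat n)"
    using 2 cnz by eventually_elim (simp add: ratfun_eval_Fract)
  thus ?thesis using that[OF p(1) 1 2] by blast
qed

text \<open>Differentiation lowers the degree. Speaking of a coefficient also covers constant p, for
  which the truncated degree p - 1 would not be smaller.\<close>

lemma coeff_pderiv_mult_eq_0:
  fixes p q :: "complex poly"
  assumes "k \<ge> degree p + degree q"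
  shows "coeff (pderiv p * q) k = 0"
proof (cases "degree p = 0")
  case True
  hence "pderiv p = 0" by (simp add: pderiv_eq_0_iff)
  thus ?thesis by simp
next
  case False
  have "degree (pderiv p * q) \<le> degree p - 1 + degree q"
    by (rule order_trans[OF degree_mult_le]) (simp add: degree_pderiv)
  also have "\<dots> < k" using False assms by simp
  finally show ?thesis by (rule coeff_eq_0)
qed

text \<open>All zeros of v are multiple zeros of the sum and lie among the finitely many roots of R.
  So v^n is a polynomial D times an exponential, and D exp \<Gamma> = P1 + P2 exp \<beta> is a
  three-term relation that Borel's theorem excludes. R is nonzero because P1 P2 \<beta>' has larger
  degree than P1' P2 - P2' P1.\<close>

lemma no_entire_root_of_exponential_sum:
  assumes v: "v holomorphic_on UNIV" and "n \<ge> 2" and P: "P1 \<noteq> 0" "P2 \<noteq> 0" and \<beta>: "degree \<beta> \<noteq> 0"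
    and eq: "\<And>z. v z ^ n = poly P1 z + poly P2 z * exp (poly \<beta> z)"
  shows False
proof -
  \<comment> \<open>eliminating \<open>exp \<beta>\<close> from \<open>P1 + P2 exp \<beta>\<close> and its derivative gives \<open>R\<close>, which therefore vanishes at
    the multiple zeros\<close>
  define R where "R = pderiv P1 * P2 - P1 * (pderiv P2 + P2 * pderiv \<beta>)"
  have half: "(0::real) < 1/2" by simp
  interpret half: growth_scale "1/2" "\<lambda>_. 0" by (rule growth_scale_0) simp
  have d\<beta>: "pderiv \<beta> \<noteq> 0" using \<beta> by (simp add: pderiv_eq_0_iff)
  have "R \<noteq> 0"
  proof
    assume "R = 0"
    hence "P1 * P2 * pderiv \<beta> = pderiv P1 * P2 - pderiv P2 * P1" by (simp add: R_def algebra_simps)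
    moreover define k where "k = degree P1 + degree P2 + degree (pderiv \<beta>)"
    have "coeff (pderiv P1 * P2 - pderiv P2 * P1) k = 0"
      by (simp add: coeff_pderiv_mult_eq_0 k_def)
    moreover have "degree (P1 * P2 * pderiv \<beta>) = k" using P d\<beta> by (simp add: degree_mult_eq k_def)
    ultimately have "lead_coeff (P1 * P2 * pderiv \<beta>) = 0" by simp
    thus False using P d\<beta> by simp
  qed
  have zero_R: "poly R z = 0" if "v z = 0" for z
  proof -
    obtain m where m: "n = Suc (Suc m)" using \<open>n \<ge> 2\<close> by (metis Suc_le_D add_2_eq_Suc le_Suc_ex)
    have "(v has_field_derivative deriv v z) (at z)" using v holomorphic_derivI by blast
    hence "((\<lambda>z. v z ^ n) has_field_derivative of_nat n * (deriv v z * v z ^ (n - Suc 0))) (at z)"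
      by (rule DERIV_power)
    hence "((\<lambda>z. v z ^ n) has_field_derivative 0) (at z)" using that by (simp add: m)
    moreover have "((\<lambda>z. poly P1 z + poly P2 z * exp (poly \<beta> z)) has_field_derivative
       (poly (pderiv P1) z + (poly (pderiv P2) z * exp (poly \<beta> z) + exp (poly \<beta> z) * poly (pderiv \<beta>) z * poly P2 z))) (at z)"
      by (intro DERIV_add DERIV_mult poly_DERIV DERIV_fun_exp)
    ultimately have 1: "poly (pderiv P1) z + (poly (pderiv P2) z * exp (poly \<beta> z) + exp (poly \<beta> z) * poly (pderiv \<beta>) z * poly P2 z) = 0"
      unfolding eq by (metis DERIV_unique)
    have 2: "poly P1 z + poly P2 z * exp (poly \<beta> z) = 0" using eq[of z] that m by simp
    have "poly R z * exp (poly \<beta> z) = 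
       poly (pderiv P1) z * (poly P1 z + poly P2 z * exp (poly \<beta> z))
       - poly P1 z * (poly (pderiv P1) z + (poly (pderiv P2) z * exp (poly \<beta> z) + exp (poly \<beta> z) * poly (pderiv \<beta>) z * poly P2 z))"
      by (simp add: R_def algebra_simps)
    thus ?thesis unfolding 1 2 by simp
  qed
  define Z where "Z = {z. poly R z = 0}"
  have finZ: "finite Z" unfolding Z_def using \<open>R \<noteq> 0\<close> by (rule poly_roots_finite)
  have "\<exists>w0. v w0 \<noteq> 0"
  proof (rule ccontr)
    assume *: "\<not> (\<exists>w0. v w0 \<noteq> 0)"
    have "- poly P1 z = poly P2 z * exp (poly \<beta> z)" for z
    proof -
      have "poly P1 z + poly P2 z * exp (poly \<beta> z) = 0" using eq[of z] * \<open>n \<ge> 2\<close> by (simp add: zero_power)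
      thus ?thesis by (rule minus_unique)
    qed
    moreover obtain w where "poly P2 w \<noteq> 0" using P(2) poly_all_0_iff_0 by blast
    ultimately have "real (degree \<beta>) \<le> 1/2"
      by (intro degree_le_of_exp_quotient[OF half half.exp_growth_uminus[OF half.exp_growth_poly] half.exp_growth_poly])
    thus False using \<beta> by simp
  qed
  then obtain w0 where w0: "v w0 \<noteq> 0" by blast
  obtain G k where G: "G holomorphic_on UNIV" "\<And>w. w \<in> Z \<Longrightarrow> G w \<noteq> 0" 
      "\<And>z. v z = (\<Prod>w\<in>Z. (z - w) ^ k w) * G z"
    using entire_factor_finite_zeros[OF finZ v w0] by metis
  have "G z \<noteq> 0" for z using G(2,3)[of z] zero_R[of z] by (cases "z \<in> Z") (auto simp: Z_def)
  then obtain g where g: "g holomorphic_on UNIV" "\<And>z. G z = exp (g z)"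
    using entire_exp_exists[OF G(1)] by metis
  define D where "D = (\<lambda>z. (\<Prod>w\<in>Z. (z - w) ^ k w) ^ n)"
  have vn: "poly P1 z + poly P2 z * exp (poly \<beta> z) = D z * exp (of_nat n * g z)" for z
    using eq[of z] by (simp add: G(3) g(2) D_def power_mult_distrib exp_of_nat_mult)
  have Dg: "order_growth \<tau> D" if "\<tau> > 0" for \<tau>
  proof -
    interpret growth_scale \<tau> "\<lambda>_. 0" using that by (rule growth_scale_0)
    show ?thesis unfolding D_def
      by (intro exp_growth_prod exp_growth_power exp_growth_diff exp_growth_ident exp_growth_const)
  qed
  have D0: "D w0 \<noteq> 0" using w0 G(3)[of w0] by (auto simp: D_def)
  define \<rho> where "\<rho> = real (degree \<beta>)"
  have \<rho>: "\<rho> > 0" using \<beta> by (simp add: \<rho>_def)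
  have "\<exists>\<Gamma>. \<forall>z. of_nat n * g z = poly \<Gamma> z"
  proof -
    interpret growth_scale \<rho> "\<lambda>_. 0" using \<rho> by (rule growth_scale_0)
    have "exp_growth (\<lambda>z. poly P1 z + poly P2 z * exp (poly \<beta> z))"
      by (intro exp_growth_add exp_growth_mult exp_growth_poly exp_growth_exp_poly) (simp add: \<rho>_def)
    moreover have "(\<lambda>z. of_nat n * g z) holomorphic_on UNIV" by (intro holomorphic_intros g)
    ultimately show ?thesis
      by (rule polynomial_of_exp_quotient[OF \<rho> _ Dg[OF \<rho>] D0 _ vn]) blast
  qed
  then obtain \<Gamma> where \<Gamma>: "\<And>z. of_nat n * g z = poly \<Gamma> z" by blast
  define F where "F = (\<lambda>i::nat. if i = 0 then D else if i = 1 then (\<lambda>z. - poly P1 z) else (\<lambda>z. - poly P2 z))"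
  define Q where "Q = (\<lambda>i::nat. if i = 0 then \<Gamma> else if i = 1 then 0 else \<beta>)"
  have F: "order_growth (1/2) (F i)" for i
    unfolding F_def using Dg[OF half] by (simp add: half.exp_growth_uminus half.exp_growth_poly)
  have sum0: "(\<Sum>i\<in>{0,1,2::nat}. F i z * exp (poly (Q i) z)) = 0" for z
    using vn[of z] by (simp add: F_def Q_def \<Gamma> algebra_simps)
  have group: "(\<Sum>i\<in>{0,1,2::nat}. if real (degree (Q i - Q k)) \<le> 1/2 then F i z * exp (poly (Q i) z) else 0) = 0"
    if "k \<in> {0,1,2}" for k z
  proof -
    have "(\<Sum>i | i \<in> {0,1,2} \<and> real (degree (Q i - Q k)) \<le> 1/2. F i z * exp (poly (Q i) z)) = 0"
      by (rule borel_independence_grouped[OF half _ F sum0 that]) auto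
    thus ?thesis
      using sum.inter_filter[of "{0,1,2::nat}" "\<lambda>i. F i z * exp (poly (Q i) z)" "\<lambda>i. real (degree (Q i - Q k)) \<le> 1/2"] by simp
  qed
  \<comment> \<open>Polynomials have growth of every positive order; any bound strictly between 0
    and 1, such as 1/2, groups the exponents modulo constants.\<close>
  have deg_half: "real d \<le> 1/2 \<longleftrightarrow> d = 0" for d :: nat by (cases d) auto
  obtain z1 where z1: "poly P1 z1 \<noteq> 0" using P(1) poly_all_0_iff_0 by blast
  obtain z2 where z2: "poly P2 z2 \<noteq> 0" using P(2) poly_all_0_iff_0 by blast
  \<comment> \<open>Otherwise the exponent 0 stands alone in its group, which would force P1 =
    0.\<close>
  have "degree \<Gamma> = 0"
  proof (rule ccontr)
    assume "degree \<Gamma> \<noteq> 0"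
    thus False using group[of 1 z1] z1 \<beta> unfolding deg_half by (simp add: F_def Q_def)
  qed
  then obtain c where "\<Gamma> = [:c:]" by (rule degree_eq_zeroE)
  moreover have "degree ([:c:] - \<beta>) = degree \<beta>"
    using \<beta> by (metis degree_minus degree_pCons_0 degree_add_eq_right diff_conv_add_uminus not_gr_zero)
  \<comment> \<open>Now \<Gamma> belongs to the group of 0, so \<beta> stands alone and P2 would
    vanish.\<close>
  ultimately show False using group[of 2 z2] z2 \<beta> unfolding deg_half by (simp add: F_def Q_def)
qed

text \<open>Multiplying f by b1 b2 exp (-\<alpha>1 / n) makes its n-th power the entire function P1
  + P2 exp (\<alpha>2 - \<alpha>1), to which the preceding impossibility applies.\<close>

lemma exponents_differ_by_constant:
  assumes f: "f meromorphic_on UNIV" and "n \<ge> 2" and p: "p1 \<noteq> 0" "p2 \<noteq> 0"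
    and eq: "\<forall>\<^sub>\<approx>z\<in>UNIV. f z ^ n = ratfun_eval p1 z * exp (poly \<alpha>1 z) + ratfun_eval p2 z * exp (poly \<alpha>2 z)"
  shows "degree (\<alpha>2 - \<alpha>1) = 0"
proof (rule ccontr)
  assume deg: "degree (\<alpha>2 - \<alpha>1) \<noteq> 0"
  have "n > 0" using \<open>n \<ge> 2\<close> by simp
  obtain a1 b1 where p1: "b1 \<noteq> 0" "p1 = Fract a1 b1" "\<And>z. ratfun_eval p1 z = poly a1 z / poly b1 z" by (rule ratfunE[of p1]) blast
  obtain a2 b2 where p2: "b2 \<noteq> 0" "p2 = Fract a2 b2" "\<And>z. ratfun_eval p2 z = poly a2 z / poly b2 z" by (rule ratfunE[of p2]) blast
  have a: "a1 \<noteq> 0" "a2 \<noteq> 0" using p p1 p2 by (auto simp: Zero_fract_def eq_fract)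
  define c where "c = b1 * b2"
  have c: "c \<noteq> 0" using p1 p2 by (simp add: c_def)
  define g where "g = (\<lambda>z. poly c z * f z * exp (- poly \<alpha>1 z / of_nat n))"
  have g: "g meromorphic_on UNIV" unfolding g_def using f \<open>n > 0\<close> by (rule meromorphic_on_poly_exp)
  define P1 where "P1 = c ^ (n - 1) * (a1 * b2)"
  define P2 where "P2 = c ^ (n - 1) * (a2 * b1)"
  define V where "V = (\<lambda>z. poly P1 z + poly P2 z * exp (poly (\<alpha>2 - \<alpha>1) z))"
  have gV: "\<forall>\<^sub>\<approx>z\<in>UNIV. g z ^ n = V z"
    using eq poly_nonzero_cosparse[OF c]
  proof eventually_elim
    case (elim z)
    obtain m where m: "n = Suc m" using \<open>n > 0\<close> by (cases n) auto
    have nz: "poly b1 z \<noteq> 0" "poly b2 z \<noteq> 0" using elim(2) by (auto simp: c_def)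
    have "g z ^ n = poly c z ^ n * f z ^ n * exp (- poly \<alpha>1 z)"
      unfolding g_def power_mult_distrib exp_scaled_power[OF \<open>n > 0\<close>] ..
    also have "\<dots> = poly c z ^ m * (poly c z * (poly a1 z / poly b1 z) * (exp (poly \<alpha>1 z) * exp (- poly \<alpha>1 z))
       + poly c z * (poly a2 z / poly b2 z) * (exp (poly \<alpha>2 z) * exp (- poly \<alpha>1 z)))"
      unfolding elim(1) p1(3) p2(3) unfolding m by (simp add: algebra_simps)
    also have "poly c z * (poly a1 z / poly b1 z) = poly (a1 * b2) z" using nz by (simp add: c_def)
    also have "poly c z * (poly a2 z / poly b2 z) = poly (a2 * b1) z" using nz by (simp add: c_def)
    also have "exp (poly \<alpha>1 z) * exp (- poly \<alpha>1 z) = 1" by (simp add: exp_minus)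
    also have "exp (poly \<alpha>2 z) * exp (- poly \<alpha>1 z) = exp (poly (\<alpha>2 - \<alpha>1) z)" by (simp add: exp_add[symmetric])
    finally show ?case by (simp add: V_def P1_def P2_def m distrib_left mult.assoc)
  qed
  have "V holomorphic_on UNIV" unfolding V_def by (intro holomorphic_intros)
  then obtain v where "v holomorphic_on UNIV" "\<forall>\<^sub>\<approx>z\<in>UNIV. g z = v z" "\<And>z. v z ^ n = V z"
    by (rule entire_root[OF g _ \<open>n > 0\<close> gV]) (rule that)
  thus False
    using no_entire_root_of_exponential_sum[of v n P1 P2 "\<alpha>2 - \<alpha>1"] \<open>n \<ge> 2\<close> a c p1(1) p2(1) deg
    by (simp add: V_def P1_def P2_def)
qed

text \<open>The general upper and lower estimates with polynomials as numerator and denominator. All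
  poles are roots of c, so the sum over the poles is finite, and 1/2 lies below every positive
  degree.\<close>

lemma growth_order_ratfun_exp:
  assumes f: "f meromorphic_on UNIV" and "c \<noteq> 0" "\<not> (\<forall>\<^sub>\<approx>z\<in>UNIV. f z = 0)" and Q: "degree Q \<noteq> 0"
    and eq: "\<forall>\<^sub>\<approx>z\<in>UNIV. f z = poly w z / poly c z * exp (poly Q z)"
  shows "growth_order f = ereal (real (degree Q))"
proof -
  have "w \<noteq> 0" using assms(3) eq by (auto elim!: eventually_mono)
  obtain w1 where w1: "poly w w1 \<noteq> 0" using \<open>w \<noteq> 0\<close> poly_all_0_iff_0 by blast
  obtain w2 where w2: "poly c w2 \<noteq> 0" using \<open>c \<noteq> 0\<close> poly_all_0_iff_0 by blast
  have og: "order_growth \<tau> (poly q)" if "\<tau> > 0" for \<tau> q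
    using growth_scale.exp_growth_poly[OF growth_scale_0[OF that]] .
  have pole: "poly c z = 0" if "is_pole f z" for z
  proof (rule ccontr)
    assume "poly c z \<noteq> 0"
    moreover have "poly p analytic_on {z}" for p :: "complex poly"
    proof -
      have "poly p holomorphic_on UNIV" by (intro holomorphic_intros)
      hence "poly p analytic_on UNIV" by (simp add: analytic_on_open)
      thus ?thesis by (rule analytic_on_subset) simp
    qed
    ultimately have "(\<lambda>z. poly w z / poly c z * exp (poly Q z)) analytic_on {z}"
      by (intro analytic_intros) auto
    hence "\<not> is_pole (\<lambda>z. poly w z / poly c z * exp (poly Q z)) z" by (rule analytic_at_imp_no_pole)
    moreover have "eventually (\<lambda>z. f z = poly w z / poly c z * exp (poly Q z)) (at z)"
      using eq by (simp add: eventually_cosparse_open_eq)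
    hence "is_pole f z \<longleftrightarrow> is_pole (\<lambda>z. poly w z / poly c z * exp (poly Q z)) z"
      by (rule is_pole_cong[OF _ refl])
    ultimately show False using that by blast
  qed
  have "finite {z. z \<noteq> 0 \<and> is_pole f z}"
    by (rule finite_subset[OF _ poly_roots_finite[OF \<open>c \<noteq> 0\<close>]]) (use pole in auto)
  hence summ: "(\<lambda>z. real (nat (- zorder f z)) * norm z powr (-(1/2))) summable_on {z. z \<noteq> 0 \<and> is_pole f z}"
    by (rule summable_on_finite)
  have pos: "0 < real (degree Q)" "1/2 < real (degree Q)" "1/2 \<le> real (degree Q)" using Q by auto
  have half: "(0::real) < 1/2" by simp
  show ?thesis
  proof (rule antisym)
    show "growth_order f \<le> ereal (real (degree Q))"
      by (rule growth_order_upper[OF pos(1) og[OF pos(1)] og[OF pos(1)] w2 order_refl eq f half pos(3) summ])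
    show "ereal (real (degree Q)) \<le> growth_order f"
      by (rule growth_order_lower[OF half og[OF half] og[OF half] w1 w2 pos(2) eq f summ])
  qed
qed

text \<open>Cancelling f^n against p1 exp \<alpha>1 leaves P(f) = p2 exp \<alpha>2. As f is a
  rational function times exp (\<alpha>1 / n), the left-hand side only has exponents j \<alpha>1 / n
  with j < n, and one of them must agree with \<alpha>2 up to a constant.\<close>

lemma single_exponential_case:
  assumes f: "f meromorphic_on UNIV" "\<not> (\<forall>\<^sub>\<approx>z\<in>UNIV. f z = 0)" and n: "diffpoly_degree P < n"
    and \<alpha>: "degree \<alpha>1 \<noteq> 0" "degree \<alpha>2 \<noteq> 0" and "p2 \<noteq> 0"
    and eq: "\<forall>\<^sub>\<approx>z\<in>UNIV. f z ^ n + diffpoly_eval P f z =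
           ratfun_eval p1 z * exp (poly \<alpha>1 z) + ratfun_eval p2 z * exp (poly \<alpha>2 z)"
    and pow: "\<forall>\<^sub>\<approx>z\<in>UNIV. f z ^ n = ratfun_eval p1 z * exp (poly \<alpha>1 z)"
  obtains s k where "s ^ n = p1" "\<forall>\<^sub>\<approx>z\<in>UNIV. f z = ratfun_eval s z * exp (poly \<alpha>1 z / of_nat n)"
    "1 \<le> k" "k < n" "smult (of_nat k) (pderiv \<alpha>1) = smult (of_nat n) (pderiv \<alpha>2)"
    "degree \<alpha>1 = degree \<alpha>2" "growth_order f = ereal (real (degree \<alpha>1))"
proof -
  have "n > 0" using n by simp
  hence n0: "(of_nat n :: complex) \<noteq> 0" by simp
  obtain w c where wc: "c \<noteq> 0" "Fract w c ^ n = p1" 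
    "\<forall>\<^sub>\<approx>z\<in>UNIV. f z = poly w z / poly c z * exp (poly \<alpha>1 z / of_nat n)"
    "\<forall>\<^sub>\<approx>z\<in>UNIV. f z = ratfun_eval (Fract w c) z * exp (poly \<alpha>1 z / of_nat n)"
    by (rule root_of_exponential[OF f(1) \<open>n > 0\<close> pow]) (rule that)
  define H where "H = smult (1 / of_nat n) \<alpha>1"
  have fH: "\<forall>\<^sub>\<approx>z\<in>UNIV. f z = poly w z / poly c z * exp (poly H z)"
    using wc(3) by (simp add: H_def)
  have degH: "degree H = degree \<alpha>1" using n0 by (simp add: H_def)
  have ord: "growth_order f = ereal (real (degree \<alpha>1))"
    using growth_order_ratfun_exp[OF f(1) wc(1) f(2) _ fH] \<alpha>(1) degH by simp
  have "w \<noteq> 0" using f(2) fH by (auto elim!: eventually_mono)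
  obtain w1 where w1: "poly w w1 \<noteq> 0" using \<open>w \<noteq> 0\<close> poly_all_0_iff_0 by blast
  obtain w2 where w2: "poly c w2 \<noteq> 0" using wc(1) poly_all_0_iff_0 by blast
  have half: "(0::real) < 1/2" by simp
  interpret growth_scale "1/2" "\<lambda>_. 0" by (rule growth_scale_0) simp
  have h: "poly H holomorphic_on UNIV" by (intro holomorphic_intros)
  have h': "exp_growth (deriv (poly H))" by (intro exp_growth_deriv exp_growth_poly)
  obtain E G A B1 B2 where *: "\<forall>\<^sub>\<approx>z\<in>UNIV. E z \<noteq> 0" "\<forall>\<^sub>\<approx>z\<in>UNIV. G z \<noteq> 0"
    "exp_growth G" "\<And>j. exp_growth (A j)" "exp_growth B1" "exp_growth B2"
    "\<forall>\<^sub>\<approx>z\<in>UNIV. G z * exp (of_nat n * poly H z) = E z * f z ^ n"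
    "\<forall>\<^sub>\<approx>z\<in>UNIV. B1 z = E z * ratfun_eval p1 z" "\<forall>\<^sub>\<approx>z\<in>UNIV. B2 z = E z * ratfun_eval p2 z"
    "\<And>z. G z * exp (of_nat n * poly H z) + (\<Sum>j<n. A j z * exp (of_nat j * poly H z)) =
       B1 z * exp (poly \<alpha>1 z) + B2 z * exp (poly \<alpha>2 z)"
    by (rule main_equation[OF exp_growth_poly exp_growth_poly h' h w1 w2 fH n eq]) (rule that)
  define F where "F = (\<lambda>j. if j < n then A j else (\<lambda>z. - B2 z))"
  define Q where "Q = (\<lambda>j. if j < n then smult (of_nat j) H else \<alpha>2)"
  have F: "exp_growth (F j)" for j unfolding F_def using * by (simp add: exp_growth_uminus)
  have sum0: "(\<Sum>i\<in>{..n}. F i z * exp (poly (Q i) z)) = 0" for z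
  proof (rule entire_zero_of_cosparse[where F = "\<lambda>z. \<Sum>i\<in>{..n}. F i z * exp (poly (Q i) z)"])
    show "(\<lambda>z. \<Sum>i\<in>{..n}. F i z * exp (poly (Q i) z)) holomorphic_on UNIV"
      by (intro holomorphic_intros exp_growth_holomorphic[OF F])
    show "\<forall>\<^sub>\<approx>z\<in>UNIV. (\<Sum>i\<in>{..n}. F i z * exp (poly (Q i) z)) = 0"
      using *(7,8) pow
    proof eventually_elim
      case (elim z)
      have "(\<Sum>i\<in>{..n}. F i z * exp (poly (Q i) z)) = (\<Sum>i<n. F i z * exp (poly (Q i) z)) - B2 z * exp (poly \<alpha>2 z)"
        unfolding lessThan_Suc_atMost[symmetric] by (simp add: F_def Q_def)
      also have "(\<Sum>i<n. F i z * exp (poly (Q i) z)) = (\<Sum>j<n. A j z * exp (of_nat j * poly H z))"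
        by (intro sum.cong) (auto simp: F_def Q_def)
      also have "G z * exp (of_nat n * poly H z) = B1 z * exp (poly \<alpha>1 z)"
        unfolding elim by (simp add: mult.assoc)
      hence "(\<Sum>j<n. A j z * exp (of_nat j * poly H z)) = B2 z * exp (poly \<alpha>2 z)"
        using *(10)[of z] by simp
      finally show ?case by simp
    qed
  qed
  \<comment> \<open>Otherwise \<alpha>2 forms a group of its own and its coefficient
    \<open>B2\<close> vanishes, contrary to p2 being nonzero.\<close>
  have "\<exists>k<n. real (degree (Q k - Q n)) \<le> 1/2"
  proof (rule ccontr)
    assume neg: "\<not> ?thesis"
    have "B2 z = 0" for z
    proof -
      have "(\<Sum>i | i \<in> {..n} \<and> real (degree (Q i - Q n)) \<le> 1/2. F i z * exp (poly (Q i) z)) = 0"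
        by (rule borel_independence_grouped[OF half _ F sum0]) auto
      also have "{i. i \<in> {..n} \<and> real (degree (Q i - Q n)) \<le> 1/2} = {n}"
        using neg by (auto simp: le_less)
      finally show ?thesis by (simp add: F_def)
    qed
    obtain a b where p2: "b \<noteq> 0" "p2 = Fract a b" "\<And>z. ratfun_eval p2 z = poly a z / poly b z" by (rule ratfunE[of p2]) blast
    have "a \<noteq> 0" using \<open>p2 \<noteq> 0\<close> p2 by (auto simp: Zero_fract_def eq_fract)
    have "\<forall>\<^sub>\<approx>z\<in>(UNIV::complex set). False"
      using *(1,9) poly_nonzero_cosparse[OF \<open>a \<noteq> 0\<close>] poly_nonzero_cosparse[OF p2(1)]
      by eventually_elim (simp add: \<open>\<And>z. B2 z = 0\<close> p2(3))
    thus False using cosparse_ex by blast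
  qed
  then obtain k where k: "k < n" "real (degree (Q k - Q n)) \<le> 1/2" by blast
  have "degree (Q k - Q n) = 0" using k(2) by (cases "degree (Q k - Q n)") auto
  hence "pderiv (Q k - Q n) = 0" by (simp add: pderiv_eq_0_iff)
  hence pd2: "smult (of_nat k) (pderiv H) = pderiv \<alpha>2" using k(1) by (simp add: Q_def pderiv_diff pderiv_smult)
  have eqk: "smult (of_nat n) (pderiv \<alpha>2) = smult (of_nat k) (pderiv \<alpha>1)"
    unfolding pd2[symmetric] H_def pderiv_smult smult_smult using n0 by simp
  have "pderiv \<alpha>2 \<noteq> 0" using \<alpha>(2) by (simp add: pderiv_eq_0_iff)
  \<comment> \<open>For k = 0 the polynomial \<alpha>2 would be constant.\<close>
  have k0: "k \<noteq> 0"
  proof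
    assume "k = 0"
    thus False using eqk n0 \<open>pderiv \<alpha>2 \<noteq> 0\<close> by (simp del: of_nat_eq_0_iff)
  qed
  have "degree (smult (of_nat n) (pderiv \<alpha>2)) = degree (smult (of_nat k) (pderiv \<alpha>1))" using eqk by simp
  hence "degree \<alpha>1 - 1 = degree \<alpha>2 - 1" using k0 \<open>n > 0\<close> by (simp add: degree_pderiv)
  hence "degree \<alpha>1 = degree \<alpha>2" using \<alpha> by simp
  thus ?thesis using that[OF wc(2,4) _ k(1) eqk[symmetric] _ ord] k0 by simp
qed

section \<open>Exponents of convergence, and the conclusion\<close>

lemma finite_of_summable_ge_one:
  fixes g :: "'a \<Rightarrow> real"
  assumes "g summable_on A" "\<And>x. x \<in> A \<Longrightarrow> g x \<ge> 1"
  shows "finite A"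
proof (rule ccontr)
  assume "infinite A"
  obtain N :: nat where N: "real N > infsum g A" using reals_Archimedean2 by blast
  obtain F where F: "F \<subseteq> A" "finite F" "card F = N"
    using infinite_arbitrarily_large[OF \<open>infinite A\<close>] by metis
  have "real N = (\<Sum>x\<in>F. 1)" using F by simp
  also have "\<dots> \<le> sum g F" using F assms(2) by (intro sum_mono) auto
  also have "\<dots> \<le> infsum g A" using F assms by (intro finite_sum_le_infsum) force+
  finally show False using N by simp
qed

text \<open>The infimum may be witnessed by the exponent 0, whereas growth classes require a
  positive one. In that case any positive exponent below the bound does.\<close>

lemma conv_exponent_lessD:
  assumes f: "f meromorphic_on UNIV" and less: "conv_exponent f < x"
  obtains \<tau> where "0 < \<tau>" "ereal \<tau> < x"
    "(\<lambda>z. real (nat (zorder f z)) * norm z powr (-\<tau>)) summable_on {z. z \<noteq> 0 \<and> isolated_zero f z}"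
proof -
  obtain \<sigma> where \<sigma>: "\<sigma> \<ge> 0" "ereal \<sigma> < x"
    "(\<lambda>z. real (nat (zorder f z)) * norm z powr (-\<sigma>)) summable_on {z. z \<noteq> 0 \<and> isolated_zero f z}"
    using less unfolding conv_exponent_def by (auto simp: Inf_less_iff)
  show ?thesis
  proof (cases "\<sigma> = 0")
    case False
    thus ?thesis using \<sigma> that[of \<sigma>] by simp
  next
    case True
    \<comment> \<open>summability with exponent \<open>0\<close> means that there are only finitely many zeros\<close>
    have "finite {z. z \<noteq> 0 \<and> isolated_zero f z}"
    proof (rule finite_of_summable_ge_one[OF \<sigma>(3)])
      fix z assume z: "z \<in> {z. z \<noteq> 0 \<and> isolated_zero f z}"
      have "isolated_singularity_at f z" using f meromorphic_on_altdef by auto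
      hence "zorder f z > 0" using z by (intro zorder_isolated_zero_pos') auto
      thus "1 \<le> real (nat (zorder f z)) * norm z powr (-\<sigma>)" using z True by simp
    qed
    moreover obtain y where "ereal 0 < ereal y" "ereal y < x" using \<sigma>(2) True ereal_dense2 by blast
    ultimately show ?thesis using that[of y] by simp
  qed
qed

lemma conv_exponent_poles_lessD:
  assumes f: "f meromorphic_on UNIV" "\<forall>\<^sub>\<approx>z\<in>UNIV. f z \<noteq> 0" and less: "conv_exponent (\<lambda>z. 1 / f z) < x"
  obtains \<tau> where "0 < \<tau>" "ereal \<tau> < x"
    "(\<lambda>z. real (nat (- zorder f z)) * norm z powr (-\<tau>)) summable_on {z. z \<noteq> 0 \<and> is_pole f z}"
proof -
  have iz: "isolated_zero (\<lambda>z. 1 / f z) z \<longleftrightarrow> is_pole f z" for z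
    using isolated_zero_inverse_iff[of f z] by (simp add: inverse_eq_divide)
  have zo: "zorder (\<lambda>z. 1 / f z) z = - zorder f z" for z
  proof -
    have "eventually (\<lambda>z. f z \<noteq> 0) (at z)" using f(2) by (simp add: eventually_cosparse_open_eq)
    hence "frequently (\<lambda>z. f z \<noteq> 0) (at z)" by (intro eventually_frequently) auto
    hence "zorder (\<lambda>z. inverse (f z)) z = - zorder f z"
      using f(1) by (intro zorder_inverse) (auto simp: meromorphic_on_altdef)
    thus ?thesis by (simp add: inverse_eq_divide)
  qed
  have "(\<lambda>z. 1 / f z) meromorphic_on UNIV" by (intro meromorphic_intros f)
  from conv_exponent_lessD[OF this less] show ?thesis unfolding iz zo using that by blast
qed

theorem theorem1p3:
  fixes n :: nat and P :: diffpoly and \<alpha>1 \<alpha>2 :: "complex poly" and p1 p2 :: ratfun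
    and f :: "complex \<Rightarrow> complex"
  assumes "n \<ge> 2"
    and "diffpoly_degree P = n - 1"
    and "degree \<alpha>1 \<noteq> 0" and "degree \<alpha>2 \<noteq> 0"
    and "p1 \<noteq> 0" and "p2 \<noteq> 0"
    and "transcendental_meromorphic f"
    and "\<forall>\<^sub>\<approx>z\<in>UNIV. f z ^ n + diffpoly_eval P f z =
           ratfun_eval p1 z * exp (poly \<alpha>1 z) + ratfun_eval p2 z * exp (poly \<alpha>2 z)"
    and "max (conv_exponent f) (conv_exponent (\<lambda>z. 1 / f z)) < growth_order f"
  shows "growth_order f = ereal (real (degree \<alpha>1)) \<and> degree \<alpha>1 = degree \<alpha>2 \<and>
    ((pderiv \<alpha>2 = pderiv \<alpha>1 \<and>
      (\<exists>c2 s1 s2. c2 \<noteq> 0 \<and> (\<forall>z. exp (poly \<alpha>2 z - poly \<alpha>1 z) = c2) \<and>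
         s1 ^ n = p1 + p2 * ratfun_const c2 \<and>
         s2 ^ n = ratfun_const (1 / c2) * p1 + p2 \<and>
         (\<forall>\<^sub>\<approx>z\<in>UNIV. f z = ratfun_eval s1 z * exp (poly \<alpha>1 z / of_nat n)) \<and>
         (\<forall>\<^sub>\<approx>z\<in>UNIV. f z = ratfun_eval s2 z * exp (poly \<alpha>2 z / of_nat n))))
     \<or> (\<exists>k1::int. 1 \<le> k1 \<and> k1 \<le> int n - 1 \<and>
         smult (of_int k1) (pderiv \<alpha>1) = smult (of_nat n) (pderiv \<alpha>2) \<and>
         (\<exists>s3. s3 ^ n = p1 \<and>
           (\<forall>\<^sub>\<approx>z\<in>UNIV. f z = ratfun_eval s3 z * exp (poly \<alpha>1 z / of_nat n))))
     \<or> (\<exists>k2::int. 1 \<le> k2 \<and> k2 \<le> int n - 1 \<and>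
         smult (of_int k2) (pderiv \<alpha>2) = smult (of_nat n) (pderiv \<alpha>1) \<and>
         (\<exists>s4. s4 ^ n = p2 \<and>
           (\<forall>\<^sub>\<approx>z\<in>UNIV. f z = ratfun_eval s4 z * exp (poly \<alpha>2 z / of_nat n)))))"
    (is "?ord \<and> ?deg \<and> (?I \<or> ?II \<or> ?III)")
proof -
  have n: "diffpoly_degree P < n" "n > 0" using assms(1,2) by auto
  have mero: "f meromorphic_on UNIV" using assms(7) by (simp add: transcendental_meromorphic_def)
  have f0: "\<not> (\<forall>\<^sub>\<approx>z\<in>UNIV. f z = 0)"
    using assms(7) unfolding transcendental_meromorphic_def by (auto dest: spec[of _ 0] simp: ratfun_eval_def)
  hence fnz: "\<forall>\<^sub>\<approx>z\<in>UNIV. f z \<noteq> 0"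
    using meromorphic_imp_constant_or_avoid[OF mero open_UNIV connected_UNIV, of 0] by blast
  obtain \<tau>1 where \<tau>1: "0 < \<tau>1" "ereal \<tau>1 < growth_order f"
    "(\<lambda>z. real (nat (zorder f z)) * norm z powr (-\<tau>1)) summable_on {z. z \<noteq> 0 \<and> isolated_zero f z}"
    using conv_exponent_lessD[OF mero, of "growth_order f"] assms(9) by auto
  obtain \<tau>2 where \<tau>2: "0 < \<tau>2" "ereal \<tau>2 < growth_order f"
    "(\<lambda>z. real (nat (- zorder f z)) * norm z powr (-\<tau>2)) summable_on {z. z \<noteq> 0 \<and> is_pole f z}"
    using conv_exponent_poles_lessD[OF mero fnz, of "growth_order f"] assms(9) by auto
  define \<tau> where "\<tau> = max \<tau>1 \<tau>2"
  have \<tau>: "0 < \<tau>" "\<tau>1 \<le> \<tau>" "\<tau>2 \<le> \<tau>" "ereal \<tau> < growth_order f"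
    using \<tau>1 \<tau>2 by (auto simp: \<tau>_def max_def)
  obtain d1 d2 h w1 w2 where d: "order_growth \<tau> d1" "order_growth \<tau> d2" "h holomorphic_on UNIV"
    "d1 w1 \<noteq> 0" "d2 w2 \<noteq> 0" "\<forall>\<^sub>\<approx>z\<in>UNIV. f z = d1 z / d2 z * exp (h z)"
    by (rule meromorphic_factorization[OF mero f0 \<tau>1(1) \<tau>(2) \<tau>2(1) \<tau>(3) \<tau>1(3) \<tau>2(3)]) (rule that)
  obtain H where H: "\<And>z. h z = poly H z"
    using exponent_polynomial[OF \<tau>(1) d n(1) assms(8)] by blast
  have fH: "\<forall>\<^sub>\<approx>z\<in>UNIV. f z = d1 z / d2 z * exp (poly H z)" using d(6) by (simp add: H)
  \<comment> \<open>If the degree were at most \<tau>, the factorisation would give f order at most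
    \<tau>, contrary to the choice of \<tau> below the order.\<close>
  have degH: "\<tau> < real (degree H)"
  proof (rule ccontr)
    assume "\<not> ?thesis"
    hence "growth_order f \<le> ereal \<tau>"
      by (intro growth_order_upper[OF \<tau>(1) d(1,2,5) _ fH mero \<tau>2(1) \<tau>(3) \<tau>2(3)]) simp
    thus False using \<tau>(4) by simp
  qed
  obtain c1 c2 where pow: "\<forall>\<^sub>\<approx>z\<in>UNIV. f z ^ n = (if c1 then ratfun_eval p1 z * exp (poly \<alpha>1 z) else 0)
     + (if c2 then ratfun_eval p2 z * exp (poly \<alpha>2 z) else 0)"
    by (rule leading_power_cases[OF \<tau>(1) d(1,2,4,5) fH degH n(1) assms(8)]) (rule that)
  \<comment> \<open>The first three alternatives lead to (I), (II) and (III); the last would make f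
    vanish.\<close>
  consider "c1" "c2" | "c1" "\<not> c2" | "\<not> c1" "c2" | "\<not> c1" "\<not> c2" by blast
  thus ?thesis
  proof cases
    case 1
    have pow': "\<forall>\<^sub>\<approx>z\<in>UNIV. f z ^ n = ratfun_eval p1 z * exp (poly \<alpha>1 z) + ratfun_eval p2 z * exp (poly \<alpha>2 z)"
      using pow 1 by simp
    have "degree (\<alpha>2 - \<alpha>1) = 0" by (rule exponents_differ_by_constant[OF mero assms(1,5,6) pow'])
    then obtain b where b: "\<alpha>2 - \<alpha>1 = [:b:]" by (rule degree_eq_zeroE)
    hence \<alpha>2: "\<alpha>2 = \<alpha>1 + [:b:]" by (simp add: algebra_simps)
    define C where "C = exp b"
    have C: "C \<noteq> 0" "\<And>z. exp (poly \<alpha>2 z - poly \<alpha>1 z) = C" by (simp_all add: C_def \<alpha>2)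
    have e2: "exp (poly \<alpha>2 z) = C * exp (poly \<alpha>1 z)" for z by (simp add: C_def \<alpha>2 exp_add)
    have pd: "pderiv \<alpha>2 = pderiv \<alpha>1" by (simp add: \<alpha>2 pderiv_add pderiv_pCons)
    have deg: "degree \<alpha>1 = degree \<alpha>2"
      using assms(3) by (simp add: \<alpha>2 degree_add_eq_left)
    have p1C: "p1 + p2 * ratfun_const C = ratfun_const 1 * p1 + ratfun_const C * p2"
      by (simp add: mult.commute)
    have pow1: "\<forall>\<^sub>\<approx>z\<in>UNIV. f z ^ n = ratfun_eval (p1 + p2 * ratfun_const C) z * exp (poly \<alpha>1 z)"
      unfolding p1C using pow' ratfun_eval_add_mult_const[of 1 p1 C p2]
    proof eventually_elim
      case (elim z)
      show ?case unfolding elim e2 by (simp add: algebra_simps)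
    qed
    obtain w c where wc: "c \<noteq> 0" "Fract w c ^ n = p1 + p2 * ratfun_const C" 
      "\<forall>\<^sub>\<approx>z\<in>UNIV. f z = poly w z / poly c z * exp (poly \<alpha>1 z / of_nat n)"
      "\<forall>\<^sub>\<approx>z\<in>UNIV. f z = ratfun_eval (Fract w c) z * exp (poly \<alpha>1 z / of_nat n)"
      by (rule root_of_exponential[OF mero n(2) pow1]) (rule that)
    have p2C: "ratfun_const (1 / C) * p1 + p2 = ratfun_const (1 / C) * p1 + ratfun_const 1 * p2" by simp
    \<comment> \<open>The same power is expressed through \<alpha>2, since exp \<alpha>2 = C exp
      \<alpha>1; extracting its root separately yields \<open>s2\<close>.\<close>
    have pow2: "\<forall>\<^sub>\<approx>z\<in>UNIV. f z ^ n = ratfun_eval (ratfun_const (1 / C) * p1 + p2) z * exp (poly \<alpha>2 z)"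
      unfolding p2C using pow' ratfun_eval_add_mult_const[of "1 / C" p1 1 p2]
    proof eventually_elim
      case (elim z)
      have "a * e + b * (C * e) = (1 / C * a + 1 * b) * (C * e)" for a b e
        using C(1) by (simp add: distrib_right)
      thus ?case unfolding elim e2 .
    qed
    obtain w' c' where wc': "c' \<noteq> 0" "Fract w' c' ^ n = ratfun_const (1 / C) * p1 + p2" 
      "\<forall>\<^sub>\<approx>z\<in>UNIV. f z = poly w' z / poly c' z * exp (poly \<alpha>2 z / of_nat n)"
      "\<forall>\<^sub>\<approx>z\<in>UNIV. f z = ratfun_eval (Fract w' c') z * exp (poly \<alpha>2 z / of_nat n)"
      by (rule root_of_exponential[OF mero n(2) pow2]) (rule that)
    have "growth_order f = ereal (real (degree (smult (1 / of_nat n) \<alpha>1)))"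
      by (rule growth_order_ratfun_exp[OF mero wc(1) f0]) (use wc(3) assms(3) n in auto)
    hence ?ord using n by simp
    moreover have ?I using pd C wc(2,4) wc'(2,4) by blast
    ultimately show ?thesis using deg by blast
  next
    case 2
    hence pow': "\<forall>\<^sub>\<approx>z\<in>UNIV. f z ^ n = ratfun_eval p1 z * exp (poly \<alpha>1 z)" using pow by simp
    obtain s k where s: "s ^ n = p1" "\<forall>\<^sub>\<approx>z\<in>UNIV. f z = ratfun_eval s z * exp (poly \<alpha>1 z / of_nat n)"
      "1 \<le> k" "k < n" "smult (of_nat k) (pderiv \<alpha>1) = smult (of_nat n) (pderiv \<alpha>2)"
      "degree \<alpha>1 = degree \<alpha>2" "growth_order f = ereal (real (degree \<alpha>1))"
      by (rule single_exponential_case[OF mero f0 n(1) assms(3,4,6,8) pow']) (rule that)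
    have "1 \<le> int k" "int k \<le> int n - 1" "smult (of_int (int k)) (pderiv \<alpha>1) = smult (of_nat n) (pderiv \<alpha>2)"
      using s by auto
    hence ?II using s(1,2) by blast
    thus ?thesis using s by blast
  next
    case 3
    hence pow': "\<forall>\<^sub>\<approx>z\<in>UNIV. f z ^ n = ratfun_eval p2 z * exp (poly \<alpha>2 z)" using pow by simp
    have eq': "\<forall>\<^sub>\<approx>z\<in>UNIV. f z ^ n + diffpoly_eval P f z =
           ratfun_eval p2 z * exp (poly \<alpha>2 z) + ratfun_eval p1 z * exp (poly \<alpha>1 z)"
      using assms(8) by (simp only: add.commute[of "ratfun_eval p2 _ * _"])
    obtain s k where s: "s ^ n = p2" "\<forall>\<^sub>\<approx>z\<in>UNIV. f z = ratfun_eval s z * exp (poly \<alpha>2 z / of_nat n)"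
      "1 \<le> k" "k < n" "smult (of_nat k) (pderiv \<alpha>2) = smult (of_nat n) (pderiv \<alpha>1)"
      "degree \<alpha>2 = degree \<alpha>1" "growth_order f = ereal (real (degree \<alpha>2))"
      by (rule single_exponential_case[OF mero f0 n(1) assms(4,3,5) eq' pow']) (rule that)
    have "1 \<le> int k" "int k \<le> int n - 1" "smult (of_int (int k)) (pderiv \<alpha>2) = smult (of_nat n) (pderiv \<alpha>1)"
      using s by auto
    hence ?III using s(1,2) by blast
    moreover have ?ord ?deg using s by simp_all
    ultimately show ?thesis by blast
  next
    case 4
    have "\<forall>\<^sub>\<approx>z\<in>UNIV. f z = 0" using pow by eventually_elim (use 4 n in simp)
    thus ?thesis using f0 by blast
  qed
qed

end
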